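(* Let $(C,o)$ be a complex analytic isolated curve singularity with $r$ irreducible components, and let $\mathbf{PE}_1(\mathbf T,Q,h)$ and $P^m(\mathbf t,q)$ be the series defined in the context. (a) $$\mathbf{PE}_1(\mathbf T,Q,h)\big|_{T_i\to t_i\sqrt q,\ Q\to\sqrt q,\ h\to-\sqrt q}=P^m(\mathbf t,q).$$ (b) Write $P^m(\mathbf t,q)=\sum_l\mathfrak p^m_l(q)\cdot\mathbf t^l$. Then each $\mathfrak p^m_l(q)$ can be written in a unique way in the form $$\mathfrak p^m_l(q)=\sum_{k\in\mathbb Z_{\ge0}}\mathfrak p^m_{l,k}\,q^{k+\mathfrak h(l)},\qquad \mathfrak p^m_{l,k}\in\mathbb Z.$$ (c) With $P^m(\mathbf t,q)=\sum_l\sum_{k\in\mathbb Z_{\ge0}}\mathfrak p^m_{l,k}\,q^{k+\mathfrak h(l)}\cdot\mathbf t^l$ written in this form, $$\mathbf{PE}_1(\mathbf T,Q,h)=\sum_l\sum_{k\in\mathbb Z_{\ge0}}\mathfrak p^m_{l,k}\,\mathbf T^lQ^{w(l)}\cdot(-Qh)^k.$$ (d) $\mathbf{PE}_1$ is a rational function of type $$\overline{\mathbf{PE}_1}(\mathbf T,Q,h)\Big/\prod_{i=1}^r(1-T_iQ),\qquad\text{where }\ \overline{\mathbf{PE}_1}(\mathbf T,Q,h)\in\mathbb Z[\mathbf T,Q,Q^{-1},h].$$ (e) If $(C,o)$ is Gorenstein, with conductor $c=(c_1,\dots,c_r)$, then after the substitution $h=-Q$ one has the symmetry $$\overline{\mathbf{PE}_1}(\mathbf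 T,Q,h=-Q)\big|_{T_i\to T_i^{-1}}=\prod_iT_i^{-c_i}\cdot\overline{\mathbf{PE}_1}(\mathbf T,Q,h=-Q).$$
   Context: Let $(C,o)$ be a complex analytic isolated curve singularity with local ring $\mathcal{O}$ and irreducible components $(C_1,o),\dots,(C_r,o)$. Let $\overline{\mathcal{O}}=\bigoplus_{i=1}^r\mathbb{C}\{t_i\}$ be the integral closure of $\mathcal O$ and $\mathfrak{v}_i(f)=\mathrm{ord}_{t_i}(f)\in\mathbb{Z}_{\ge0}\cup\{\infty\}$ the $i$-th valuation. The conductor ideal $(\mathcal O:\overline{\mathcal O})$ has the form $(t_1^{c_1},\dots,t_r^{c_r})\overline{\mathcal O}$, and $c=(c_1,\dots,c_r)$ is called the conductor. For $l\in(\mathbb{Z}_{\ge0})^r$ put $\mathcal F(l)=\{f\in\mathcal O:\mathfrak v_i(f)\ge l_i\ \forall i\}$, $\mathfrak h(l)=\dim_{\mathbb C}\mathcal O/\mathcal F(l)$ (Hilbert function), $|l|=\sum_i l_i$, and $w(l)=2\mathfrak h(l)-|l|$. Inequalities between vectors are coordinatewise. Let $E_1,\dots,E_r$ be the standard basis of $\mathbb Z^r$ and $E_J=\sum_{i\in J}E_i$. Multi-index notation: $\mathbf t^l=t_1^{l_1}\cdots t_r^{l_r}$, $\mathbf T^l=T_1^{l_1}\cdots T_r^{l_r}$. Motivic Poincaré series: $P^m(\mathbf t,q)=\sum_{l\in(\mathbb Z_{\ge0})^r}\mathfrak p^m_l(q)\,\mathbf t^l$ with $$\mathfrak p^m_l(q)=\sum_{J\subset\{1,\dots,r\}}(-1)^{|J|}\cdot\frac{q^{\mathfrak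 h(l+E_J)}-q^{\mathfrak h(l)}}{1-q}.$$ Let $\mathfrak X=(\mathbb R_{\ge0})^r$ with its cubical decomposition: for $l\in(\mathbb Z_{\ge0})^r$ and $I\subset\{1,\dots,r\}$, the cube $(l,I)$ has dimension $|I|$ and vertices $l+E_{I'}$, $I'\subset I$. The weight $w(\square)$ of a cube is the maximum of $w$ over its vertices. For $n\in\mathbb Z$, $S_n\subset\mathfrak X$ is the union of all cubes with $w(\square)\le n$. For $d\in\mathbb Z_{\ge0}$, $\mathfrak X_{-d}$ is the union of cubes $(l,I)$ with $|l|\ge d$; for $l\in(\mathbb Z_{\ge0})^r$, $\mathfrak X_{-l}=\{x\in\mathfrak X:x\ge l\}$, the union of cubes $(l',I)$ with $l'\ge l$. Put $$(E^1_{-l,q})_n=H_{-|l|+q}(S_n\cap\mathfrak X_{-l},\,S_n\cap\mathfrak X_{-l}\cap\mathfrak X_{-|l|-1},\,\mathbb Z),$$ $$\mathbf{PE}_1(\mathbf T,Q,h)=\mathbf{PE}_1(T_1,\dots,T_r,Q,h)=\sum_{l\in(\mathbb Z_{\ge0})^r,\,n,\,q}\mathrm{rank}\big((E^1_{-l,q})_n\big)\cdot T_1^{l_1}\cdots T_r^{l_r}\,Q^n\,h^{-|l|+q}.$$ (The direct sum of $(E^1_{-l,q})_n$ over $|l|=d$ is the first page $H_{-d+q}(S_n\cap\mathfrak X_{-d},S_n\cap\mathfrak X_{-d-1},\mathbb Z)$ of the spectral sequence of the filtration $\{S_n\cap\mathfrak X_{-d}\}_d$ of $S_n$.) *)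

theory Defs
  imports
    "HOL-Complex_Analysis.Complex_Analysis"
    "HOL-Homology.Homology"
    "HOL-Computational_Algebra.Computational_Algebra"
    "HOL-Library.Function_Algebras"
    "HOL-Library.Poly_Mapping"
    "HOL-Library.Extended_Nat"
begin

text \<open>Holomorphic function of several variables on an open set: the real derivative exists and is
  complex linear.\<close>

definition holomorphic_fun_on :: "(complex ^ 'n \<Rightarrow> complex) \<Rightarrow> (complex ^ 'n) set \<Rightarrow> bool" where
  "holomorphic_fun_on f U \<longleftrightarrow>
     (\<forall>z\<in>U. \<exists>D. (f has_derivative D) (at z) \<and> (\<forall>a v. D (a *s v) = a * D v))"

text \<open>Representatives of the elements of the local ring of \<open>\<complex>\<^sup>n\<close> at \<open>p\<close>.  Elements of the local
  ring are handled through representatives, and equality of germs is expressed with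
  the filter \<open>nhds p\<close>.\<close>

definition hol_germs :: "complex ^ 'n \<Rightarrow> (complex ^ 'n \<Rightarrow> complex) set" where
  "hol_germs p = {f. \<exists>U. open U \<and> p \<in> U \<and> holomorphic_fun_on f U}"

definition analytic_set_germ :: "complex ^ 'n \<Rightarrow> (complex ^ 'n) set \<Rightarrow> bool" where
  "analytic_set_germ p A \<longleftrightarrow>
     p \<in> A \<and>
     (\<exists>U F. open U \<and> p \<in> U \<and> finite F \<and> (\<forall>f\<in>F. holomorphic_fun_on f U) \<and>
            A \<inter> U = {z \<in> U. \<forall>f\<in>F. f z = 0})"

definition vanishes_on_germ ::
    "complex ^ 'n \<Rightarrow> (complex ^ 'n) set \<Rightarrow> (complex ^ 'n \<Rightarrow> complex) \<Rightarrow> bool" where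
  "vanishes_on_germ p A f \<longleftrightarrow> (\<forall>\<^sub>F z in nhds p. z \<in> A \<longrightarrow> f z = 0)"

definition subset_germ :: "complex ^ 'n \<Rightarrow> (complex ^ 'n) set \<Rightarrow> (complex ^ 'n) set \<Rightarrow> bool" where
  "subset_germ p A B \<longleftrightarrow> (\<forall>\<^sub>F z in nhds p. z \<in> A \<longrightarrow> z \<in> B)"

definition eq_germ :: "complex ^ 'n \<Rightarrow> (complex ^ 'n) set \<Rightarrow> (complex ^ 'n) set \<Rightarrow> bool" where
  "eq_germ p A B \<longleftrightarrow> (\<forall>\<^sub>F z in nhds p. z \<in> A \<longleftrightarrow> z \<in> B)"

definition irreducible_germ :: "complex ^ 'n \<Rightarrow> (complex ^ 'n) set \<Rightarrow> bool" where
  "irreducible_germ p A \<longleftrightarrow>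
     analytic_set_germ p A \<and>
     (\<forall>B B'. analytic_set_germ p B \<and> analytic_set_germ p B' \<and> eq_germ p A (B \<union> B') \<longrightarrow>
             eq_germ p A B \<or> eq_germ p A B')"

definition irreducible_components ::
    "complex ^ 'n \<Rightarrow> (complex ^ 'n) set \<Rightarrow> ('r \<Rightarrow> (complex ^ 'n) set) \<Rightarrow> bool" where
  "irreducible_components p A B \<longleftrightarrow>
     (\<forall>i. irreducible_germ p (B i)) \<and>
     eq_germ p A (\<Union>i. B i) \<and>
     (\<forall>i j. i \<noteq> j \<longrightarrow> \<not> subset_germ p (B i) (B j))"

text \<open>Near \<open>z\<close>, the set is a one-dimensional complex submanifold (with holomorphic
  parametrisation \<open>\<gamma>\<close>).\<close>

definition smooth_curve_at :: "(complex ^ 'n) set \<Rightarrow> complex ^ 'n \<Rightarrow> bool" where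
  "smooth_curve_at A z \<longleftrightarrow>
     (\<exists>V U \<gamma> \<gamma>'. open V \<and> z \<in> V \<and> open U \<and> homeomorphism U (A \<inter> V) \<gamma> \<gamma>' \<and>
        (\<forall>j. (\<lambda>s. \<gamma> s $ j) holomorphic_on U) \<and>
        (\<forall>s\<in>U. \<exists>j. deriv (\<lambda>s. \<gamma> s $ j) s \<noteq> 0))"

definition isolated_curve_singularity :: "complex ^ 'n \<Rightarrow> (complex ^ 'n) set \<Rightarrow> bool" where
  "isolated_curve_singularity p C \<longleftrightarrow>
     analytic_set_germ p C \<and> p islimpt C \<and>
     (\<forall>\<^sub>F z in at p. z \<in> C \<longrightarrow> smooth_curve_at C z)"

text \<open>The ring \<open>\<Oplus>\<^sub>i \<complex>{t\<^sub>i}\<close>, with componentwise operations.\<close>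

definition branch_ring :: "('r \<Rightarrow> complex fps) set" where
  "branch_ring = {f. \<forall>i. fps_conv_radius (f i) > 0}"

definition branch_scale :: "complex \<Rightarrow> ('r \<Rightarrow> complex fps) \<Rightarrow> 'r \<Rightarrow> complex fps" where
  "branch_scale a f = (\<lambda>i. fps_const a * f i)"

global_interpretation branch: vector_space branch_scale
  by unfold_locales
     (auto simp: branch_scale_def fun_eq_iff algebra_simps simp flip: fps_const_add fps_const_mult)

definition integral_over :: "'a :: comm_ring_1 set \<Rightarrow> 'a \<Rightarrow> bool" where
  "integral_over R x \<longleftrightarrow> (\<exists>P. lead_coeff P = 1 \<and> (\<forall>k. Polynomial.coeff P k \<in> R) \<and> poly P x = 0)"

text \<open>\<open>\<phi>\<close> induces an embedding of the local ring \<open>\<O> = \<O>\<^bsub>\<complex>\<^sup>n,p\<^esub> / I(C)\<close> of \<open>C = \<Union>\<^sub>i C\<^sub>i\<close> as a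
  complex subalgebra of \<open>\<Oplus>\<^sub>i \<complex>{t\<^sub>i}\<close> which makes the latter the integral closure of \<open>\<O>\<close> in its
  total ring of fractions, with the \<open>i\<close>-th summand belonging to the component \<open>C\<^sub>i\<close>.  Since
  \<open>\<Oplus>\<^sub>i \<complex>{t\<^sub>i}\<close> is integrally closed in its own total ring of fractions, it suffices to say that
  its elements are integral over \<open>\<O>\<close> and are fractions of elements of \<open>\<O>\<close>; the denominator
  \<open>b\<close> is a non-zero-divisor because no component of it vanishes.\<close>

definition integral_closure_map ::
    "complex ^ 'n \<Rightarrow> ('r \<Rightarrow> (complex ^ 'n) set) \<Rightarrow>
     ((complex ^ 'n \<Rightarrow> complex) \<Rightarrow> 'r \<Rightarrow> complex fps) \<Rightarrow> bool" where
  "integral_closure_map p Cs \<phi> \<longleftrightarrow>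
     \<phi> ` hol_germs p \<subseteq> branch_ring \<and>
     (\<forall>f\<in>hol_germs p. \<forall>g\<in>hol_germs p. \<phi> (\<lambda>z. f z + g z) = \<phi> f + \<phi> g) \<and>
     (\<forall>f\<in>hol_germs p. \<forall>g\<in>hol_germs p. \<phi> (\<lambda>z. f z * g z) = \<phi> f * \<phi> g) \<and>
     (\<forall>a. \<phi> (\<lambda>z. a) = (\<lambda>i. fps_const a)) \<and>
     (\<forall>f\<in>hol_germs p. \<forall>i. \<phi> f i = 0 \<longleftrightarrow> vanishes_on_germ p (Cs i) f) \<and>
     (\<forall>x\<in>branch_ring. integral_over (\<phi> ` hol_germs p) x) \<and>
     (\<forall>x\<in>branch_ring. \<exists>a\<in>\<phi> ` hol_germs p. \<exists>b\<in>\<phi> ` hol_germs p. (\<forall>i. b i \<noteq> 0) \<and> b * x = a)"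

definition branch_val :: "complex fps \<Rightarrow> enat" where
  "branch_val g = (if g = 0 then \<infinity> else enat (subdegree g))"

definition conductor_ideal :: "('r \<Rightarrow> complex fps) set \<Rightarrow> ('r \<Rightarrow> complex fps) set" where
  "conductor_ideal R = {f \<in> branch_ring. \<forall>g\<in>branch_ring. f * g \<in> R}"

definition is_conductor :: "('r \<Rightarrow> complex fps) set \<Rightarrow> ('r \<Rightarrow> nat) \<Rightarrow> bool" where
  "is_conductor R c \<longleftrightarrow>
     conductor_ideal R = {(\<lambda>i. fps_X ^ c i) * g | g. g \<in> branch_ring}"

text \<open>\<open>dim\<^sub>\<complex> V/W\<close> for subspaces \<open>W \<subseteq> V\<close>, as the number of elements of a family in \<open>V\<close> whose classes
  form a basis of \<open>V/W\<close>.  As for the library's \<open>dim\<close>, an infinite dimension is represented by 0.\<close>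

definition quot_dim :: "('r \<Rightarrow> complex fps) set \<Rightarrow> ('r \<Rightarrow> complex fps) set \<Rightarrow> nat" where
  "quot_dim V W = card (SOME B. B \<subseteq> V \<and> branch.independent B \<and> branch.span B \<inter> W = {0} \<and>
                                (\<forall>v\<in>V. \<exists>b\<in>branch.span B. v - b \<in> W))"

text \<open>\<open>\<O>\<close> is reduced of dimension one, hence Cohen--Macaulay; it is Gorenstein iff its type is one,
  i.e. iff the socle \<open>((x) : \<mm>)/(x)\<close> of \<open>\<O>/(x)\<close> is one-dimensional over the residue field
  \<open>\<complex>\<close>, for a non-zero-divisor \<open>x\<close> in the maximal ideal \<open>\<mm>\<close>.\<close>

definition max_ideal :: "('r \<Rightarrow> complex fps) set \<Rightarrow> ('r \<Rightarrow> complex fps) set" where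
  "max_ideal R = {f \<in> R. \<not> (\<exists>g\<in>R. f * g = 1)}"

definition Gorenstein :: "('r \<Rightarrow> complex fps) set \<Rightarrow> bool" where
  "Gorenstein R \<longleftrightarrow>
     (\<exists>x\<in>max_ideal R. (\<forall>y\<in>R. x * y = 0 \<longrightarrow> y = 0) \<and>
        quot_dim {f \<in> R. \<forall>m\<in>max_ideal R. f * m \<in> (*) x ` R} ((*) x ` R) = 1)"

definition filt :: "('r \<Rightarrow> complex fps) set \<Rightarrow> ('r \<Rightarrow> nat) \<Rightarrow> ('r \<Rightarrow> complex fps) set" where
  "filt R l = {f \<in> R. \<forall>i. branch_val (f i) \<ge> enat (l i)}"

definition hilb :: "('r \<Rightarrow> complex fps) set \<Rightarrow> ('r \<Rightarrow> nat) \<Rightarrow> nat" where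
  "hilb R l = quot_dim R (filt R l)"

definition size_vec :: "('r :: finite \<Rightarrow> nat) \<Rightarrow> nat" where
  "size_vec l = (\<Sum>i\<in>UNIV. l i)"

definition weight :: "('r :: finite \<Rightarrow> complex fps) set \<Rightarrow> ('r \<Rightarrow> nat) \<Rightarrow> int" where
  "weight R l = 2 * int (hilb R l) - int (size_vec l)"

definition E :: "'r set \<Rightarrow> 'r \<Rightarrow> nat" where
  "E J = (\<lambda>i. if i \<in> J then 1 else 0)"

text \<open>The coefficient \<open>p\<^sup>m\<^sub>l(q)\<close>.  Every division by \<open>1 - q\<close> below is an exact division in
  \<open>\<int>[q]\<close>.\<close>

definition motivic_coeff :: "('r :: finite \<Rightarrow> complex fps) set \<Rightarrow> ('r \<Rightarrow> nat) \<Rightarrow> int poly" where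
  "motivic_coeff R l =
     (\<Sum>J\<in>UNIV. (-1) ^ card J * ((Polynomial.monom 1 (hilb R (l + E J))
        - Polynomial.monom 1 (hilb R l)) div [:1, -1:]))"

text \<open>\<open>p\<^sup>m\<^sub>l(q) = \<Sum>\<^sub>k a\<^sub>k q\<^bsup>k+h(l)\<^esup>\<close>; as the left-hand side is a polynomial, so is the right-hand
  side.\<close>

definition is_motivic_expansion ::
    "('r :: finite \<Rightarrow> complex fps) set \<Rightarrow> ('r \<Rightarrow> nat) \<Rightarrow> (nat \<Rightarrow> int) \<Rightarrow> bool" where
  "is_motivic_expansion R l a \<longleftrightarrow>
     finite {k. a k \<noteq> 0} \<and>
     motivic_coeff R l = (\<Sum>k | a k \<noteq> 0. Polynomial.monom (a k) (k + hilb R l))"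

definition cube :: "('r :: finite \<Rightarrow> nat) \<Rightarrow> 'r set \<Rightarrow> (real ^ 'r) set" where
  "cube l I = cbox (\<chi> i. real (l i)) (\<chi> i. real ((l + E I) i))"

definition cube_weight ::
    "('r :: finite \<Rightarrow> complex fps) set \<Rightarrow> ('r \<Rightarrow> nat) \<Rightarrow> 'r set \<Rightarrow> int" where
  "cube_weight R l I = Max ((\<lambda>I'. weight R (l + E I')) ` Pow I)"

definition S_level :: "('r :: finite \<Rightarrow> complex fps) set \<Rightarrow> int \<Rightarrow> (real ^ 'r) set" where
  "S_level R n = \<Union>{cube l I | l I. cube_weight R l I \<le> n}"

definition X_deg :: "nat \<Rightarrow> (real ^ 'r :: finite) set" where
  "X_deg d = \<Union>{cube l I | l I. size_vec l \<ge> d}"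

definition X_above :: "('r :: finite \<Rightarrow> nat) \<Rightarrow> (real ^ 'r) set" where
  "X_above l = {x. \<forall>i. x $ i \<ge> real (l i)}"

definition E1 :: "('r :: finite \<Rightarrow> complex fps) set \<Rightarrow> ('r \<Rightarrow> nat) \<Rightarrow> int \<Rightarrow> int \<Rightarrow>
    ((real ^ 'r) chain) set monoid" where
  "E1 R l q n = relative_homology_group (- int (size_vec l) + q)
     (top_of_set (S_level R n \<inter> X_above l)) (S_level R n \<inter> X_above l \<inter> X_deg (size_vec l + 1))"

text \<open>Rank of an abelian group (written multiplicatively): the largest size of a
  \<open>\<int>\<close>-linearly independent subset.\<close>

definition abelian_rank :: "('a, 'b) monoid_scheme \<Rightarrow> nat" where
  "abelian_rank G = Sup {card B | B. finite B \<and> B \<subseteq> carrier G \<and>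
     (\<forall>a :: 'a \<Rightarrow> int. finprod G (\<lambda>b. b [^]\<^bsub>G\<^esub> a b) B = \<one>\<^bsub>G\<^esub> \<longrightarrow> (\<forall>b\<in>B. a b = 0))}"

text \<open>The exponent \<open>(l, n, k)\<close> stands for \<open>T\<^sup>l Q\<^sup>n h\<^sup>k\<close>.  Polynomials, i.e. elements of
  \<open>\<int>[T, Q, Q\<^sup>-\<^sup>1, h]\<close>, are finitely supported (type \<open>TQh_poly\<close>), formal series are arbitrary
  coefficient functions (type \<open>TQh_series\<close>).\<close>

type_synonym 'r TQh = "('r \<Rightarrow> nat) \<times> int \<times> nat"
type_synonym 'r TQh_poly = "'r TQh \<Rightarrow>\<^sub>0 int"
type_synonym 'r TQh_series = "'r TQh \<Rightarrow> int"

definition var_T :: "'r \<Rightarrow> 'r TQh_poly" where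
  "var_T i = Poly_Mapping.single (E {i}, 0, 0) 1"

definition var_Q :: "'r TQh_poly" where
  "var_Q = Poly_Mapping.single (0, 1, 0) 1"

definition var_h :: "'r TQh_poly" where
  "var_h = Poly_Mapping.single (0, 0, 1) 1"

definition series_mult :: "'r TQh_poly \<Rightarrow> 'r TQh_series \<Rightarrow> 'r TQh_series" where
  "series_mult P F = (\<lambda>(l, n, k).
     \<Sum>(m, a, j) \<in> {(m, a, j) \<in> Poly_Mapping.keys P. m \<le> l \<and> j \<le> k}.
       Poly_Mapping.lookup P (m, a, j) * F (l - m, n - a, k - j))"

text \<open>In the series \<open>PE\<^sub>1\<close> the power \<open>h\<^sup>k\<close> has \<open>k = -|l| + q\<close>, the homological degree, so
  \<open>q = k + |l|\<close>; only \<open>k \<ge> 0\<close> is recorded, as homology vanishes in negative degrees.\<close>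

definition PE1 :: "('r :: finite \<Rightarrow> complex fps) set \<Rightarrow> 'r TQh_series" where
  "PE1 R = (\<lambda>(l, n, k). int (abelian_rank (E1 R l (int k + int (size_vec l)) n)))"

text \<open>Substitution \<open>h = -Q\<close>, with values in \<open>\<int>[T, T\<^sup>-\<^sup>1, Q, Q\<^sup>-\<^sup>1]\<close> (exponents \<open>(l, n)\<close> of
  \<open>T\<^sup>l Q\<^sup>n\<close>, where \<open>l\<close> may have negative entries).\<close>

type_synonym 'r TQ_laurent = "(('r \<Rightarrow> int) \<times> int) \<Rightarrow>\<^sub>0 int"

definition subst_h :: "'r TQh_poly \<Rightarrow> 'r TQ_laurent" where
  "subst_h P = (\<Sum>(l, n, k) \<in> Poly_Mapping.keys P.
     Poly_Mapping.single (\<lambda>i. int (l i), n) (Poly_Mapping.lookup P (l, n, k)) *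
     (- Poly_Mapping.single (0, 1) 1) ^ k)"

definition invert_T :: "'r TQ_laurent \<Rightarrow> 'r TQ_laurent" where
  "invert_T P = (\<Sum>(l, n) \<in> Poly_Mapping.keys P.
     Poly_Mapping.single (- l, n) (Poly_Mapping.lookup P (l, n)))"

end

theory Submission
  imports Defs
begin

text \<open>Let \<open>h\<close> be the Hilbert function.  For fixed \<open>l\<close>, the function \<open>\<rho>(J) = h(l + E\<^sub>J)\<close> is, up to a
  constant, the rank function of a matroid, and the cube \<open>(l, I)\<close> has weight \<open>w(l) + \<rho>(I) - \<rho>({})\<close>.
  By excision the group \<open>(E\<^sup>1)\<^sub>n\<close> at \<open>l\<close> is the local homology at the apex of the fan over the complex
  \<open>{I. \<rho>(I) \<le> m}\<close>; deletion and contraction in the long exact sequence of a triple show that it is free and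
  concentrated in one degree, so its rank is an Euler characteristic, i.e. a coefficient of \<open>p\<^sup>m\<^sub>l\<close>.
  Rationality follows from the existence of a conductor, proved by writing \<open>\<complex>{t\<^sub>i}\<close> as a finite module
  over \<open>\<complex>{x}\<close> for an \<open>x\<close> in the local ring.  In the Gorenstein case a comparison of colengths gives
  \<open>|c| \<le> 2 h(c)\<close>, and hence the symmetry \<open>w(c - l) = w(l)\<close> of the weight on \<open>\<int>\<^sup>r\<close>, which yields
  the symmetry of the numerator.\<close>

text \<open>Concentration in one degree rests on a match of shifts: contracting an element
  \<open>v\<close> that is not a loop raises the base value of the rank function by one, just as the
  connecting map lowers the degree by one. Loops, and bounds at or above the full rank, do not fit
  this pattern and are split off as cones. The map \<open>\<phi>\<close> is given only by algebraic
  properties, not as substitution of parametrisations. Before convergent series in \<open>x\<close>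
  can act on the branches, its compatibility with composition must be derived coefficient by
  coefficient. One inequality suffices for the duality: the defect \<open>w(l) - w(c - l)\<close>
  never increases with \<open>l\<close> and is odd under reflection, so it vanishes once it is
  nonpositive far below 0. \<open>PE1\<close> itself lives on \<open>l \<ge> 0\<close>, which
  reflection does not preserve. After multiplication by the denominator and by
  \<open>1 - Q^2\<close> there remains an alternating sum over pairs \<open>(I, J)\<close>, governed
  by the weight at \<open>l - E I + E J\<close>, and reflection exchanges \<open>I\<close> and
  \<open>J\<close>. Finite support of the numerator then allows \<open>1 - Q^2\<close> to be
  cancelled.\<close>

no_notation fps_nth (infixl "$" 75)

section \<open>Local homology of fans\<close>

abbreviation pair_homology :: "int \<Rightarrow> 'a::real_normed_vector set \<Rightarrow> 'a set \<Rightarrow> 'a chain set monoid" where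
  "pair_homology k A S \<equiv> relative_homology_group k (top_of_set A) S"

lemma homotopic_with_linear_pair:
  fixes A B :: "'a::real_normed_vector set"
  assumes "continuous_on A f" "continuous_on A g" "S \<subseteq> A"
    and "\<And>x t. x \<in> A \<Longrightarrow> 0 \<le> t \<Longrightarrow> t \<le> 1 \<Longrightarrow> (1 - t) *\<^sub>R f x + t *\<^sub>R g x \<in> B"
    and "\<And>x t. x \<in> S \<Longrightarrow> 0 \<le> t \<Longrightarrow> t \<le> 1 \<Longrightarrow> (1 - t) *\<^sub>R f x + t *\<^sub>R g x \<in> T"
  shows "homotopic_with (\<lambda>h. h \<in> S \<rightarrow> T) (top_of_set A) (top_of_set B) f g"
proof -
  let ?h = "\<lambda>z. (1 - fst z) *\<^sub>R f (snd z) + fst z *\<^sub>R g (snd z)"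
  have "continuous_on ({0..1} \<times> A) ?h"
    by (intro continuous_intros continuous_on_compose2[OF assms(1)] continuous_on_compose2[OF assms(2)]) auto
  moreover have "?h \<in> ({0..1} \<times> A) \<rightarrow> B"
    using assms(4) by auto
  ultimately have "continuous_map (prod_topology (top_of_set {0..1}) (top_of_set A)) (top_of_set B) ?h"
    by (simp add: continuous_map_in_subtopology flip: euclidean_product_topology subtopology_Times)
  then show ?thesis
    unfolding homotopic_with_def
    by (intro exI[of _ ?h]) (use assms(5) in auto)
qed

text \<open>Every deformation below is a straight segment from a composite to the identity, so the
  homotopy conditions reduce to the segment staying inside the space and inside the
  subspace.\<close>

lemma linear_homotopy_equivalence_iso:
  fixes A B :: "'a::real_normed_vector set"
  assumes "continuous_on A f" "f \<in> A \<rightarrow> B" "f \<in> S \<rightarrow> T" "S \<subseteq> A"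
    and "continuous_on B g" "g \<in> B \<rightarrow> A" "g \<in> T \<rightarrow> S" "T \<subseteq> B"
    and "\<And>x t. x \<in> A \<Longrightarrow> 0 \<le> t \<Longrightarrow> t \<le> 1 \<Longrightarrow> (1 - t) *\<^sub>R g (f x) + t *\<^sub>R x \<in> A"
    and "\<And>x t. x \<in> S \<Longrightarrow> 0 \<le> t \<Longrightarrow> t \<le> 1 \<Longrightarrow> (1 - t) *\<^sub>R g (f x) + t *\<^sub>R x \<in> S"
    and "\<And>x t. x \<in> B \<Longrightarrow> 0 \<le> t \<Longrightarrow> t \<le> 1 \<Longrightarrow> (1 - t) *\<^sub>R f (g x) + t *\<^sub>R x \<in> B"
    and "\<And>x t. x \<in> T \<Longrightarrow> 0 \<le> t \<Longrightarrow> t \<le> 1 \<Longrightarrow> (1 - t) *\<^sub>R f (g x) + t *\<^sub>R x \<in> T"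
  shows "pair_homology k A S \<cong> pair_homology k B T"
proof (rule homotopy_equivalent_space_imp_isomorphic_relative_homology_groups)
  show "continuous_map (top_of_set A) (top_of_set B) f" "continuous_map (top_of_set B) (top_of_set A) g"
    using assms by (auto simp: continuous_map_in_subtopology)
  have "continuous_on A (g \<circ> f)" "continuous_on B (f \<circ> g)"
    using assms by (auto intro!: continuous_on_compose intro: continuous_on_subset simp del: o_apply)
  then show "homotopic_with (\<lambda>h. h \<in> S \<rightarrow> S) (top_of_set A) (top_of_set A) (g \<circ> f) id"
    "homotopic_with (\<lambda>h. h \<in> T \<rightarrow> T) (top_of_set B) (top_of_set B) (f \<circ> g) id"
    using assms by (auto intro!: homotopic_with_linear_pair)
qed (use assms in auto)

text \<open>For \<open>U\<close> relatively closed and \<open>T\<close> relatively open, the closure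
  and interior conditions of the excision axiom collapse to \<open>U \<subseteq> T\<close>.\<close>

lemma pair_homology_excision:
  fixes A :: "'a::real_normed_vector set"
  assumes "closedin (top_of_set A) U" "openin (top_of_set A) T" "U \<subseteq> T"
  shows "pair_homology k (A - U) (T - U) \<cong> pair_homology k A T"
proof -
  have "T \<subseteq> A" using assms(2) openin_imp_subset by blast
  then have "hom_induced k (subtopology (top_of_set A) (A - U)) (T - U) (subtopology (top_of_set A) A) T id
    \<in> iso (relative_homology_group k (subtopology (top_of_set A) (A - U)) (T - U))
          (relative_homology_group k (subtopology (top_of_set A) A) T)"
    using assms by (intro homology_excision_axiom) (auto simp: closure_of_closedin interior_of_openin)
  then show ?thesis
    by (auto simp: subtopology_subtopology is_iso_def Int_absorb1 Diff_subset)
qed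

text \<open>For down-closed \<open>K\<close> this is the union of the coordinate orthants of the
  faces, i.e. the infinite cone over a simplicial complex; puncturing it at 0 computes the reduced
  homology of that complex, one degree up. The empty family, which lacks even the face
  \<open>{}\<close>, gives the empty space.\<close>

definition fan :: "'r set set \<Rightarrow> (real ^ 'r) set" where
  "fan K = {y. (\<forall>i. 0 \<le> y $ i) \<and> {i. y $ i \<noteq> 0} \<in> K}"

definition deletion :: "'r \<Rightarrow> 'r set set \<Rightarrow> 'r set set" where
  "deletion v K = {I \<in> K. v \<notin> I}"

definition link :: "'r \<Rightarrow> 'r set set \<Rightarrow> 'r set set" where
  "link v K = {I. v \<notin> I \<and> insert v I \<in> K}"

definition down_closed :: "'r set set \<Rightarrow> bool" where
  "down_closed K \<longleftrightarrow> (\<forall>I\<in>K. \<forall>J. J \<subseteq> I \<longrightarrow> J \<in> K)"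

definition axis_line :: "'r \<Rightarrow> (real ^ 'r) set" where
  "axis_line v = {y. \<forall>i. i \<noteq> v \<longrightarrow> y $ i = 0}"

definition set_coord :: "'r \<Rightarrow> real \<Rightarrow> real ^ 'r \<Rightarrow> real ^ 'r" where
  "set_coord v a y = (\<chi> i. if i = v then a else y $ i)"

lemma set_coord_nth [simp]: "set_coord v a y $ i = (if i = v then a else y $ i)"
  by (simp add: set_coord_def)

lemma continuous_on_set_coord [continuous_intros]: "continuous_on A (set_coord v a)"
  unfolding set_coord_def
  by (intro continuous_on_vec_lambda, case_tac "i = v") (auto intro!: continuous_intros)

abbreviation local_homology :: "int \<Rightarrow> 'r set set \<Rightarrow> (real ^ 'r :: finite) chain set monoid" where
  "local_homology k K \<equiv> pair_homology k (fan K) (fan K - {0})"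

text \<open>Setting coordinate \<open>v\<close> to 0 retracts the fan onto the fan of the deletion;
  a point off the axis keeps a nonzero coordinate other than \<open>v\<close>, so the punctured
  parts correspond.\<close>

lemma fan_deletion:
  assumes "down_closed K"
  shows "pair_homology k (fan K) (fan K - axis_line v) \<cong> local_homology k (deletion v K)"
proof (rule linear_homotopy_equivalence_iso[where f = "set_coord v 0" and g = id])
  have *: "(1 - t) *\<^sub>R set_coord v 0 x + t *\<^sub>R x \<in> fan K" if "x \<in> fan K" "0 \<le> t" "t \<le> 1" for x t
  proof -
    have "{i. ((1 - t) *\<^sub>R set_coord v 0 x + t *\<^sub>R x) $ i \<noteq> 0} \<subseteq> {i. x $ i \<noteq> 0}" by auto
    with assms that have "{i. ((1 - t) *\<^sub>R set_coord v 0 x + t *\<^sub>R x) $ i \<noteq> 0} \<in> K"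
      unfolding fan_def down_closed_def by blast
    with that show ?thesis
      unfolding fan_def mem_Collect_eq by auto
  qed
  show "(1 - t) *\<^sub>R id (set_coord v 0 x) + t *\<^sub>R x \<in> fan K" if "x \<in> fan K" "0 \<le> t" "t \<le> 1" for x t
    using * that by simp
  show "(1 - t) *\<^sub>R id (set_coord v 0 x) + t *\<^sub>R x \<in> fan K - axis_line v"
    if x: "x \<in> fan K - axis_line v" and "0 \<le> t" "t \<le> 1" for x t
  proof -
    obtain i where "i \<noteq> v" "x $ i \<noteq> 0" using x by (auto simp: axis_line_def)
    then have "((1 - t) *\<^sub>R set_coord v 0 x + t *\<^sub>R x) $ i \<noteq> 0" by (simp add: algebra_simps)
    with * that \<open>i \<noteq> v\<close> show ?thesis unfolding axis_line_def by auto
  qed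
  show f: "set_coord v 0 \<in> fan K \<rightarrow> fan (deletion v K)"
  proof
    fix x assume x: "x \<in> fan K"
    have "{i. set_coord v 0 x $ i \<noteq> 0} \<subseteq> {i. x $ i \<noteq> 0}" by auto
    with assms x have "{i. set_coord v 0 x $ i \<noteq> 0} \<in> K"
      unfolding fan_def down_closed_def by blast
    with x show "set_coord v 0 x \<in> fan (deletion v K)"
      unfolding fan_def deletion_def mem_Collect_eq by auto
  qed
  show "set_coord v 0 \<in> fan K - axis_line v \<rightarrow> fan (deletion v K) - {0}"
    using f by (auto simp: axis_line_def vec_eq_iff Pi_iff)
  have [simp]: "set_coord v 0 x = x" if "x \<in> fan (deletion v K)" for x
    using that by (auto simp: fan_def deletion_def vec_eq_iff)
  show "(1 - t) *\<^sub>R set_coord v 0 (id x) + t *\<^sub>R x \<in> fan (deletion v K)"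
    if "x \<in> fan (deletion v K)" for x t
    using that by (simp flip: scaleR_left.add)
  show "(1 - t) *\<^sub>R set_coord v 0 (id x) + t *\<^sub>R x \<in> fan (deletion v K) - {0}"
    if "x \<in> fan (deletion v K) - {0}" for x t
    using that by (simp flip: scaleR_left.add)
  show "id \<in> fan (deletion v K) \<rightarrow> fan K" by (auto simp: fan_def deletion_def)
  show "id \<in> fan (deletion v K) - {0} \<rightarrow> fan K - axis_line v"
    by (auto simp: fan_def deletion_def axis_line_def vec_eq_iff) 
qed (auto intro: continuous_intros)

lemma closed_axis_line: "closed (axis_line v :: (real ^ 'r :: finite) set)"
proof -
  have "axis_line v = (\<Inter>i\<in>-{v}. {y :: real ^ 'r. y $ i = 0})" by (auto simp: axis_line_def)
  also have "closed \<dots>" by (intro closed_INT ballI closed_Collect_eq continuous_intros)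
  finally show ?thesis .
qed

text \<open>Where coordinate \<open>v\<close> is positive the fan is the product of an open ray with
  the fan of the link, and the axis is the ray over the origin. Excision removes the rest.\<close>

lemma fan_link:
  fixes K :: "'r :: finite set set"
  assumes "down_closed K"
  shows "pair_homology k (fan K - {0}) (fan K - axis_line v) \<cong> local_homology k (link v K)"
proof -
  let ?A = "fan K - {0}" and ?T = "fan K - axis_line v" and ?U = "{y \<in> fan K - {0}. y $ v = 0}"
  let ?O = "{y \<in> fan K. y $ v > 0}"
  have "closedin (top_of_set ?A) ?U"
  proof -
    have "closedin (top_of_set ?A) (?A \<inter> {y. y $ v = 0})"
      by (intro closedin_closed_Int closed_Collect_eq continuous_intros)
    also have "?A \<inter> {y. y $ v = 0} = ?U" by auto
    finally show ?thesis .
  qed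
  moreover have "openin (top_of_set ?A) ?T"
  proof -
    have "openin (top_of_set ?A) (?A \<inter> - axis_line v)"
      by (intro openin_open_Int open_Compl closed_axis_line)
    also have "?A \<inter> - axis_line v = ?T" by (auto simp: axis_line_def)
    finally show ?thesis .
  qed
  \<comment> \<open>A nonzero point with vanishing coordinate \<open>v\<close> has another nonzero
    coordinate, so it is off the axis.\<close>
  moreover have "?U \<subseteq> ?T" by (force simp: axis_line_def vec_eq_iff)
  ultimately have "pair_homology k (?A - ?U) (?T - ?U) \<cong> pair_homology k ?A ?T"
    by (rule pair_homology_excision)
  moreover have "?A - ?U = ?O" by (force simp: fan_def less_le)
  moreover have "?T - ?U = ?O - axis_line v" by (force simp: fan_def less_le axis_line_def vec_eq_iff)
  ultimately have 1: "pair_homology k ?O (?O - axis_line v) \<cong> pair_homology k ?A ?T" by simp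
  \<comment> \<open>Height 1 serves as a section of the projection that forgets coordinate
    \<open>v\<close>.\<close>
  have 2: "pair_homology k ?O (?O - axis_line v) \<cong> local_homology k (link v K)"
  proof (rule linear_homotopy_equivalence_iso[where f = "set_coord v 0" and g = "set_coord v 1"])
    have *: "(1 - t) *\<^sub>R set_coord v 1 (set_coord v 0 x) + t *\<^sub>R x \<in> ?O"
      if "x \<in> ?O" "0 \<le> t" "t \<le> 1" for x t
    proof -
      have pos: "(1 - t) + t * x $ v > 0"
      proof (cases "t = 1")
        case False
        then have "1 - t > 0" "t * x $ v \<ge> 0" using that by auto
        then show ?thesis by linarith
      qed (use that in auto)
      have "((1 - t) *\<^sub>R set_coord v 1 (set_coord v 0 x) + t *\<^sub>R x) $ i
            = (if i = v then (1 - t) + t * x $ v else x $ i)" for i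
        by (auto simp: algebra_simps)
      then have "{i. ((1 - t) *\<^sub>R set_coord v 1 (set_coord v 0 x) + t *\<^sub>R x) $ i \<noteq> 0} = {i. x $ i \<noteq> 0}"
        using pos that by auto
      with that pos show ?thesis unfolding fan_def mem_Collect_eq by auto
    qed
    then show "(1 - t) *\<^sub>R set_coord v 1 (set_coord v 0 x) + t *\<^sub>R x \<in> ?O"
      if "x \<in> ?O" "0 \<le> t" "t \<le> 1" for x t using that by blast
    show "(1 - t) *\<^sub>R set_coord v 1 (set_coord v 0 x) + t *\<^sub>R x \<in> ?O - axis_line v"
      if x: "x \<in> ?O - axis_line v" and "0 \<le> t" "t \<le> 1" for x t
    proof -
      obtain i where "i \<noteq> v" "x $ i \<noteq> 0" using x unfolding axis_line_def by blast
      then have "((1 - t) *\<^sub>R set_coord v 1 (set_coord v 0 x) + t *\<^sub>R x) $ i \<noteq> 0"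
        by (simp add: algebra_simps)
      with *[of x t] that \<open>i \<noteq> v\<close> show ?thesis unfolding axis_line_def by auto
    qed
    have [simp]: "set_coord v 0 (set_coord v 1 x) = x" if "x \<in> fan (link v K)" for x
      using that by (auto simp: fan_def link_def vec_eq_iff)
    show "(1 - t) *\<^sub>R set_coord v 0 (set_coord v 1 x) + t *\<^sub>R x \<in> fan (link v K)"
      if "x \<in> fan (link v K)" for x t
      using that by (simp flip: scaleR_left.add)
    show "(1 - t) *\<^sub>R set_coord v 0 (set_coord v 1 x) + t *\<^sub>R x \<in> fan (link v K) - {0}"
      if "x \<in> fan (link v K) - {0}" for x t
      using that by (simp flip: scaleR_left.add)
    show f: "set_coord v 0 \<in> ?O \<rightarrow> fan (link v K)"
    proof
      fix x assume x: "x \<in> ?O"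
      then have "insert v {i. set_coord v 0 x $ i \<noteq> 0} = {i. x $ i \<noteq> 0}" by auto
      with x show "set_coord v 0 x \<in> fan (link v K)"
        unfolding fan_def link_def mem_Collect_eq by auto
    qed
    show "set_coord v 0 \<in> ?O - axis_line v \<rightarrow> fan (link v K) - {0}"
    proof
      fix x assume x: "x \<in> ?O - axis_line v"
      then obtain i where "i \<noteq> v" "x $ i \<noteq> 0" unfolding axis_line_def by blast
      then have "set_coord v 0 x $ i \<noteq> 0" by simp
      then have "set_coord v 0 x \<noteq> 0" by (metis zero_index)
      with f x show "set_coord v 0 x \<in> fan (link v K) - {0}" by auto
    qed
    show g: "set_coord v 1 \<in> fan (link v K) \<rightarrow> ?O"
    proof
      fix x assume x: "x \<in> fan (link v K)"
      then have "{i. set_coord v 1 x $ i \<noteq> 0} = insert v {i. x $ i \<noteq> 0}" by auto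
      with x show "set_coord v 1 x \<in> ?O"
        unfolding fan_def link_def mem_Collect_eq by auto
    qed
    show "set_coord v 1 \<in> fan (link v K) - {0} \<rightarrow> ?O - axis_line v"
    proof
      fix x assume x: "x \<in> fan (link v K) - {0}"
      then have "x $ v = 0" by (auto simp: fan_def link_def)
      moreover obtain i where "x $ i \<noteq> 0" using x by (auto simp: vec_eq_iff)
      ultimately have "i \<noteq> v" "x $ i \<noteq> 0" by auto
      with g x show "set_coord v 1 x \<in> ?O - axis_line v" by (auto simp: axis_line_def)
    qed
  qed (auto intro: continuous_intros)
  show ?thesis
    using 1 2 group.iso_sym[OF group_relative_homology_group] iso_trans by blast
qed

text \<open>The fan is closed under adding multiples of the \<open>v\<close>-th unit vector, so a
  translation homotopic to the identity pushes it off the origin. The pair is thus equivalent to one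
  with equal members.\<close>

lemma local_homology_cone:
  fixes K :: "'r :: finite set set"
  assumes "down_closed K" "\<And>I. I \<in> K \<Longrightarrow> insert v I \<in> K"
  shows "trivial_group (local_homology k K)"
proof -
  let ?f = "\<lambda>y :: real ^ 'r. y + axis v 1"
  have *: "y + a *\<^sub>R axis v 1 \<in> fan K" if "y \<in> fan K" "a \<ge> 0" for y a
  proof -
    have "{i. (y + a *\<^sub>R axis v 1) $ i \<noteq> 0} \<subseteq> insert v {i. y $ i \<noteq> 0}" by (auto simp: axis_def)
    moreover have "insert v {i. y $ i \<noteq> 0} \<in> K" using assms(2) that by (auto simp: fan_def)
    ultimately have "{i. (y + a *\<^sub>R axis v 1) $ i \<noteq> 0} \<in> K"
      using assms(1) unfolding down_closed_def by blast
    then show ?thesis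
      using that unfolding fan_def mem_Collect_eq by (auto simp: axis_def)
  qed
  have **: "y + a *\<^sub>R axis v 1 \<noteq> 0" if "y \<in> fan K" "a > 0 \<or> a \<ge> 0 \<and> y \<noteq> 0" for y a
  proof
    assume eq: "y + a *\<^sub>R axis v 1 = 0"
    have "y $ i + a * axis v 1 $ i = 0" for i 
      using arg_cong[OF eq, of "\<lambda>y. y $ i"] by simp
    moreover have "y $ i \<ge> 0" for i using that by (simp add: fan_def)
    moreover have "axis v (1::real) $ i \<ge> 0" for i by (simp add: axis_def)
    ultimately have "y $ i = 0 \<and> a * axis v 1 $ i = 0" for i
      using that(2) by (smt (verit) mult_nonneg_nonneg)
    from this[of v] this have "a = 0" "y = 0" by (auto simp: vec_eq_iff)
    with that show False by auto
  qed
  have eq: "(1 - t) *\<^sub>R ?f x + t *\<^sub>R x = x + (1 - t) *\<^sub>R axis v 1" for x t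
    by (simp add: algebra_simps)
  have "local_homology k K \<cong> pair_homology k (fan K - {0}) (fan K - {0})"
  proof (rule linear_homotopy_equivalence_iso[where f = ?f and g = id])
    show "?f \<in> fan K \<rightarrow> fan K - {0}" "?f \<in> fan K - {0} \<rightarrow> fan K - {0}"
      using *[where a = 1] **[where a = 1] by auto
  qed (use * ** in \<open>auto simp: eq intro!: continuous_intros\<close>)
  moreover have "trivial_group (pair_homology k (fan K - {0}) (fan K - {0}))"
    using trivial_relative_homology_group_topspace[of _ "top_of_set (fan K - {0})"] by simp
  ultimately show ?thesis
    by (simp add: isomorphic_group_triviality)
qed

lemma local_homology_empty: "trivial_group (local_homology k {})"
  by (intro trivial_relative_homology_group_empty) (simp add: fan_def)

lemma fan_point: "fan {{}} = {0}"
  by (auto simp: fan_def vec_eq_iff)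

lemma local_homology_point:
  "k \<noteq> 0 \<Longrightarrow> trivial_group (local_homology k {{}})"
  "local_homology 0 {{}} \<cong> integer_group"
  unfolding fan_point by (auto intro: homology_dimension_axiom homology_coefficients)

section \<open>Ranks of free abelian groups\<close>

definition int_vectors :: "nat \<Rightarrow> (nat \<Rightarrow> int) set" where
  "int_vectors n = {x. \<forall>j\<ge>n. x j = 0}"

definition int_combination :: "('a, 'b) monoid_scheme \<Rightarrow> nat \<Rightarrow> (nat \<Rightarrow> 'a) \<Rightarrow> (nat \<Rightarrow> int) \<Rightarrow> 'a" where
  "int_combination G n b x = finprod G (\<lambda>j. b j [^]\<^bsub>G\<^esub> x j) {..<n}"

text \<open>Coordinates refer to an indexed family instead of a subset, so images and lifts of a
  basis can be written down without a separate injectivity check. Padding the integer vectors by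
  zeros makes coordinates unique.\<close>

definition free_of_rank :: "('a, 'b) monoid_scheme \<Rightarrow> nat \<Rightarrow> bool" where
  "free_of_rank G n \<longleftrightarrow> comm_group G \<and>
     (\<exists>b. b \<in> {..<n} \<rightarrow> carrier G \<and> bij_betw (int_combination G n b) (int_vectors n) (carrier G))"

lemma (in comm_group) int_combination_closed:
  "b \<in> {..<n} \<rightarrow> carrier G \<Longrightarrow> int_combination G n b x \<in> carrier G"
  unfolding int_combination_def by (auto intro!: finprod_closed)

lemma (in comm_group) int_combination_add:
  assumes "b \<in> {..<n} \<rightarrow> carrier G"
  shows "int_combination G n b (\<lambda>j. x j + y j) = int_combination G n b x \<otimes> int_combination G n b y"
proof -
  have "int_combination G n b (\<lambda>j. x j + y j) = finprod G (\<lambda>j. b j [^] x j \<otimes> b j [^] y j) {..<n}"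
    unfolding int_combination_def using assms
    by (intro finprod_cong') (auto simp: int_pow_mult Pi_iff)
  also have "\<dots> = int_combination G n b x \<otimes> int_combination G n b y"
    unfolding int_combination_def using assms by (intro finprod_multf) auto
  finally show ?thesis .
qed

lemma (in comm_group) finprod_int_pow:
  assumes "f \<in> A \<rightarrow> carrier G" "finite A"
  shows "finprod G f A [^] (m::int) = finprod G (\<lambda>j. f j [^] m) A"
  using assms(2,1) by (induction A) (auto simp: int_pow_distrib Pi_iff)

lemma (in comm_group) int_combination_scale:
  assumes "b \<in> {..<n} \<rightarrow> carrier G"
  shows "int_combination G n b (\<lambda>j. x j * m) = int_combination G n b x [^] m"
  unfolding int_combination_def using assms
  by (subst finprod_int_pow) (auto intro!: finprod_cong' simp: int_pow_pow Pi_iff)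

lemma (in comm_group) int_combination_sum:
  assumes "b \<in> {..<n} \<rightarrow> carrier G" "finite C"
  shows "finprod G (\<lambda>c. int_combination G n b (x c)) C = int_combination G n b (\<lambda>j. \<Sum>c\<in>C. x c j)"
  using assms(2)
proof (induction C)
  case empty
  then show ?case by (simp add: int_combination_def)
next
  case (insert c C)
  then show ?case
    using int_combination_closed[OF assms(1)] by (simp add: int_combination_add[OF assms(1)] Pi_iff)
qed

lemma hom_finprod_comm_group:
  assumes "comm_group G" "comm_group H" "f \<in> hom G H" "b \<in> A \<rightarrow> carrier G" "finite A"
  shows "f (finprod G b A) = finprod H (\<lambda>j. f (b j)) A"
proof -
  interpret G: comm_group G by fact
  interpret H: comm_group H by fact
  interpret group_hom G H f using assms(3) by unfold_locales
  show ?thesis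
    using assms(5,4) by (induction A) (auto simp: Pi_iff)
qed

lemma hom_int_combination:
  assumes "comm_group G" "comm_group H" "f \<in> hom G H" "b \<in> {..<n} \<rightarrow> carrier G"
  shows "f (int_combination G n b x) = int_combination H n (f \<circ> b) x"
proof -
  interpret G: comm_group G by fact
  interpret H: comm_group H by fact
  interpret group_hom G H f using assms(3) by unfold_locales
  show ?thesis
    unfolding int_combination_def using assms(4)
    by (subst hom_finprod_comm_group[OF assms(1-3)])
      (auto intro!: H.finprod_cong' simp: Pi_iff hom_int_pow)
qed

text \<open>Gaussian elimination without division: a nonzero pivot in the last row is eliminated
  from the other rows by cross-multiplication, which keeps all entries integral.\<close>

lemma int_linear_system_nontrivial:
  fixes M :: "nat \<Rightarrow> 'c \<Rightarrow> int"
  assumes "finite C" "n < card C"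
  shows "\<exists>x. (\<exists>c\<in>C. x c \<noteq> 0) \<and> (\<forall>i<n. (\<Sum>c\<in>C. M i c * x c) = 0)"
  using assms
proof (induction n arbitrary: C M)
  case 0
  then have "C \<noteq> {}" by auto
  then show ?case by (intro exI[of _ "\<lambda>_. 1"]) auto
next
  case (Suc n)
  show ?case
  proof (cases "\<exists>c\<in>C. M n c \<noteq> 0")
    case False
    obtain x where "\<exists>c\<in>C. x c \<noteq> 0" "\<forall>i<n. (\<Sum>c\<in>C. M i c * x c) = 0"
      using Suc.IH[of C M] Suc.prems by auto
    with False show ?thesis by (intro exI[of _ x]) (auto simp: less_Suc_eq)
  next
    case True
    then obtain p where p: "p \<in> C" "M n p \<noteq> 0" by blast
    let ?D = "C - {p}"
    have D: "finite ?D" "n < card ?D" using Suc.prems p by auto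
    obtain x where x: "\<exists>c\<in>?D. x c \<noteq> 0"
      "\<forall>i<n. (\<Sum>c\<in>?D. (M n p * M i c - M i p * M n c) * x c) = 0"
      using Suc.IH[OF D, of "\<lambda>i c. M n p * M i c - M i p * M n c"] by blast
    \<comment> \<open>The remaining unknowns are scaled by the pivot so that the pivot unknown
      solves row \<open>n\<close> over the integers.\<close>
    define y where "y c = (if c = p then - (\<Sum>c\<in>?D. M n c * x c) else M n p * x c)" for c
    have "(\<Sum>c\<in>C. M i c * y c) = (\<Sum>c\<in>?D. (M n p * M i c - M i p * M n c) * x c)" for i
    proof -
      have "(\<Sum>c\<in>C. M i c * y c) = M i p * y p + (\<Sum>c\<in>?D. M i c * y c)"
        using p Suc.prems by (simp add: sum.remove)
      also have "(\<Sum>c\<in>?D. M i c * y c) = (\<Sum>c\<in>?D. M n p * M i c * x c)"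
        by (intro sum.cong) (auto simp: y_def)
      also have "M i p * y p = - (\<Sum>c\<in>?D. M i p * M n c * x c)"
        by (simp add: y_def sum_distrib_left mult.assoc)
      finally show ?thesis by (simp add: sum_subtractf algebra_simps)
    qed
    with x p have "(\<exists>c\<in>C. y c \<noteq> 0) \<and> (\<forall>i<Suc n. (\<Sum>c\<in>C. M i c * y c) = 0)"
      by (auto simp: less_Suc_eq y_def mult.commute)
    then show ?thesis by blast
  qed
qed

text \<open>A basis is an independent set of size \<open>n\<close>. More than \<open>n\<close>
  elements are dependent, since their coordinate vectors form a homogeneous integer system with more
  unknowns than equations.\<close>

lemma abelian_rank_free:
  assumes "free_of_rank G n"
  shows "abelian_rank G = n"
proof -
  obtain b where G: "comm_group G" and b: "b \<in> {..<n} \<rightarrow> carrier G"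
    and bij: "bij_betw (int_combination G n b) (int_vectors n) (carrier G)"
    using assms by (auto simp: free_of_rank_def)
  interpret comm_group G by fact
  define indep where "indep B \<longleftrightarrow> finite B \<and> B \<subseteq> carrier G \<and>
    (\<forall>a :: 'a \<Rightarrow> int. finprod G (\<lambda>b. b [^]\<^bsub>G\<^esub> a b) B = \<one>\<^bsub>G\<^esub> \<longrightarrow> (\<forall>b\<in>B. a b = 0))" for B
  have zero: "x j = 0" if "int_combination G n b x = \<one>\<^bsub>G\<^esub>" "j < n" for x j
  proof -
    \<comment> \<open>Only the first \<open>n\<close> entries enter the combination; truncation
      brings \<open>x\<close> into the domain of the bijection.\<close>
    define x' where "x' j = (if j < n then x j else 0)" for j
    have "int_combination G n b x' = int_combination G n b x"
      using b unfolding int_combination_def by (intro finprod_cong') (auto simp: x'_def)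
    moreover have "int_combination G n b (\<lambda>_. 0) = \<one>\<^bsub>G\<^esub>"
      using b by (auto simp: int_combination_def intro!: finprod_one_eqI)
    ultimately have "x' = (\<lambda>_. 0)"
      using that bij by (auto simp: bij_betw_def int_vectors_def x'_def intro: inj_onD)
    then have "x' j = 0" by simp
    then show ?thesis using that by (simp add: x'_def)
  qed
  \<comment> \<open>The rank counts subsets, so the indexed basis has to be free of repetitions; a
    repetition would be a relation with coefficients 1 and -1.\<close>
  have "inj_on b {..<n}"
  proof (rule inj_onI, rule ccontr)
    fix i j assume ij: "i \<in> {..<n}" "j \<in> {..<n}" "b i = b j" "i \<noteq> j"
    define x :: "nat \<Rightarrow> int" where "x k = (if k = i then 1 else if k = j then -1 else 0)" for k
    have "int_combination G n b x = finprod G (\<lambda>k. b k [^]\<^bsub>G\<^esub> x k) {i,j}"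
      unfolding int_combination_def using ij b
      by (intro finprod_mono_neutral_cong_right) (auto simp: x_def)
    also have "\<dots> = \<one>\<^bsub>G\<^esub>"
      using ij b by (subst finprod_insert) (auto simp: x_def int_pow_neg Pi_iff)
    finally have "x i = 0" using zero ij by auto
    then show False by (simp add: x_def)
  qed
  have "indep (b ` {..<n})"
    unfolding indep_def
  proof (intro conjI allI impI)
    fix a :: "'a \<Rightarrow> int"
    assume "finprod G (\<lambda>b. b [^]\<^bsub>G\<^esub> a b) (b ` {..<n}) = \<one>\<^bsub>G\<^esub>"
    moreover have "finprod G (\<lambda>b. b [^]\<^bsub>G\<^esub> a b) (b ` {..<n}) = int_combination G n b (a \<circ> b)"
      unfolding int_combination_def using b \<open>inj_on b {..<n}\<close> by (subst finprod_reindex) auto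
    ultimately show "\<forall>b\<in>b ` {..<n}. a b = 0"
      using zero[of "a \<circ> b"] by auto
  qed (use b in auto)
  then have "\<exists>B. indep B \<and> card B = n"
    using \<open>inj_on b {..<n}\<close> card_image[of b "{..<n}"] by auto
  moreover have "card B \<le> n" if "indep B" for B
  proof (rule ccontr)
    assume "\<not> card B \<le> n"
    define y where "y = inv_into (int_vectors n) (int_combination G n b)"
    have y: "int_combination G n b (y c) = c" if "c \<in> carrier G" for c
      using that bij unfolding y_def bij_betw_def by (metis f_inv_into_f)
    have B: "finite B" "B \<subseteq> carrier G" using \<open>indep B\<close> by (auto simp: indep_def)
    obtain x where x: "\<exists>c\<in>B. x c \<noteq> 0" "\<forall>i<n. (\<Sum>c\<in>B. y c i * x c) = 0"
      using int_linear_system_nontrivial[OF B(1), of n "\<lambda>i c. y c i"] \<open>\<not> card B \<le> n\<close> by auto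
    have "finprod G (\<lambda>c. c [^]\<^bsub>G\<^esub> x c) B = finprod G (\<lambda>c. int_combination G n b (\<lambda>j. y c j * x c)) B"
      using B b int_combination_closed[OF b] y
      by (intro finprod_cong') (auto simp: int_combination_scale[OF b] subset_iff)
    also have "\<dots> = int_combination G n b (\<lambda>j. \<Sum>c\<in>B. y c j * x c)"
      by (rule int_combination_sum[OF b B(1)])
    also have "\<dots> = \<one>\<^bsub>G\<^esub>"
      using x b by (auto simp: int_combination_def intro!: finprod_one_eqI)
    finally show False using \<open>indep B\<close> x(1) by (auto simp: indep_def)
  qed
  ultimately have "n \<in> card ` {B. indep B}" "\<And>m. m \<in> card ` {B. indep B} \<Longrightarrow> m \<le> n" by auto
  then have "Sup (card ` {B. indep B}) = n" by (intro cSup_eq_maximum)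
  then show ?thesis
    unfolding abelian_rank_def indep_def by (simp add: image_Collect)
qed

lemma free_of_rank_trivial:
  assumes "comm_group G" "trivial_group G"
  shows "free_of_rank G 0"
proof -
  interpret comm_group G by fact
  have "int_vectors 0 = {\<lambda>_. 0}" by (auto simp: int_vectors_def)
  moreover have "carrier G = {\<one>\<^bsub>G\<^esub>}" using assms by (simp add: trivial_group_def)
  ultimately show ?thesis
    using assms(1) by (simp add: free_of_rank_def int_combination_def bij_betw_def)
qed

lemma trivial_if_free_of_rank_0:
  assumes "free_of_rank G 0"
  shows "trivial_group G"
proof -
  interpret comm_group G using assms by (simp add: free_of_rank_def)
  have "carrier G = int_combination G 0 (\<lambda>_. \<one>\<^bsub>G\<^esub>) ` int_vectors 0"
    using assms by (auto simp: free_of_rank_def bij_betw_def int_combination_def)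
  then show ?thesis
    by (auto simp: trivial_group_def int_combination_def int_vectors_def is_group)
qed

lemma free_of_rank_iso:
  assumes "free_of_rank G n" "G \<cong> H" "comm_group H"
  shows "free_of_rank H n"
proof -
  obtain f where f: "f \<in> iso G H" using assms(2) by (auto simp: is_iso_def)
  obtain b where G: "comm_group G" and b: "b \<in> {..<n} \<rightarrow> carrier G"
    and bij: "bij_betw (int_combination G n b) (int_vectors n) (carrier G)"
    using assms by (auto simp: free_of_rank_def)
  have "f \<circ> int_combination G n b = int_combination H n (f \<circ> b)"
    using hom_int_combination[OF G assms(3) _ b] f by (auto simp: iso_def)
  moreover have "bij_betw (f \<circ> int_combination G n b) (int_vectors n) (carrier H)"
    using f bij by (auto simp: iso_def intro: bij_betw_trans)
  moreover have "f \<circ> b \<in> {..<n} \<rightarrow> carrier H" using f b by (auto simp: iso_def hom_def)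
  ultimately show ?thesis unfolding free_of_rank_def using assms(3) by metis
qed

lemma free_of_rank_integer_group: "free_of_rank integer_group 1"
proof -
  interpret comm_group integer_group by (rule abelian_integer_group)
  have "int_combination integer_group 1 (\<lambda>_. 1) x = x 0" for x
    by (simp add: int_combination_def lessThan_Suc)
  moreover have "bij_betw (\<lambda>x. x 0) (int_vectors 1) (carrier integer_group)"
    by (rule bij_betw_byWitness[where f' = "\<lambda>m j. if j = 0 then m else 0"])
      (auto simp: int_vectors_def fun_eq_iff)
  ultimately show ?thesis
    unfolding free_of_rank_def
    by (intro conjI abelian_integer_group exI[of _ "\<lambda>_. 1"]) (auto cong: bij_betw_cong simp del: carrier_integer_group simp add: carrier_integer_group[THEN equalityD2, THEN subsetD])
qed

text \<open>The images of a basis of \<open>A\<close> followed by lifts of a basis of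
  \<open>C\<close> form a basis of \<open>B\<close>: applying \<open>g\<close> isolates the
  coordinates on the lifts, and what remains lies in the kernel of \<open>g\<close>.\<close>

lemma free_of_rank_short_exact:
  assumes "short_exact_sequence C B A g f" "free_of_rank A a" "free_of_rank C c" "comm_group B"
  shows "free_of_rank B (a + c)"
proof -
  have ses: "exact_seq ([C, B, A], [g, f])" "g \<in> epi B C" "f \<in> mon A B"
    using short_exact_sequenceD[OF assms(1)] by auto
  have ker: "kernel B C g = f ` carrier A" and gh: "g \<in> hom B C" and fh: "f \<in> hom A B"
    and surj: "g ` carrier B = carrier C" and inj: "inj_on f (carrier A)"
    using ses by (auto simp: epi_def mon_def)
  interpret A: comm_group A using assms by (simp add: free_of_rank_def)
  interpret C: comm_group C using assms by (simp add: free_of_rank_def)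
  interpret B: comm_group B by fact
  interpret g: group_hom B C g using gh by unfold_locales
  interpret f: group_hom A B f using fh by unfold_locales
  obtain bA where bA: "bA \<in> {..<a} \<rightarrow> carrier A"
    and bijA: "bij_betw (int_combination A a bA) (int_vectors a) (carrier A)"
    using assms by (auto simp: free_of_rank_def)
  obtain bC where bC: "bC \<in> {..<c} \<rightarrow> carrier C"
    and bijC: "bij_betw (int_combination C c bC) (int_vectors c) (carrier C)"
    using assms by (auto simp: free_of_rank_def)
  define l where "l j = inv_into (carrier B) g (bC j)" for j
  have l: "l \<in> {..<c} \<rightarrow> carrier B" "\<And>j. j < c \<Longrightarrow> g (l j) = bC j"
    using bC surj unfolding l_def by (auto simp: Pi_iff inv_into_into f_inv_into_f)
  define b where "b j = (if j < a then f (bA j) else l (j - a))" for j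
  have b: "b \<in> {..<a + c} \<rightarrow> carrier B"   proof
    fix j assume j: "j \<in> {..<a + c}"
    show "b j \<in> carrier B"
    proof (cases "j < a")
      case True
      then show ?thesis using f.hom_closed[OF funcset_mem[OF bA]] by (simp add: b_def)
    next
      case False
      then have "j - a < c" using j by auto
      then show ?thesis using funcset_mem[OF l(1)] False by (simp add: b_def)
    qed
  qed
  define lo :: "(nat \<Rightarrow> int) \<Rightarrow> nat \<Rightarrow> int" where "lo x = (\<lambda>j. if j < a then x j else 0)" for x
  define hi :: "(nat \<Rightarrow> int) \<Rightarrow> nat \<Rightarrow> int" where "hi x = (\<lambda>j. x (a + j))" for x
  have split: "int_combination B (a + c) b x = f (int_combination A a bA (lo x)) \<otimes>\<^bsub>B\<^esub> int_combination B c l (hi x)" for x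
  proof -
    have "j < a + c \<longleftrightarrow> j < a \<or> (\<exists>i<c. j = a + i)" for j by presburger
    then have "{..<a + c} = {..<a} \<union> (+) a ` {..<c}" by (auto simp: image_iff)
    then have "int_combination B (a + c) b x =
       finprod B (\<lambda>j. b j [^]\<^bsub>B\<^esub> x j) {..<a} \<otimes>\<^bsub>B\<^esub> finprod B (\<lambda>j. b j [^]\<^bsub>B\<^esub> x j) ((+) a ` {..<c})"
      unfolding int_combination_def using b
      by (simp, subst B.finprod_Un_disjoint) (auto simp: Pi_iff)
    also have "finprod B (\<lambda>j. b j [^]\<^bsub>B\<^esub> x j) {..<a} = int_combination B a (f \<circ> bA) (lo x)"
      unfolding int_combination_def using b bA
      by (intro B.finprod_cong') (auto simp: Pi_iff b_def lo_def)
    also have "\<dots> = f (int_combination A a bA (lo x))"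
      by (rule hom_int_combination[OF A.comm_group_axioms B.comm_group_axioms fh bA, symmetric])
    also have "finprod B (\<lambda>j. b j [^]\<^bsub>B\<^esub> x j) ((+) a ` {..<c}) = int_combination B c l (hi x)"
      unfolding int_combination_def using b l
      by (subst B.finprod_reindex) (auto simp: Pi_iff b_def hi_def intro!: B.finprod_cong')
    finally show ?thesis .
  qed
  have gl: "g (int_combination B c l z) = int_combination C c bC z" for z
  proof -
    have "g (int_combination B c l z) = int_combination C c (g \<circ> l) z"
      by (rule hom_int_combination[OF B.comm_group_axioms C.comm_group_axioms gh l(1)])
    also have "\<dots> = int_combination C c bC z"
      unfolding int_combination_def using l bC by (intro C.finprod_cong') auto
    finally show ?thesis .
  qed
  have gf: "g (f u) = \<one>\<^bsub>C\<^esub>" if "u \<in> carrier A" for u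
    using that ker by (auto simp: kernel_def)
  have Acl: "int_combination A a bA x \<in> carrier A" for x by (rule A.int_combination_closed[OF bA])
  have Bcl: "int_combination B c l x \<in> carrier B" for x by (rule B.int_combination_closed[OF l(1)])
  have Ccl: "int_combination C c bC x \<in> carrier C" for x by (rule C.int_combination_closed[OF bC])
  have gsplit: "g (int_combination B (a + c) b x) = int_combination C c bC (hi x)" for x
    using Acl Bcl Ccl by (simp add: split gl gf)
  have lo: "lo x \<in> int_vectors a" for x by (auto simp: lo_def int_vectors_def)
  have hi: "hi x \<in> int_vectors c" if "x \<in> int_vectors (a + c)" for x
    using that by (auto simp: hi_def int_vectors_def)
  have "bij_betw (int_combination B (a + c) b) (int_vectors (a + c)) (carrier B)"
    unfolding bij_betw_def
  proof
    show "inj_on (int_combination B (a + c) b) (int_vectors (a + c))"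
    proof
      fix x y assume xy: "x \<in> int_vectors (a + c)" "y \<in> int_vectors (a + c)"
        and eq: "int_combination B (a + c) b x = int_combination B (a + c) b y"
      have "int_combination C c bC (hi x) = int_combination C c bC (hi y)"
        using gsplit[of x] gsplit[of y] eq by simp
      then have hixy: "hi x = hi y" using bijC hi xy by (auto simp: bij_betw_def dest: inj_onD)
      with eq have "f (int_combination A a bA (lo x)) = f (int_combination A a bA (lo y))"
        using Acl Bcl by (simp add: split)
      then have "int_combination A a bA (lo x) = int_combination A a bA (lo y)"
        using inj Acl by (auto dest: inj_onD)
      then have loxy: "lo x = lo y" using bijA lo by (auto simp: bij_betw_def dest: inj_onD)
      show "x = y"
      proof
        fix j
        show "x j = y j"
          using fun_cong[OF hixy, of "j - a"] fun_cong[OF loxy, of j]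
          by (cases "j < a") (auto simp: lo_def hi_def)
      qed
    qed
    show "int_combination B (a + c) b ` int_vectors (a + c) = carrier B"
    proof (intro equalityI subsetI)
      fix y assume y: "y \<in> carrier B"
      then have "g y \<in> int_combination C c bC ` int_vectors c"
        using bijC by (auto simp: bij_betw_def)
      then obtain z where z: "z \<in> int_vectors c" "g y = int_combination C c bC z" by auto
      let ?w = "y \<otimes>\<^bsub>B\<^esub> inv\<^bsub>B\<^esub> (int_combination B c l z)"
      have "?w \<in> kernel B C g"
        using y z Bcl Ccl by (auto simp: kernel_def gl)
      then obtain u where u: "u \<in> carrier A" "?w = f u" using ker by auto
      then obtain w where w: "w \<in> int_vectors a" "u = int_combination A a bA w"
        using bijA by (auto simp: bij_betw_def)
      define x where "x j = (if j < a then w j else z (j - a))" for j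
      have x: "lo x = w" "hi x = z" "x \<in> int_vectors (a + c)"
        using w z by (auto simp: lo_def hi_def x_def int_vectors_def fun_eq_iff)
      have "int_combination B (a + c) b x = ?w \<otimes>\<^bsub>B\<^esub> int_combination B c l z"
        by (simp add: split x u w)
      also have "\<dots> = y" using y Bcl by (simp add: B.m_assoc)
      finally show "y \<in> int_combination B (a + c) b ` int_vectors (a + c)" using x by blast
    qed (use B.int_combination_closed[OF b] in auto)
  qed
  with b assms(4) show ?thesis unfolding free_of_rank_def by blast
qed

lemma comm_group_pair_homology [simp]: "comm_group (pair_homology k A S)"
  by simp

section \<open>Complexes of bounded matroid rank\<close>

lemma trivial_group_middle:
  assumes ex: "exact_seq ([C, B, A], [g, f])" and "trivial_group A" "trivial_group C"
  shows "trivial_group B"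
proof -
  have ker: "kernel B C g = f ` carrier A" and hom: "g \<in> hom B C" "f \<in> hom A B" and gr: "group A" "group B"
    using ex by (simp_all add: group_hom_def group_hom_axioms_def)
  have "b \<in> kernel B C g" if "b \<in> carrier B" for b
    using that assms(3) hom_in_carrier[OF hom(1) that] by (simp add: kernel_def trivial_group_def)
  then have "carrier B \<subseteq> {f \<one>\<^bsub>A\<^esub>}" using ker assms(2) by (auto simp: trivial_group_def)
  moreover have "f \<one>\<^bsub>A\<^esub> = \<one>\<^bsub>B\<^esub>" using hom_one[OF hom(2)] gr by simp
  ultimately show ?thesis using gr by (auto simp: trivial_group_def group.is_monoid)
qed

text \<open>The triple \<open>fan K - axis_line v\<close> inside \<open>fan K - {0}\<close> inside
  \<open>fan K\<close> is chosen because \<open>fan_deletion\<close> and \<open>fan_link\<close>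
  identify the two pairs over its smallest member with the deletion and the link of
  \<open>v\<close>.\<close>

lemma exact_seq_fan_triple:
  fixes K :: "'r :: finite set set"
  obtains e1 f g e2 where
    "exact_seq ([pair_homology (k - 1) (fan K) (fan K - axis_line v),
      pair_homology (k - 1) (fan K - {0}) (fan K - axis_line v),
      local_homology k K,
      pair_homology k (fan K) (fan K - axis_line v),
      pair_homology k (fan K - {0}) (fan K - axis_line v)], [e1, g, f, e2])"
proof -
  let ?X = "top_of_set (fan K)" and ?S = "fan K - {0}" and ?T = "fan K - axis_line v"
  have "?T \<subseteq> ?S" by (auto simp: axis_line_def)
  moreover have "subtopology ?X ?S = top_of_set ?S"
    by (simp add: subtopology_subtopology Int_absorb1 Diff_subset)
  ultimately show ?thesis
    using that homology_exactness_triple_1[of ?T ?S k ?X] homology_exactness_triple_2[of ?T ?S k ?X]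
      homology_exactness_triple_3[of ?T ?S k ?X]
    by (metis exact_seq_cons_iff)
qed

lemma local_homology_trivial_if_deletion_link:
  assumes "down_closed K" "trivial_group (local_homology k (deletion v K))"
    "trivial_group (local_homology (k - 1) (link v K))"
  shows "trivial_group (local_homology k K)"
proof -
  obtain e1 f g e2 where ex: "exact_seq ([pair_homology (k - 1) (fan K) (fan K - axis_line v),
      pair_homology (k - 1) (fan K - {0}) (fan K - axis_line v), local_homology k K,
      pair_homology k (fan K) (fan K - axis_line v),
      pair_homology k (fan K - {0}) (fan K - axis_line v)], [e1, g, f, e2])"
    by (rule exact_seq_fan_triple)
  have "trivial_group (pair_homology k (fan K) (fan K - axis_line v))"
    "trivial_group (pair_homology (k - 1) (fan K - {0}) (fan K - axis_line v))"
    using isomorphic_group_triviality[OF fan_deletion[OF assms(1)], of k v]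
      isomorphic_group_triviality[OF fan_link[OF assms(1)], of "k - 1" v] assms by auto
  moreover have "exact_seq ([pair_homology (k - 1) (fan K - {0}) (fan K - axis_line v),
      local_homology k K, pair_homology k (fan K) (fan K - axis_line v)], [g, f])"
    using ex by (simp add: group_hom_def group_hom_axioms_def)
  ultimately show ?thesis using trivial_group_middle by blast
qed

text \<open>The link in degree \<open>k\<close> and the deletion in degree \<open>k - 1\<close> sit
  at the two ends of the exact sequence. As they vanish, a short exact sequence remains and ranks
  add.\<close>

lemma local_homology_free_if_deletion_link:
  assumes "down_closed K" "free_of_rank (local_homology k (deletion v K)) a"
    "free_of_rank (local_homology (k - 1) (link v K)) c"
    "trivial_group (local_homology k (link v K))" "trivial_group (local_homology (k - 1) (deletion v K))"
  shows "free_of_rank (local_homology k K) (a + c)"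
proof -
  obtain e1 f g e2 where ex: "exact_seq ([pair_homology (k - 1) (fan K) (fan K - axis_line v),
      pair_homology (k - 1) (fan K - {0}) (fan K - axis_line v), local_homology k K,
      pair_homology k (fan K) (fan K - axis_line v),
      pair_homology k (fan K - {0}) (fan K - axis_line v)], [e1, g, f, e2])"
    by (rule exact_seq_fan_triple)
  note del = fan_deletion[OF assms(1), of _ v] and lnk = fan_link[OF assms(1), of _ v]
  have "trivial_group (pair_homology (k - 1) (fan K) (fan K - axis_line v))"
    "trivial_group (pair_homology k (fan K - {0}) (fan K - axis_line v))"
    using isomorphic_group_triviality[OF del, of "k - 1"]
      isomorphic_group_triviality[OF lnk, of k] assms by auto
  with ex have "short_exact_sequence (pair_homology (k - 1) (fan K - {0}) (fan K - axis_line v))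
    (local_homology k K) (pair_homology k (fan K) (fan K - axis_line v)) g f"
    unfolding short_exact_sequence_def by blast
  moreover have "free_of_rank (pair_homology k (fan K) (fan K - axis_line v)) a"
    by (rule free_of_rank_iso[OF assms(2) group.iso_sym[OF _ del]]) auto
  moreover have "free_of_rank (pair_homology (k - 1) (fan K - {0}) (fan K - axis_line v)) c"
    by (rule free_of_rank_iso[OF assms(3) group.iso_sym[OF _ lnk]]) auto
  ultimately show ?thesis
    by (rule free_of_rank_short_exact) auto
qed

text \<open>The value at the empty set is left free, because contracting \<open>v\<close> replaces
  \<open>\<rho>\<close> by \<open>\<lambda>I. \<rho> (insert v I)\<close>, which may change
  it.\<close>

definition matroid_rank :: "'r set \<Rightarrow> ('r set \<Rightarrow> int) \<Rightarrow> bool" where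
  "matroid_rank V \<rho> \<longleftrightarrow>
     (\<forall>I i. I \<subseteq> V \<longrightarrow> i \<in> V \<longrightarrow> \<rho> I \<le> \<rho> (insert i I) \<and> \<rho> (insert i I) \<le> \<rho> I + 1) \<and>
     (\<forall>I i j. I \<subseteq> V \<longrightarrow> i \<in> V \<longrightarrow> j \<in> V \<longrightarrow>
        \<rho> (insert j (insert i I)) - \<rho> (insert j I) \<le> \<rho> (insert i I) - \<rho> I)"

lemma matroid_rank_insert:
  assumes "matroid_rank V \<rho>" "I \<subseteq> V" "i \<in> V"
  shows "\<rho> I \<le> \<rho> (insert i I)" "\<rho> (insert i I) \<le> \<rho> I + 1"
  using assms by (simp_all add: matroid_rank_def)

lemma matroid_rank_submodular:
  assumes "matroid_rank V \<rho>" "I \<subseteq> V" "i \<in> V" "j \<in> V"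
  shows "\<rho> (insert j (insert i I)) - \<rho> (insert j I) \<le> \<rho> (insert i I) - \<rho> I"
  using assms by (simp add: matroid_rank_def)

definition rank_complex :: "'r set \<Rightarrow> ('r set \<Rightarrow> int) \<Rightarrow> int \<Rightarrow> 'r set set" where
  "rank_complex V \<rho> m = {I. I \<subseteq> V \<and> \<rho> I \<le> m}"

text \<open>The empty face is included with sign 1, so this is minus the reduced Euler
  characteristic.\<close>

definition signed_count :: "'r set set \<Rightarrow> int" where
  "signed_count K = (\<Sum>I\<in>K. (- 1) ^ card I)"

lemma matroid_rank_mono:
  assumes "matroid_rank V \<rho>" "finite V" "J \<subseteq> I" "I \<subseteq> V"
  shows "\<rho> J \<le> \<rho> I"
proof -
  have "finite (I - J)" using assms by (meson finite_Diff finite_subset)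
  moreover have "D \<subseteq> I - J \<Longrightarrow> \<rho> J \<le> \<rho> (J \<union> D)" if "finite D" for D
    using that
  proof (induction D)
    case (insert d D)
    then have "\<rho> (J \<union> D) \<le> \<rho> (insert d (J \<union> D))"
      using assms by (intro matroid_rank_insert(1)[OF assms(1)]) auto
    with insert show ?case by auto
  qed auto
  ultimately have "\<rho> J \<le> \<rho> (J \<union> (I - J))" by blast
  also have "J \<union> (I - J) = I" using assms by auto
  finally show ?thesis .
qed

text \<open>By submodularity the gain from adding \<open>v\<close> cannot exceed its gain over the
  empty set, which is 0 for a loop.\<close>

lemma matroid_rank_loop:
  assumes "matroid_rank V \<rho>" "finite I" "I \<subseteq> V" "v \<in> V" "\<rho> {v} = \<rho> {}"
  shows "\<rho> (insert v I) = \<rho> I"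
  using assms(2,3)
proof (induction I)
  case (insert i I)
  then have "\<rho> (insert i (insert v I)) - \<rho> (insert i I) \<le> \<rho> (insert v I) - \<rho> I"
    "\<rho> (insert i I) \<le> \<rho> (insert v (insert i I))"
    using assms matroid_rank_submodular[OF assms(1), of I v i] matroid_rank_insert(1)[OF assms(1), of "insert i I" v]
    by (auto simp: insert_commute)
  with insert show ?case by (simp add: insert_commute)
qed (use assms in simp)

lemma down_closed_rank_complex:
  assumes "matroid_rank V \<rho>" "finite V"
  shows "down_closed (rank_complex V \<rho> m)"
  unfolding down_closed_def rank_complex_def using matroid_rank_mono[OF assms]
  by (auto intro: order_trans)

text \<open>Removing \<open>v\<close> matches the faces through \<open>v\<close> with the faces of
  the link and flips their sign.\<close>

lemma signed_count_deletion_link: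
  fixes K :: "'r :: finite set set"
  shows "signed_count K = signed_count (deletion v K) - signed_count (link v K)"
proof -
  have "signed_count K = signed_count (deletion v K) + (\<Sum>I\<in>{I \<in> K. v \<in> I}. (- 1) ^ card I)"
    unfolding signed_count_def deletion_def
    by (subst sum.union_disjoint[symmetric]) (auto intro!: sum.cong)
  also have "(\<Sum>I\<in>{I \<in> K. v \<in> I}. (- 1 :: int) ^ card I) = (\<Sum>I\<in>link v K. - ((- 1) ^ card I))"
  proof (rule sum.reindex_bij_witness[where i = "insert v" and j = "\<lambda>I. I - {v}"])
    show "- ((- 1 :: int) ^ card (I - {v})) = (- 1) ^ card I" if "I \<in> {I \<in> K. v \<in> I}" for I
      using that by (subst card.remove[of I v]) auto
  qed (auto simp: link_def insert_absorb)
  finally show ?thesis by (simp add: signed_count_def sum_negf)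
qed

lemma signed_count_cone:
  fixes K :: "'r :: finite set set"
  assumes "down_closed K" "\<And>I. I \<in> K \<Longrightarrow> insert v I \<in> K"
  shows "signed_count K = 0"
proof -
  have "deletion v K = link v K"
    using assms unfolding deletion_def link_def down_closed_def by blast
  then show ?thesis using signed_count_deletion_link[of K v] by simp
qed

text \<open>The exceptional case \<open>V = {}\<close>, \<open>m > \<rho> {}\<close> is a single point, with homology in degree 0.\<close>
theorem local_homology_rank_complex:
  fixes \<rho> :: "'r :: finite set \<Rightarrow> int"
  assumes "matroid_rank V \<rho>" "V = {} \<Longrightarrow> m \<le> \<rho> {}"
  shows "\<exists>n. free_of_rank (local_homology k (rank_complex V \<rho> m)) n \<and>
    int n = (if k = m - \<rho> {} then (- 1) ^ nat k * signed_count (rank_complex V \<rho> m) else 0)"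
  using assms
proof (induction "card V" arbitrary: V \<rho> m k rule: less_induct)
  case less
  let ?K = "rank_complex V \<rho> m"
  note mr = less.prems(1)
  have dc: "down_closed ?K" by (rule down_closed_rank_complex[OF mr]) simp
  have trivial_case: ?case if "trivial_group (local_homology k ?K)" "signed_count ?K = 0"
    using free_of_rank_trivial[OF comm_group_pair_homology that(1)] that(2) by (intro exI[of _ 0]) simp
  \<comment> \<open>The complex is empty, or a single face \<open>{}\<close>, or a cone. Otherwise
    \<open>V\<close> has no loops and \<open>m\<close> is at least \<open>\<rho> {}\<close> but
    below \<open>\<rho> V\<close>; only there are deletion and link used.\<close>
  consider "m < \<rho> {}" | "V = {}" "m = \<rho> {}"
    | v where "v \<in> V" "\<And>I. I \<in> ?K \<Longrightarrow> insert v I \<in> ?K"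
    | v where "v \<in> V" "\<rho> {} \<le> m" "m < \<rho> V" "\<And>i. i \<in> V \<Longrightarrow> \<rho> {i} \<noteq> \<rho> {}"
  proof -
    \<comment> \<open>At or above the full rank the complex is a simplex, a cone over any of its
      vertices.\<close>
    have "insert v I \<in> ?K" if "v \<in> V" "m \<ge> \<rho> V" "I \<in> ?K" for v I
    proof -
      have "insert v I \<subseteq> V" using that by (auto simp: rank_complex_def)
      then show ?thesis using that matroid_rank_mono[OF mr, of "insert v I" V] by (auto simp: rank_complex_def)
    qed
    moreover have "insert i I \<in> ?K" if "i \<in> V" "\<rho> {i} = \<rho> {}" "I \<in> ?K" for i I
      using that matroid_rank_loop[OF mr, of I i] by (auto simp: rank_complex_def)
    ultimately have "\<exists>v. v \<in> V \<and> (\<forall>I\<in>?K. insert v I \<in> ?K)"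
      if "V \<noteq> {}" "m \<ge> \<rho> V \<or> (\<exists>i\<in>V. \<rho> {i} = \<rho> {})"
      using that by (metis ex_in_conv)
    note v = this
    have v: "\<exists>v. v \<in> V \<and> (\<forall>I\<in>?K. insert v I \<in> ?K)"
      if "V \<noteq> {}" "m \<ge> \<rho> V \<or> (\<exists>i\<in>V. \<rho> {i} = \<rho> {})" by (rule v[OF that])
    show ?thesis
    proof (cases "m < \<rho> {}")
      case False
      show ?thesis
      proof (cases "V = {}")
        case True
        have "m = \<rho> {}" using False less.prems(2)[OF True] by linarith
        with True show ?thesis by (rule that(2))
      next
        case nonempty: False
        show ?thesis
        proof (cases "m \<ge> \<rho> V \<or> (\<exists>i\<in>V. \<rho> {i} = \<rho> {})")
          case True
          from v[OF nonempty True] obtain w where w: "w \<in> V" "\<forall>I\<in>?K. insert w I \<in> ?K" by blast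
          then have "\<And>I. I \<in> ?K \<Longrightarrow> insert w I \<in> ?K" by blast
          then show ?thesis by (rule that(3)[OF w(1)])
        next
          case bad: False
          obtain w where "w \<in> V" using nonempty by auto
          show ?thesis
          proof (rule that(4)[OF \<open>w \<in> V\<close>])
            show "\<rho> {} \<le> m" using False by linarith
            show "m < \<rho> V" using bad by linarith
            show "\<rho> {i} \<noteq> \<rho> {}" if "i \<in> V" for i using bad that by blast
          qed
        qed
      qed
    qed (rule that(1))
  qed
  then show ?case
  proof cases
    case 1
    have "I \<notin> ?K" for I
    proof
      assume "I \<in> ?K"
      then have "\<rho> {} \<le> \<rho> I" "\<rho> I \<le> m"
        using matroid_rank_mono[OF mr _ empty_subsetI, of I] by (simp_all add: rank_complex_def)
      with 1 show False by linarith
    qed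
    then have "?K = {}" by blast
    then show ?thesis
      by (intro trivial_case) (simp_all add: local_homology_empty signed_count_def)
  next
    case 2
    then have K: "?K = {{}}" by (auto simp: rank_complex_def)
    show ?thesis
    proof (cases "k = 0")
      case True
      have "free_of_rank (local_homology 0 {{}}) 1"
        by (rule free_of_rank_iso[OF free_of_rank_integer_group group.iso_sym[OF _ local_homology_point(2)]]) auto
      then show ?thesis using True 2(2) unfolding K by (intro exI[of _ 1]) (simp add: signed_count_def)
    next
      case False
      then show ?thesis
        using 2(2) free_of_rank_trivial[OF comm_group_pair_homology local_homology_point(1)] unfolding K
        by (intro exI[of _ 0]) simp
    qed
  next
    case 3
    show ?thesis
      by (rule trivial_case[OF local_homology_cone[OF dc 3(2)] signed_count_cone[OF dc 3(2)]])
  next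
    case (4 v)
    let ?V = "V - {v}" and ?\<rho> = "\<lambda>I. \<rho> (insert v I)"
    have small: "card ?V < card V" using 4(1) by (intro psubset_card_mono) auto
    have del: "deletion v ?K = rank_complex ?V \<rho> m" by (auto simp: deletion_def rank_complex_def)
    have lnk: "link v ?K = rank_complex ?V ?\<rho> m" using 4(1) by (auto simp: link_def rank_complex_def)
    \<comment> \<open>Since \<open>v\<close> is not a loop, the link has base rank
      \<open>\<rho> {} + 1\<close>. Its homology therefore sits one degree below that of the
      deletion, which is exactly the shift in the exact sequence.\<close>
    have \<rho>v: "\<rho> {v} = \<rho> {} + 1"
    proof -
      have "\<rho> {} \<le> \<rho> {v}" "\<rho> {v} \<le> \<rho> {} + 1"
        using matroid_rank_insert[OF mr _ 4(1), of "{}"] by auto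
      with 4(4)[OF 4(1)] show ?thesis by linarith
    qed
    have mr1: "matroid_rank ?V \<rho>"
      unfolding matroid_rank_def
      by (intro conjI allI impI matroid_rank_insert[OF mr] matroid_rank_submodular[OF mr]) blast+
    have mr2: "matroid_rank ?V ?\<rho>"
      unfolding matroid_rank_def
    proof (intro conjI allI impI)
      fix I i j assume *: "I \<subseteq> ?V" "i \<in> ?V"
      then have I: "insert v I \<subseteq> V" "i \<in> V" using 4(1) by auto
      then show "\<rho> (insert v I) \<le> \<rho> (insert v (insert i I))" "\<rho> (insert v (insert i I)) \<le> \<rho> (insert v I) + 1"
        using matroid_rank_insert[OF mr I] by (simp_all add: insert_commute)
      assume "j \<in> ?V"
      then have "\<rho> (insert j (insert i (insert v I))) - \<rho> (insert j (insert v I)) \<le> \<rho> (insert i (insert v I)) - \<rho> (insert v I)"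
        using I by (intro matroid_rank_submodular[OF mr]) auto
      then show "\<rho> (insert v (insert j (insert i I))) - \<rho> (insert v (insert j I))
          \<le> \<rho> (insert v (insert i I)) - \<rho> (insert v I)"
        by (simp add: insert_commute)
    qed
    \<comment> \<open>If \<open>v\<close> is the only element, the bounds on \<open>m\<close> force
      \<open>m = \<rho> {}\<close>, so the induction hypothesis applies to both complexes on the
      empty ground set.\<close>
    have emp: "m = \<rho> {}" if "?V = {}"
    proof -
      have "V = {v}" using that 4(1) by auto
      then show ?thesis using 4(2,3) \<rho>v by simp
    qed
    have IH1: "\<exists>n. free_of_rank (local_homology k (deletion v ?K)) n \<and>
      int n = (if k = m - \<rho> {} then (- 1) ^ nat k * signed_count (deletion v ?K) else 0)" for k
      unfolding del by (rule less.hyps[OF small mr1]) (use emp in auto)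
    have IH2: "\<exists>n. free_of_rank (local_homology k (link v ?K)) n \<and>
      int n = (if k = m - \<rho> {} - 1 then (- 1) ^ nat k * signed_count (link v ?K) else 0)" for k
      unfolding lnk using less.hyps[OF small mr2, of m k] emp \<rho>v by (simp add: algebra_simps)
    have triv1: "trivial_group (local_homology k (deletion v ?K))" if "k \<noteq> m - \<rho> {}" for k
      using IH1[of k] that by (auto intro: trivial_if_free_of_rank_0)
    have triv2: "trivial_group (local_homology k (link v ?K))" if "k \<noteq> m - \<rho> {} - 1" for k
      using IH2[of k] that by (auto intro: trivial_if_free_of_rank_0)
    show ?thesis
    proof (cases "k = m - \<rho> {}")
      case False
      then have "trivial_group (local_homology k ?K)"
        by (intro local_homology_trivial_if_deletion_link[OF dc, of _ v] triv1 triv2) auto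
      then show ?thesis
        using False free_of_rank_trivial[OF comm_group_pair_homology] by (intro exI[of _ 0]) simp
    next
      case True
      obtain a c where a: "free_of_rank (local_homology k (deletion v ?K)) a"
          "int a = (- 1) ^ nat k * signed_count (deletion v ?K)"
        and c: "free_of_rank (local_homology (k - 1) (link v ?K)) c"
          "int c = (- 1) ^ nat (k - 1) * signed_count (link v ?K)"
        using IH1[of k] IH2[of "k - 1"] True by auto
      have "free_of_rank (local_homology k ?K) (a + c)"
        by (intro local_homology_free_if_deletion_link[OF dc a(1) c(1)] triv1 triv2) (use True in auto)
      moreover have "int (a + c) = (- 1) ^ nat k * signed_count ?K"
      proof (cases "k = 0")
        case True
        \<comment> \<open>At \<open>k = 0\<close> the exponent \<open>nat (k - 1)\<close> is
          truncated, so the sign rule for the link fails. Without loops only the face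
          \<open>{}\<close> has rank at most \<open>\<rho> {}\<close>, so the link is empty and
          contributes nothing.\<close>
        have "?K = {{}}"
        proof -
          have "I = {}" if "I \<in> ?K" for I
          proof (rule ccontr)
            assume "I \<noteq> {}"
            then obtain i where "i \<in> I" by auto
            then have "{i} \<subseteq> I" by simp
            then have "{i} \<in> ?K" using dc that unfolding down_closed_def by blast
            then have "\<rho> {i} \<le> m" "i \<in> V" by (simp_all add: rank_complex_def)
            moreover have "\<rho> {} \<le> \<rho> {i}" using mr \<open>i \<in> V\<close> by (simp add: matroid_rank_def)
            ultimately show False using 4(4)[of i] True \<open>k = m - \<rho> {}\<close> by simp
          qed
          moreover have "{} \<in> ?K" using 4(2) by (auto simp: rank_complex_def)
          ultimately show ?thesis by blast
        qed
        then have "link v ?K = {}" by (auto simp: link_def)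
        then have "c = 0" "signed_count (link v ?K) = 0" using c(2) by (auto simp: signed_count_def)
        then show ?thesis using a signed_count_deletion_link[of ?K v] by simp
      next
        case False
        then have "nat k = Suc (nat (k - 1))" using True 4(2) by linarith
        then show ?thesis
          using a(2) c(2) unfolding signed_count_deletion_link[of ?K v] by (simp add: algebra_simps)
      qed
      ultimately show ?thesis using True by (intro exI[of _ "a + c"]) simp
    qed
  qed
qed

section \<open>Cubical sets near their lowest vertex\<close>

definition cubical :: "(('r :: finite \<Rightarrow> nat) \<Rightarrow> 'r set \<Rightarrow> bool) \<Rightarrow> (real ^ 'r) set" where
  "cubical P = \<Union>{cube l I | l I. P l I}"

text \<open>A face of a cube arises by moving along the directions \<open>J\<close> to the opposite
  side and keeping the directions \<open>I'\<close>, disjoint from \<open>J\<close>, free.\<close>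

definition face_closed :: "(('r :: finite \<Rightarrow> nat) \<Rightarrow> 'r set \<Rightarrow> bool) \<Rightarrow> bool" where
  "face_closed P \<longleftrightarrow> (\<forall>l I J I'. P l I \<longrightarrow> J \<subseteq> I \<longrightarrow> I' \<subseteq> I - J \<longrightarrow> P (l + E J) I')"

definition lattice_point :: "('r :: finite \<Rightarrow> nat) \<Rightarrow> real ^ 'r" where
  "lattice_point l = (\<chi> i. real (l i))"

text \<open>A point with nonnegative coordinates lies in the relative interior of exactly one cube:
  \<open>nat_floor\<close> is its lowest vertex and \<open>frac_support\<close> its set of
  directions.\<close>

definition nat_floor :: "real ^ 'r :: finite \<Rightarrow> 'r \<Rightarrow> nat" where
  "nat_floor x = (\<lambda>i. nat \<lfloor>x $ i\<rfloor>)"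

definition frac_support :: "real ^ 'r :: finite \<Rightarrow> 'r set" where
  "frac_support x = {i. x $ i \<noteq> real (nat_floor x i)}"

lemma lattice_point_nth [simp]: "lattice_point l $ i = real (l i)"
  by (simp add: lattice_point_def)

lemma mem_cube: "x \<in> cube l I \<longleftrightarrow> (\<forall>i. real (l i) \<le> x $ i \<and> x $ i \<le> real (l i) + (if i \<in> I then 1 else 0))"
  by (auto simp: cube_def mem_box_cart E_def)

text \<open>The cube containing \<open>x\<close> in its relative interior is a face of every cube
  through \<open>x\<close>; with all faces included it is the only one to be tested.\<close>

lemma mem_cubical_iff:
  assumes "face_closed P"
  shows "x \<in> cubical P \<longleftrightarrow> (\<forall>i. 0 \<le> x $ i) \<and> P (nat_floor x) (frac_support x)"
proof (intro iffI conjI allI)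
  assume "x \<in> cubical P"
  then obtain l I where x: "x \<in> cube l I" and P: "P l I" by (auto simp: cubical_def)
  have b: "real (l i) \<le> x $ i" "x $ i \<le> real (l i) + (if i \<in> I then 1 else 0)" for i
    using x by (auto simp: mem_cube)
  show "0 \<le> x $ i" for i using b(1)[of i] by linarith
  define J where "J = {i \<in> I. x $ i = real (l i) + 1}"
  have fl: "nat_floor x i = l i + E J i" for i
  proof (cases "i \<in> J")
    case True
    then have "x $ i = real (l i + 1)" by (simp add: J_def)
    then show ?thesis using True by (simp only: nat_floor_def E_def floor_of_nat) simp
  next
    case False
    then have "x $ i < real (l i) + 1" using b(2)[of i] by (auto simp: J_def split: if_splits)
    with b(1)[of i] have "\<lfloor>x $ i\<rfloor> = int (l i)" by (intro floor_unique) auto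
    then show ?thesis using False by (simp add: nat_floor_def E_def)
  qed
  then have "nat_floor x = l + E J" by (simp add: fun_eq_iff)
  moreover have "frac_support x \<subseteq> I - J"
  proof
    fix i assume "i \<in> frac_support x"
    then have "x $ i \<noteq> real (l i + E J i)" by (simp add: frac_support_def fl)
    with b[of i] show "i \<in> I - J" by (auto simp: J_def E_def split: if_splits)
  qed
  ultimately show "P (nat_floor x) (frac_support x)"
    using assms P unfolding face_closed_def J_def by fastforce
next
  assume x: "(\<forall>i. 0 \<le> x $ i) \<and> P (nat_floor x) (frac_support x)"
  have "x \<in> cube (nat_floor x) (frac_support x)"
    unfolding mem_cube
  proof
    fix i
    have "0 \<le> x $ i" using x by simp
    then have "real (nat_floor x i) = of_int \<lfloor>x $ i\<rfloor>" by (simp add: nat_floor_def)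
    then show "real (nat_floor x i) \<le> x $ i \<and>
        x $ i \<le> real (nat_floor x i) + (if i \<in> frac_support x then 1 else 0)"
      by (auto simp: frac_support_def nat_floor_def)
  qed
  with x show "x \<in> cubical P" by (auto simp: cubical_def)
qed

text \<open>A vertex of larger size than \<open>l\<close> must exceed it in some coordinate;
  conversely the floor of a point with such a coordinate has larger size. This identifies the
  subspace of the pair with the complement of a half-open cube at \<open>l\<close>.\<close>

lemma mem_X_deg_iff:
  assumes "x \<in> X_above l"
  shows "x \<in> X_deg (size_vec l + 1) \<longleftrightarrow> (\<exists>i. real (l i) + 1 \<le> x $ i)"
proof
  assume "x \<in> X_deg (size_vec l + 1)"
  then obtain l' I where l': "x \<in> cube l' I" "size_vec l + 1 \<le> size_vec l'" by (auto simp: X_deg_def)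
  then have "\<not> (\<forall>i. l' i \<le> l i)"
    unfolding size_vec_def by (metis Suc_eq_plus1 not_less_eq_eq sum_mono)
  then obtain i where "l i < l' i" by (auto simp: not_le)
  then have "real (l i) + 1 \<le> real (l' i)" by linarith
  moreover have "real (l' i) \<le> x $ i" using l' by (simp add: mem_cube)
  ultimately show "\<exists>i. real (l i) + 1 \<le> x $ i" by (intro exI[of _ i]) linarith
next
  assume "\<exists>i. real (l i) + 1 \<le> x $ i"
  then obtain i where i: "real (l i) + 1 \<le> x $ i" by blast
  have x: "real (l j) \<le> x $ j" for j using assms by (simp add: X_above_def)
  have ge: "l j \<le> nat_floor x j" for j using x[of j] by (simp add: nat_floor_def le_nat_iff le_floor_iff)
  have "l i + 1 \<le> nat_floor x i" using i by (simp add: nat_floor_def le_nat_iff le_floor_iff)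
  then have "size_vec l < size_vec (nat_floor x)"
    unfolding size_vec_def using ge by (intro sum_strict_mono_ex1) (auto intro!: exI[of _ i])
  moreover have "x \<in> cubical (\<lambda>l' I. size_vec l + 1 \<le> size_vec l')"
  proof (subst mem_cubical_iff)
    show "face_closed (\<lambda>l' I. size_vec l + 1 \<le> size_vec l')"
      by (auto simp: face_closed_def size_vec_def sum.distrib)
    show "(\<forall>i. 0 \<le> x $ i) \<and> size_vec l + 1 \<le> size_vec (nat_floor x)"
      using x calculation by (auto intro: order_trans[OF of_nat_0_le_iff])
  qed
  ultimately show "x \<in> X_deg (size_vec l + 1)" by (simp add: X_deg_def cubical_def)
qed

lemma nat_floor_eq:
  fixes x :: "real ^ 'r :: finite"
  assumes "\<And>i. real (l i) \<le> x $ i" "\<And>i. x $ i < real (l i) + 1"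
  shows "nat_floor x = l" "frac_support x = {i. x $ i - real (l i) \<noteq> 0}"
proof -
  have "\<lfloor>x $ i\<rfloor> = int (l i)" for i using assms[of i] by (intro floor_unique) auto
  then show "nat_floor x = l" by (simp add: nat_floor_def fun_eq_iff)
  then show "frac_support x = {i. x $ i - real (l i) \<noteq> 0}" by (simp add: frac_support_def)
qed

lemma continuous_on_infnorm: "continuous_on S (infnorm :: 'a :: euclidean_space \<Rightarrow> real)"
proof -
  have "\<bar>infnorm x - infnorm y\<bar> \<le> norm (x - y)" for x y :: 'a
    using infnorm_triangle[of "x - y" y] infnorm_triangle[of "y - x" x] infnorm_le_norm[of "x - y"]
      infnorm_sub[of x y] by simp
  then have "1-lipschitz_on S (infnorm :: 'a \<Rightarrow> real)"
    by (intro lipschitz_onI) (auto simp: dist_norm)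
  then show ?thesis by (rule lipschitz_on_continuous_on)
qed

lemma component_le_infnorm: "\<bar>y $ i\<bar> \<le> infnorm (y :: real ^ 'r :: finite)"
  using component_le_infnorm_cart by blast

lemma infnorm_attained: "\<exists>i. infnorm (y :: real ^ 'r :: finite) = \<bar>y $ i\<bar>"
proof -
  have "infnorm y = Max (range (\<lambda>i. \<bar>y $ i\<bar>))"
    unfolding infnorm_cart by (subst cSup_eq_Max) (auto simp: full_SetCompr_eq)
  also have "\<dots> \<in> range (\<lambda>i. \<bar>y $ i\<bar>)" by (intro Max_in) auto
  finally show ?thesis by auto
qed

text \<open>Radial projection from the lattice point \<open>l\<close>, stopped once some coordinate exceeds \<open>l\<close> by 1.\<close>
definition radial_push :: "('r :: finite \<Rightarrow> nat) \<Rightarrow> real ^ 'r \<Rightarrow> real ^ 'r" where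
  "radial_push l x = lattice_point l + (1 / min 1 (infnorm (x - lattice_point l))) *\<^sub>R (x - lattice_point l)"

text \<open>\<open>radial_push\<close> deforms the punctured set onto \<open>B\<close>. It uses the
  maximum norm, whose unit ball matches the cubes, so a point close to \<open>l\<close> moves inside
  its own cube until a coordinate reaches the upper facet.\<close>

lemma pair_homology_punctured:
  fixes P :: "('r :: finite \<Rightarrow> nat) \<Rightarrow> 'r set \<Rightarrow> bool" and l :: "'r \<Rightarrow> nat"
  assumes P: "face_closed P"
  defines "A \<equiv> cubical P \<inter> X_above l"
  defines "B \<equiv> {x \<in> A. \<exists>i. real (l i) + 1 \<le> x $ i}"
  shows "trivial_group (pair_homology k (A - {lattice_point l}) B)"
proof -
  let ?L = "lattice_point l" and ?r = "radial_push l"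
  have BA: "B \<subseteq> A - {?L}" by (auto simp: B_def)
  have far: "?r x = x" if "infnorm (x - ?L) \<ge> 1" for x
    using that by (simp add: radial_push_def)
  have B_far: "infnorm (x - ?L) \<ge> 1" if x: "x \<in> B" for x
  proof -
    obtain i where i: "real (l i) + 1 \<le> x $ i" using x by (auto simp: B_def)
    have "\<bar>(x - ?L) $ i\<bar> \<le> infnorm (x - ?L)" by (rule component_le_infnorm)
    then show ?thesis using i by simp
  qed
  have near: "(1 - t) *\<^sub>R ?r x + t *\<^sub>R x \<in> A - {?L} \<and> (t = 0 \<longrightarrow> ?r x \<in> B)"
    if x: "x \<in> A - {?L}" and t: "0 \<le> t" "t \<le> 1" and small: "infnorm (x - ?L) < 1" for x t
  proof -
    define M where "M = infnorm (x - ?L)"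
    have M: "0 < M" "M < 1" using x small by (auto simp: M_def infnorm_pos_lt)
    \<comment> \<open>A point of the segment lies on the ray from \<open>l\<close> through
      \<open>x\<close>; \<open>c\<close> is its stretching factor, at most \<open>1 / M\<close>, so
      it stays in the cube.\<close>
    define c where "c = (1 - t) / M + t"
    have y0: "0 \<le> (x - ?L) $ i" for i using x by (auto simp: A_def X_above_def)
    have yM: "(x - ?L) $ i \<le> M" for i using component_le_infnorm[of "x - ?L" i] by (simp add: M_def)
    have r: "?r x = ?L + (1 / M) *\<^sub>R (x - ?L)" using M by (simp add: radial_push_def M_def)
    have eq: "(1 - t) *\<^sub>R ?r x + t *\<^sub>R x = ?L + c *\<^sub>R (x - ?L)"
      unfolding r c_def by (simp add: algebra_simps)
    have c: "0 < c" "c \<le> 1 / M"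
    proof -
      have "t \<le> t / M" using t M by (simp add: le_divide_eq mult_left_le)
      moreover have "c = (1 / M - t / M) + t" by (simp add: c_def diff_divide_distrib)
      ultimately show "c \<le> 1 / M" by simp
      show "0 < c"
        using t M by (cases "t = 0") (auto simp: c_def intro!: add_nonneg_pos)
    qed
    have fl: "nat_floor x = l" "frac_support x = {i. x $ i - real (l i) \<noteq> 0}"
    proof -
      have "real (l i) \<le> x $ i" "x $ i < real (l i) + 1" for i using y0[of i] yM[of i] M by auto
      from nat_floor_eq[OF this] show "nat_floor x = l" "frac_support x = {i. x $ i - real (l i) \<noteq> 0}" .
    qed
    have "P l (frac_support x)" using x mem_cubical_iff[OF P, of x] fl by (auto simp: A_def)
    moreover have in_cube: "?L + c *\<^sub>R (x - ?L) \<in> cube l (frac_support x)"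
      unfolding mem_cube
    proof
      fix i
      have "c * (x - ?L) $ i \<le> 1 / M * M"
        using c M y0[of i] yM[of i] by (intro mult_mono) auto
      then have "c * (x - ?L) $ i \<le> 1" using M by simp
      moreover have "0 \<le> c * (x - ?L) $ i" using c y0[of i] by (intro mult_nonneg_nonneg) auto
      ultimately show "real (l i) \<le> (?L + c *\<^sub>R (x - ?L)) $ i \<and>
          (?L + c *\<^sub>R (x - ?L)) $ i \<le> real (l i) + (if i \<in> frac_support x then 1 else 0)"
        by (auto simp: fl)
    qed
    moreover have "?L + c *\<^sub>R (x - ?L) \<in> X_above l"
      using in_cube unfolding mem_cube X_above_def by blast
    ultimately have "?L + c *\<^sub>R (x - ?L) \<in> A"
      unfolding A_def cubical_def by blast
    moreover have "?L + c *\<^sub>R (x - ?L) \<noteq> ?L" using c x by auto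
    ultimately have mem: "(1 - t) *\<^sub>R ?r x + t *\<^sub>R x \<in> A - {?L}" using eq by simp
    moreover have "?r x \<in> B" if "t = 0"
    proof -
      obtain i where "M = \<bar>(x - ?L) $ i\<bar>" using infnorm_attained[of "x - ?L"] by (auto simp: M_def)
      then have "M = (x - ?L) $ i" using y0[of i] by simp
      then have "?r x $ i = real (l i) + 1" using M by (simp add: r)
      moreover have "?r x \<in> A" using mem that by simp
      ultimately show ?thesis by (auto simp: B_def intro!: exI[of _ i])
    qed
    ultimately show ?thesis using mem by blast
  qed
  have far_B: "x \<in> B" if "x \<in> A" "infnorm (x - ?L) \<ge> 1" for x
  proof -
    obtain i where "infnorm (x - ?L) = \<bar>(x - ?L) $ i\<bar>" using infnorm_attained by blast
    moreover have "0 \<le> (x - ?L) $ i" using that by (simp add: A_def X_above_def)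
    ultimately have "real (l i) + 1 \<le> x $ i" using that by simp
    then show ?thesis using that by (auto simp: B_def)
  qed
  have rB: "?r x \<in> B" if "x \<in> A - {?L}" for x
    using near[of x 0] far[of x] far_B[of x] that by (cases "infnorm (x - ?L) < 1") auto
  have r_id: "?r x = x" if "x \<in> B" for x using far B_far that by blast
  have "pair_homology k (A - {?L}) B \<cong> pair_homology k B B"
  proof (rule linear_homotopy_equivalence_iso[where f = ?r and g = id])
    show "continuous_on (A - {?L}) ?r"
      unfolding radial_push_def
      by (intro continuous_intros continuous_on_compose2[OF continuous_on_infnorm[of UNIV]])
        (auto simp: min_def infnorm_eq_0)
    show "?r \<in> A - {?L} \<rightarrow> B" using rB by blast
    show "?r \<in> B \<rightarrow> B" using r_id by auto
    show "(1 - t) *\<^sub>R id (?r x) + t *\<^sub>R x \<in> A - {?L}" if "x \<in> A - {?L}" "0 \<le> t" "t \<le> 1" for x t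
    proof (cases "infnorm (x - ?L) < 1")
      case True
      then show ?thesis using near[OF that] by simp
    next
      case False
      then have "(1 - t) *\<^sub>R id (?r x) + t *\<^sub>R x = x"
        using far[of x] by (simp flip: scaleR_left.add)
      then show ?thesis using that by simp
    qed
    show "(1 - t) *\<^sub>R id (?r x) + t *\<^sub>R x \<in> B" if "x \<in> B" "0 \<le> t" "t \<le> 1" for x t
      using that r_id by (simp flip: scaleR_left.add)
    show "(1 - t) *\<^sub>R ?r (id x) + t *\<^sub>R x \<in> B" if "x \<in> B" "0 \<le> t" "t \<le> 1" for x t
      using that r_id by (simp flip: scaleR_left.add)
    show "(1 - t) *\<^sub>R ?r (id x) + t *\<^sub>R x \<in> B" if "x \<in> B" "0 \<le> t" "t \<le> 1" for x t
      using that r_id by (simp flip: scaleR_left.add)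
  qed (use BA in auto)
  moreover have "trivial_group (pair_homology k B B)"
    using trivial_relative_homology_group_topspace[of k "top_of_set B"] by simp
  ultimately show ?thesis by (simp add: isomorphic_group_triviality)
qed

text \<open>In the exact sequence of the triple the groups of (\<open>S\<close>, \<open>T\<close>)
  vanish on both sides of the map induced by the identity.\<close>

lemma pair_homology_iso_if_trivial:
  assumes "T \<subseteq> S" "S \<subseteq> A" "\<And>k. trivial_group (pair_homology k S T)"
  shows "pair_homology k A T \<cong> pair_homology k A S"
proof -
  let ?X = "top_of_set A"
  have "subtopology ?X S = top_of_set S"
    using assms(2) by (simp add: subtopology_subtopology Int_absorb1)
  then have "exact_seq ([pair_homology (k - 1) S T, pair_homology k A S, pair_homology k A T, pair_homology k S T],
      [hom_relboundary k ?X S T, hom_induced k ?X T ?X S id, hom_induced k (top_of_set S) T ?X T id])"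
    using homology_exactness_triple_1[OF assms(1), of k ?X]
      homology_exactness_triple_3[OF assms(1), of k ?X]
    by (metis exact_seq_cons_iff)
  from very_short_exact_sequence[OF this assms(3) assms(3)] show ?thesis
    by (auto simp: is_iso_def)
qed

text \<open>Excision removes all cubes that do not have \<open>l\<close> as their lowest vertex.\<close>
theorem pair_homology_lowest_vertex:
  fixes P :: "('r :: finite \<Rightarrow> nat) \<Rightarrow> 'r set \<Rightarrow> bool"
  assumes P: "face_closed P"
  shows "pair_homology k (cubical P \<inter> X_above l) (cubical P \<inter> X_above l \<inter> X_deg (size_vec l + 1))
    \<cong> local_homology k {I. P l I}"
proof -
  define A where "A = cubical P \<inter> X_above l"
  let ?L = "lattice_point l"
  let ?B = "{x \<in> A. \<exists>i. real (l i) + 1 \<le> x $ i}"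
  let ?C = "{x \<in> A. \<forall>i. x $ i < real (l i) + 1}"
  \<comment> \<open>The subspace is first enlarged to the complement of the vertex; afterwards
    everything outside the half-open cube can be excised.\<close>
  have 1: "pair_homology k A ?B \<cong> pair_homology k A (A - {?L})"
    unfolding A_def by (rule pair_homology_iso_if_trivial[OF _ _ pair_homology_punctured[OF P]]) auto
  have "pair_homology k (A - ?B) (A - {?L} - ?B) \<cong> pair_homology k A (A - {?L})"
  proof (rule pair_homology_excision)
    have "closed (\<Union>i. {x :: real ^ 'r. real (l i) + 1 \<le> x $ i})"
      by (intro closed_UN ballI closed_Collect_le continuous_intros) auto
    then have "closedin (top_of_set A) (A \<inter> (\<Union>i. {x. real (l i) + 1 \<le> x $ i}))"
      by (rule closedin_closed_Int)
    also have "A \<inter> (\<Union>i. {x. real (l i) + 1 \<le> x $ i}) = ?B" by auto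
    finally show "closedin (top_of_set A) ?B" .
    show "openin (top_of_set A) (A - {?L})"
      by (simp add: Diff_eq openin_open_Int open_Compl)
  qed auto
  moreover have C: "A - ?B = ?C" by (simp add: set_eq_iff not_le) blast
  moreover have "A - {?L} - ?B = ?C - {?L}" using C by blast
  ultimately have 2: "pair_homology k ?C (?C - {?L}) \<cong> pair_homology k A (A - {?L})" by simp
  define K where "K = {I. P l I}"
  have C_iff: "x \<in> ?C \<longleftrightarrow> (\<forall>i. 0 \<le> x $ i - real (l i) \<and> x $ i - real (l i) < 1) \<and> {i. x $ i - real (l i) \<noteq> 0} \<in> K" for x
  proof (cases "\<forall>i. 0 \<le> x $ i - real (l i) \<and> x $ i - real (l i) < 1")
    case True
    have "real (l i) \<le> x $ i" "x $ i < real (l i) + 1" for i using True[rule_format, of i] by auto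
    note fl = nat_floor_eq[OF this]
    have "0 \<le> x $ i" for i using True[rule_format, of i] by linarith
    then have "x \<in> cubical P \<longleftrightarrow> {i. x $ i - real (l i) \<noteq> 0} \<in> K"
      using mem_cubical_iff[OF P, of x] fl by (simp add: K_def)
    moreover have "x \<in> X_above l" using True by (simp add: X_above_def)
    moreover have "x $ i < real (l i) + 1" for i using True[rule_format, of i] by linarith
    ultimately show ?thesis using True by (auto simp: A_def)
  next
    case False
    then obtain i where "\<not> (0 \<le> x $ i - real (l i) \<and> x $ i - real (l i) < 1)" by blast
    then have "x $ i < real (l i) \<or> real (l i) + 1 \<le> x $ i" by linarith
    then have "x \<notin> ?C" by (auto simp: A_def X_above_def not_le not_less intro!: exI[of _ i])
    with False show ?thesis by blast
  qed
  define f where "f x = x - ?L" for x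
  \<comment> \<open>\<open>f\<close> embeds the half-open cubes into the fan;
    \<open>s / (1 + s)\<close> compresses each ray into a unit interval without changing supports.
    The two maps are inverse only up to homotopy.\<close>
  define g where "g y = ?L + (\<chi> i. y $ i / (1 + y $ i))" for y :: "real ^ 'r"
  have f [simp]: "f x $ i = x $ i - real (l i)" for x i by (simp add: f_def)
  have g [simp]: "g y $ i = real (l i) + y $ i / (1 + y $ i)" for y i by (simp add: g_def)
  have frac: "0 \<le> s / (1 + s)" "s / (1 + s) < 1" "s / (1 + s) = 0 \<longleftrightarrow> s = 0" if "0 \<le> s" for s :: real
    using that by (auto simp: divide_less_eq)
  have mix: "0 \<le> (1 - t) * (s / (1 + s)) + t * s"
      "s < 1 \<Longrightarrow> (1 - t) * (s / (1 + s)) + t * s < 1"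
      "(1 - t) * (s / (1 + s)) + t * s = 0 \<longleftrightarrow> s = 0"
    if "0 \<le> s" "0 \<le> t" "t \<le> 1" for s t :: real
  proof -
    show "0 \<le> (1 - t) * (s / (1 + s)) + t * s" using that frac[of s] by simp
    show "(1 - t) * (s / (1 + s)) + t * s < 1" if "s < 1"
      using convex_bound_lt[of "s / (1 + s)" 1 s "1 - t" t] frac[of s] that \<open>0 \<le> s\<close> \<open>0 \<le> t\<close> \<open>t \<le> 1\<close> by simp
    show "(1 - t) * (s / (1 + s)) + t * s = 0 \<longleftrightarrow> s = 0"
    proof
      assume *: "(1 - t) * (s / (1 + s)) + t * s = 0"
      have "0 \<le> (1 - t) * (s / (1 + s))" "0 \<le> t * s" using that frac[of s] by simp_all
      with * have "(1 - t) * (s / (1 + s)) = 0" "t * s = 0" by linarith+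
      then show "s = 0" using frac[of s] that by (cases "t = 0") auto
    qed simp
  qed
  have 3: "pair_homology k ?C (?C - {?L}) \<cong> local_homology k K"
  proof (rule linear_homotopy_equivalence_iso[where f = f and g = g])
    show "continuous_on ?C f" unfolding f_def by (intro continuous_intros)
    show "continuous_on (fan K) g"
      unfolding g_def by (intro continuous_intros) (auto simp: fan_def add_nonneg_eq_0_iff)
    show f1: "f \<in> ?C \<rightarrow> fan K"
    proof
      fix x assume "x \<in> ?C"
      then show "f x \<in> fan K" unfolding C_iff fan_def mem_Collect_eq f by blast
    qed
    have f0: "f x = 0 \<longleftrightarrow> x = ?L" for x by (simp add: f_def)
    show "f \<in> ?C - {?L} \<rightarrow> fan K - {0}" using f1 f0 by auto
    have supp_g: "{i. g y $ i - real (l i) \<noteq> 0} = {i. y $ i \<noteq> 0}" if "y \<in> fan K" for y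
    proof -
      have "0 \<le> y $ i" for i using that by (simp add: fan_def)
      then have "g y $ i - real (l i) \<noteq> 0 \<longleftrightarrow> y $ i \<noteq> 0" for i
        using frac(3)[of "y $ i"] by (simp del: divide_eq_0_iff)
      then show ?thesis by blast
    qed
    show g1: "g \<in> fan K \<rightarrow> ?C"
    proof
      fix y assume y: "y \<in> fan K"
      then have "0 \<le> y $ i" for i by (simp add: fan_def)
      from frac(1,2)[OF this] have "\<forall>i. 0 \<le> g y $ i - real (l i) \<and> g y $ i - real (l i) < 1"
        unfolding g by simp
      moreover have "{i. g y $ i - real (l i) \<noteq> 0} \<in> K" using y unfolding supp_g[OF y] by (simp add: fan_def)
      ultimately show "g y \<in> ?C" unfolding C_iff by blast
    qed
    show "g \<in> fan K - {0} \<rightarrow> ?C - {?L}"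
    proof
      fix y assume y: "y \<in> fan K - {0}"
      then obtain i where "y $ i \<noteq> 0" by (auto simp: vec_eq_iff)
      moreover have "0 \<le> y $ i" using y by (simp add: fan_def)
      ultimately have "g y $ i \<noteq> ?L $ i" using frac(3)[of "y $ i"] by (simp del: divide_eq_0_iff)
      then have "g y \<noteq> ?L" by metis
      then show "g y \<in> ?C - {?L}" using g1 y by blast
    qed
    have C1: "(1 - t) *\<^sub>R g (f x) + t *\<^sub>R x \<in> ?C \<and> ((1 - t) *\<^sub>R g (f x) + t *\<^sub>R x = ?L \<longrightarrow> x = ?L)"
      if x: "x \<in> ?C" and t: "0 \<le> t" "t \<le> 1" for x t
    proof -
      let ?s = "\<lambda>i. x $ i - real (l i)" and ?z = "(1 - t) *\<^sub>R g (f x) + t *\<^sub>R x"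
      have z: "?z $ i - real (l i) = (1 - t) * (?s i / (1 + ?s i)) + t * ?s i" for i
      proof -
        have "(1 - t) * (a + q) + t * b - a = (1 - t) * q + t * (b - a)" for a b q :: real
          by (simp add: algebra_simps)
        then show ?thesis by (simp only: vector_add_component vector_scaleR_component real_scaleR_def g f)
      qed
      have s: "0 \<le> ?s i" "?s i < 1" for i using x unfolding C_iff by blast+
      have "\<forall>i. 0 \<le> ?z $ i - real (l i) \<and> ?z $ i - real (l i) < 1"
        unfolding z using mix(1)[OF s(1) t] mix(2)[OF s(1) t s(2)] by blast
      moreover have "{i. ?z $ i - real (l i) \<noteq> 0} = {i. ?s i \<noteq> 0}"
        unfolding z using mix(3)[OF s(1) t] by blast
      moreover have "{i. ?s i \<noteq> 0} \<in> K" using x unfolding C_iff by blast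
      ultimately have "?z \<in> ?C" unfolding C_iff by metis
      moreover have "x = ?L" if "?z = ?L"
      proof -
        have "?z $ i - real (l i) = 0" for i by (subst that) simp
        then have "?s i = 0" for i using mix(3)[OF s(1) t] unfolding z by blast
        then show ?thesis by (simp add: vec_eq_iff)
      qed
      ultimately show ?thesis by blast
    qed
    then show "(1 - t) *\<^sub>R g (f x) + t *\<^sub>R x \<in> ?C" if "x \<in> ?C" "0 \<le> t" "t \<le> 1" for x t
      using that by blast
    show "(1 - t) *\<^sub>R g (f x) + t *\<^sub>R x \<in> ?C - {?L}" if "x \<in> ?C - {?L}" "0 \<le> t" "t \<le> 1" for x t
      using C1[of x t] that by blast
    have F1: "(1 - t) *\<^sub>R f (g y) + t *\<^sub>R y \<in> fan K \<and> ((1 - t) *\<^sub>R f (g y) + t *\<^sub>R y = 0 \<longrightarrow> y = 0)"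
      if y: "y \<in> fan K" and t: "0 \<le> t" "t \<le> 1" for y t
    proof -
      let ?z = "(1 - t) *\<^sub>R f (g y) + t *\<^sub>R y"
      have z: "?z $ i = (1 - t) * (y $ i / (1 + y $ i)) + t * y $ i" for i by simp
      have s: "0 \<le> y $ i" for i using y by (simp add: fan_def)
      have "{i. ?z $ i \<noteq> 0} = {i. y $ i \<noteq> 0}" unfolding z using mix(3)[OF s t] by simp
      moreover have "\<forall>i. 0 \<le> ?z $ i" unfolding z using mix(1)[OF s t] by blast
      ultimately have "?z \<in> fan K" using y unfolding fan_def mem_Collect_eq by metis
      moreover have "y = 0" if "?z = 0"
      proof -
        have "?z $ i = 0" for i by (subst that) simp
        then have "y $ i = 0" for i using mix(3)[OF s t] unfolding z by blast
        then show ?thesis by (simp add: vec_eq_iff)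
      qed
      ultimately show ?thesis by blast
    qed
    then show "(1 - t) *\<^sub>R f (g y) + t *\<^sub>R y \<in> fan K" if "y \<in> fan K" "0 \<le> t" "t \<le> 1" for y t
      using that by blast
    show "(1 - t) *\<^sub>R f (g y) + t *\<^sub>R y \<in> fan K - {0}" if "y \<in> fan K - {0}" "0 \<le> t" "t \<le> 1" for y t
      using F1[of y t] that by blast
  qed auto
  have "pair_homology k A ?B \<cong> local_homology k K"
    using 1 2 3 group.iso_sym[OF group_relative_homology_group] iso_trans by blast
  moreover have "A \<inter> X_deg (size_vec l + 1) = ?B"
    using mem_X_deg_iff[of _ l] by (auto simp: A_def)
  ultimately show ?thesis by (simp add: A_def K_def)
qed

section \<open>Codimensions and the Hilbert function\<close>

interpretation branch_pair: vector_space_pair branch_scale branch_scale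
  by unfold_locales

definition spans_mod :: "('r \<Rightarrow> complex fps) set \<Rightarrow> ('r \<Rightarrow> complex fps) set \<Rightarrow> ('r \<Rightarrow> complex fps) set \<Rightarrow> bool" where
  "spans_mod B V W \<longleftrightarrow> (\<forall>v\<in>V. \<exists>b\<in>branch.span B. v - b \<in> W)"

definition basis_mod :: "('r \<Rightarrow> complex fps) set \<Rightarrow> ('r \<Rightarrow> complex fps) set \<Rightarrow> ('r \<Rightarrow> complex fps) set \<Rightarrow> bool" where
  "basis_mod B V W \<longleftrightarrow> B \<subseteq> V \<and> branch.independent B \<and> branch.span B \<inter> W = {0} \<and> spans_mod B V W"

definition has_codim :: "('r \<Rightarrow> complex fps) set \<Rightarrow> ('r \<Rightarrow> complex fps) set \<Rightarrow> nat \<Rightarrow> bool" where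
  "has_codim V W n \<longleftrightarrow> (\<exists>B. basis_mod B V W \<and> finite B \<and> card B = n)"

text \<open>Spanning alone, with neither independence nor containment in \<open>V\<close>, so that
  upper bounds can be combined along chains.\<close>

definition codim_le :: "('r \<Rightarrow> complex fps) set \<Rightarrow> ('r \<Rightarrow> complex fps) set \<Rightarrow> nat \<Rightarrow> bool" where
  "codim_le V W n \<longleftrightarrow> (\<exists>B. finite B \<and> card B \<le> n \<and> spans_mod B V W)"

text \<open>Exchange argument modulo \<open>W\<close>: sending each element of \<open>B\<close> to a
  representative in the span of \<open>B'\<close> extends to a linear map that moves vectors of
  \<open>branch.span B\<close> only by elements of \<open>W\<close>. Its kernel there lies in
  \<open>W\<close>, hence is zero.\<close>

lemma card_independent_mod_le:
  assumes W: "branch.subspace W" and "spans_mod B' V W" "finite B'"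
    and B: "B \<subseteq> V" "branch.independent B" "branch.span B \<inter> W = {0}"
  shows "finite B \<and> card B \<le> card B'"
proof -
  have "\<exists>p. \<forall>b\<in>B. p b \<in> branch.span B' \<and> b - p b \<in> W"
    using assms(2) B(1) unfolding spans_mod_def by (intro bchoice) blast
  then obtain p where p: "\<And>b. b \<in> B \<Longrightarrow> p b \<in> branch.span B'" "\<And>b. b \<in> B \<Longrightarrow> b - p b \<in> W" by blast
  obtain P where P: "Vector_Spaces.linear branch_scale branch_scale P" "\<forall>b\<in>B. P b = p b"
    using branch_pair.linear_independent_extend[OF B(2), of p] by blast
  interpret P: Vector_Spaces.linear branch_scale branch_scale P by (rule P(1))
  have "v - P v \<in> W" if "v \<in> branch.span B" for v
    using that
  proof (induction rule: branch.span_induct)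
    show "branch.subspace {v. v - P v \<in> W}"
      unfolding branch.subspace_def
    proof (intro conjI allI ballI)
      show "0 \<in> {v. v - P v \<in> W}" using branch.subspace_0[OF W] by (simp add: P.zero)
    next
      fix x y assume "x \<in> {v. v - P v \<in> W}" "y \<in> {v. v - P v \<in> W}"
      then have "(x - P x) + (y - P y) \<in> W" using branch.subspace_add[OF W] by blast
      then show "x + y \<in> {v. v - P v \<in> W}" by (simp add: P.add algebra_simps)
    next
      fix a x assume "x \<in> {v. v - P v \<in> W}"
      then have "branch_scale a (x - P x) \<in> W" using branch.subspace_scale[OF W] by blast
      then show "branch_scale a x \<in> {v. v - P v \<in> W}"
        by (simp add: P.scale branch.scale_right_diff_distrib)
    qed
  next
    fix x assume "x \<in> B"
    then show "x - P x \<in> W" using p(2)[of x] P(2) by metis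
  qed
  then have "v = 0" if "v \<in> branch.span B" "P v = 0" for v
    using that B(3) by (metis IntI diff_zero singletonD)
  then have inj: "inj_on P (branch.span B)"
    using P.inj_on_iff_eq_0[OF branch.subspace_span] by blast
  have ind: "branch.independent (P ` B)"
    by (rule branch_pair.linear_independent_injective_image[OF P(1) B(2) inj])
  have "P ` B \<subseteq> branch.span B'" using p P by auto
  then have "finite (P ` B) \<and> card (P ` B) \<le> card B'"
    using branch.independent_span_bound[OF \<open>finite B'\<close> ind] by blast
  moreover have "inj_on P B" using inj branch.span_superset inj_on_subset by blast
  ultimately show ?thesis by (metis card_image finite_imageD)
qed

lemma has_codim_le:
  assumes "branch.subspace W" "has_codim V W n" "codim_le V W m"
  shows "n \<le> m"
  using assms card_independent_mod_le[OF assms(1)]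
  unfolding has_codim_def codim_le_def basis_mod_def by (meson order_trans)

text \<open>\<open>quot_dim\<close> picks an arbitrary basis; the exchange bound in both directions
  makes its size independent of the choice.\<close>

lemma quot_dim_eq:
  assumes "branch.subspace W" "has_codim V W n"
  shows "quot_dim V W = n"
proof -
  obtain B where B: "basis_mod B V W" "finite B" "card B = n" using assms(2) by (auto simp: has_codim_def)
  define C where "C = (SOME B. basis_mod B V W)"
  have C: "basis_mod C V W" unfolding C_def by (rule someI) (rule B(1))
  have "finite C \<and> card C \<le> card B"
    using card_independent_mod_le[OF assms(1), of B V C] B C by (simp add: basis_mod_def)
  moreover from this have "card B \<le> card C"
    using card_independent_mod_le[OF assms(1), of C V B] B C by (simp add: basis_mod_def)
  moreover have "quot_dim V W = card C"
    by (simp add: quot_dim_def C_def basis_mod_def spans_mod_def)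
  ultimately show ?thesis using B by simp
qed

text \<open>A basis of \<open>W\<close> is extended to one of \<open>V\<close>, and the added
  vectors form the complement. The linear projection onto the old vectors separates the two
  spans.\<close>

lemma basis_mod_exists:
  assumes V: "branch.subspace V" and W: "branch.subspace W" and "W \<subseteq> V"
  shows "\<exists>B. basis_mod B V W"
proof -
  obtain A where A: "A \<subseteq> W" "branch.independent A" "W \<subseteq> branch.span A"
    using branch.maximal_independent_subset by blast
  obtain C where C: "A \<subseteq> C" "C \<subseteq> V" "branch.independent C" "V \<subseteq> branch.span C"
    using branch.maximal_independent_subset_extend[of A V] A assms(3) by blast
  let ?B = "C - A"
  obtain P where P: "Vector_Spaces.linear branch_scale branch_scale P"
    "\<forall>b\<in>C. P b = (if b \<in> A then b else 0)"
    using branch_pair.linear_independent_extend[OF C(3), of "\<lambda>b. if b \<in> A then b else 0"] by blast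
  have "P x = 0" if "x \<in> branch.span ?B" for x
    using branch_pair.linear_eq_0_on_span[OF P(1) _ that] P(2) by auto
  moreover have "P x = x" if "x \<in> branch.span A" for x
  proof (rule branch_pair.linear_eq_on_span[OF P(1) branch.linear_ident _ that])
    show "P a = a" if "a \<in> A" for a using that P(2) C(1) by auto
  qed
  ultimately have "branch.span ?B \<inter> branch.span A \<subseteq> {0}" by force
  then have int: "branch.span ?B \<inter> W = {0}"
    using A(3) branch.span_zero branch.subspace_0[OF W] by blast
  have "\<exists>b\<in>branch.span ?B. v - b \<in> W" if "v \<in> V" for v
  proof -
    have "v \<in> branch.span (A \<union> ?B)" using that C by (simp add: Un_absorb1 subset_iff)
    then obtain a b where "v = a + b" "a \<in> branch.span A" "b \<in> branch.span ?B"
      unfolding branch.span_Un by blast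
    moreover have "branch.span A \<subseteq> W" using A(1) W branch.span_minimal by blast
    ultimately show ?thesis by (intro bexI[of _ b]) auto
  qed
  with int C show ?thesis
    unfolding basis_mod_def spans_mod_def by (meson Diff_subset branch.independent_mono subset_trans)
qed

text \<open>Existence of a basis gives the chosen set its meaning. The value 1 also rules out an
  infinite basis, whose cardinality would be reported as 0.\<close>

lemma codim_le_quot_dim_1:
  assumes "branch.subspace V" "branch.subspace W" "W \<subseteq> V" "quot_dim V W = 1"
  shows "codim_le V W 1"
proof -
  define C where "C = (SOME B. basis_mod B V W)"
  have "basis_mod C V W"
    unfolding C_def by (rule someI_ex) (rule basis_mod_exists[OF assms(1-3)])
  moreover have "card C = 1"
    using assms(4) by (simp add: quot_dim_def basis_mod_def spans_mod_def C_def)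
  moreover from this have "finite C" by (intro card_ge_0_finite) simp
  ultimately show ?thesis
    unfolding codim_le_def by (intro exI[of _ C]) (simp add: basis_mod_def)
qed

lemma codim_le_trans:
  assumes "branch.subspace W" "codim_le U V m" "codim_le V W n"
  shows "codim_le U W (m + n)"
proof -
  obtain A where A: "finite A" "card A \<le> m" "spans_mod A U V" using assms by (auto simp: codim_le_def)
  obtain B where B: "finite B" "card B \<le> n" "spans_mod B V W" using assms by (auto simp: codim_le_def)
  have "spans_mod (A \<union> B) U W"
    unfolding spans_mod_def
  proof
    fix u assume "u \<in> U"
    then obtain a where a: "a \<in> branch.span A" "u - a \<in> V" using A(3) by (auto simp: spans_mod_def)
    then obtain b where b: "b \<in> branch.span B" "u - a - b \<in> W" using B(3) by (auto simp: spans_mod_def)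
    have "a + b \<in> branch.span (A \<union> B)"
      using a(1) b(1) by (meson branch.span_add branch.span_mono sup_ge1 sup_ge2 subsetD)
    moreover have "u - (a + b) \<in> W" using b(2) by (simp add: diff_diff_add)
    ultimately show "\<exists>b\<in>branch.span (A \<union> B). u - b \<in> W" by blast
  qed
  moreover have "card (A \<union> B) \<le> m + n" using card_Un_le[of A B] A B by linarith
  ultimately show ?thesis unfolding codim_le_def using A B by blast
qed

lemma has_codim_Suc:
  assumes V: "branch.subspace V" and W: "branch.subspace W" and "W \<subseteq> V" "V \<subseteq> U" "has_codim U V n"
    and f: "f \<in> V" "f \<notin> W" and line: "\<And>g. g \<in> V \<Longrightarrow> \<exists>k. g - branch_scale k f \<in> W"
  shows "has_codim U W (Suc n)"
proof -
  obtain B where B: "basis_mod B U V" "finite B" "card B = n" using assms(5) by (auto simp: has_codim_def)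
  have f0: "f \<notin> branch.span B"
  proof
    assume "f \<in> branch.span B"
    moreover have "branch.span B \<inter> V = {0}" using B(1) by (simp only: basis_mod_def)
    ultimately have "f = 0" using f(1) by blast
    then show False using f(2) branch.subspace_0[OF W] by simp
  qed
  have "basis_mod (insert f B) U W"
    unfolding basis_mod_def
  proof (intro conjI)
    show "insert f B \<subseteq> U" using B f assms(4) by (auto simp: basis_mod_def)
    show "branch.independent (insert f B)"
      using f0 B by (simp add: basis_mod_def branch.independent_insertI)
    have "x = 0" if x: "x \<in> branch.span (insert f B)" "x \<in> W" for x
    proof -
      obtain k where k: "x - branch_scale k f \<in> branch.span B"
        using x(1) branch.span_insert by blast
      moreover have "x - branch_scale k f \<in> V"
        using x(2) assms(3) f(1) V by (meson branch.subspace_diff branch.subspace_scale subsetD)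
      ultimately have eq: "x = branch_scale k f" using B(1) unfolding basis_mod_def by (metis IntI eq_iff_diff_eq_0 singletonD)
      show "x = 0"
      proof (cases "k = 0")
        case False
        have "branch_scale (inverse k) x \<in> W" using x(2) W branch.subspace_scale by blast
        then show ?thesis using False f(2) by (simp add: eq)
      qed (simp add: eq)
    qed
    then show "branch.span (insert f B) \<inter> W = {0}"
      using branch.span_zero branch.subspace_0[OF W] by blast
    show "spans_mod (insert f B) U W"
      unfolding spans_mod_def
    proof
      fix u assume "u \<in> U"
      then obtain b where b: "b \<in> branch.span B" "u - b \<in> V" using B(1) by (auto simp: basis_mod_def spans_mod_def)
      then obtain k where k: "u - b - branch_scale k f \<in> W" using line by blast
      have "b + branch_scale k f \<in> branch.span (insert f B)"
        using b(1) by (meson branch.span_add branch.span_base branch.span_mono branch.span_scale insertI1 subset_insertI subsetD)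
      moreover have "u - (b + branch_scale k f) \<in> W" using k by (simp add: diff_diff_add)
      ultimately show "\<exists>b\<in>branch.span (insert f B). u - b \<in> W" by blast
    qed
  qed
  moreover have "f \<notin> B" using f0 branch.span_base by blast
  ultimately show ?thesis using B unfolding has_codim_def by (metis card_insert_disjoint finite_insert)
qed

section \<open>Jumps of the valuation filtration and the matroid of the Hilbert function\<close>

lemma branch_val_ge_iff: "enat n \<le> branch_val g \<longleftrightarrow> (\<forall>k<n. fps_nth g k = 0)"
proof (cases "g = 0")
  case False
  have "n \<le> subdegree g \<longleftrightarrow> (\<forall>k<n. fps_nth g k = 0)"
    using subdegree_geI[OF False] nth_less_subdegree_zero order.strict_trans2 by blast
  then show ?thesis using False by (simp add: branch_val_def)
qed (simp add: branch_val_def)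

lemma mem_filt_iff: "f \<in> filt R l \<longleftrightarrow> f \<in> R \<and> (\<forall>i. \<forall>k<l i. fps_nth (f i) k = 0)"
  by (simp add: filt_def branch_val_ge_iff)

lemma branch_scale_nth [simp]: "fps_nth (branch_scale a f i) k = a * fps_nth (f i) k"
  by (simp add: branch_scale_def)

text \<open>Equivalent to a unit increase of the Hilbert function in direction \<open>i\<close>
  (\<open>hilb_add_E\<close>), but stated through a witness that can be multiplied.\<close>

definition jump :: "('r \<Rightarrow> complex fps) set \<Rightarrow> ('r \<Rightarrow> nat) \<Rightarrow> 'r \<Rightarrow> bool" where
  "jump R l i \<longleftrightarrow> (\<exists>f\<in>filt R l. fps_nth (f i) (l i) \<noteq> 0)"

lemma subspace_filt: "branch.subspace R \<Longrightarrow> branch.subspace (filt R l)"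
  by (simp add: branch.subspace_def mem_filt_iff)

lemma mem_filt_add_E: "f \<in> filt R (l + E {i}) \<longleftrightarrow> f \<in> filt R l \<and> fps_nth (f i) (l i) = 0"
  unfolding mem_filt_iff by (auto simp: E_def less_Suc_eq split: if_splits) 

lemma filt_add_E_no_jump: "\<not> jump R l i \<Longrightarrow> filt R (l + E {i}) = filt R l"
  by (auto simp: jump_def mem_filt_add_E)

text \<open>The coefficient of degree \<open>l i\<close> on branch \<open>i\<close> embeds the
  quotient of two successive filtration steps into the complex numbers, so the codimension grows by
  at most one.\<close>

lemma has_codim_filt_add_E:
  assumes R: "branch.subspace R" and "has_codim R (filt R l) n"
  shows "has_codim R (filt R (l + E {i})) (n + (if jump R l i then 1 else 0))"
proof (cases "jump R l i")
  case True
  then obtain f where f: "f \<in> filt R l" "fps_nth (f i) (l i) \<noteq> 0" by (auto simp: jump_def)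
  have "has_codim R (filt R (l + E {i})) (Suc n)"
  proof (rule has_codim_Suc[OF subspace_filt[OF R] subspace_filt[OF R] _ _ assms(2) f(1)])
    show "filt R (l + E {i}) \<subseteq> filt R l" by (auto simp: mem_filt_add_E)
    show "filt R l \<subseteq> R" by (auto simp: mem_filt_iff)
    show "f \<notin> filt R (l + E {i})" using f by (simp add: mem_filt_add_E)
    show "\<exists>k. g - branch_scale k f \<in> filt R (l + E {i})" if g: "g \<in> filt R l" for g
    proof (intro exI)
      let ?k = "fps_nth (g i) (l i) / fps_nth (f i) (l i)"
      have "g - branch_scale ?k f \<in> filt R l"
        using g f(1) subspace_filt[OF R] by (meson branch.subspace_diff branch.subspace_scale)
      then show "g - branch_scale ?k f \<in> filt R (l + E {i})" using f(2) by (simp add: mem_filt_add_E)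
    qed
  qed
  then show ?thesis using True by simp
qed (use assms in \<open>simp add: filt_add_E_no_jump\<close>)

text \<open>Induction on the size of \<open>l\<close> gives finite codimension, so that
  \<open>hilb\<close> is a true dimension and never the default for an infinite one.\<close>

lemma has_codim_filt_hilb:
  fixes R :: "('r :: finite \<Rightarrow> complex fps) set"
  assumes R: "branch.subspace R"
  shows "has_codim R (filt R l) (hilb R l)"
proof -
  have "\<exists>n. has_codim R (filt R l) n"
  proof (induction "size_vec l" arbitrary: l)
    case 0
    then have "l i = 0" for i by (simp add: size_vec_def)
    then have "filt R l = R" by (auto simp: mem_filt_iff)
    moreover have "basis_mod {} R R"
      using branch.subspace_0[OF R] by (auto simp: basis_mod_def spans_mod_def branch.independent_empty)
    ultimately show ?case unfolding has_codim_def by (metis finite.emptyI)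
  next
    case (Suc n)
    then obtain i where i: "l i \<noteq> 0" unfolding size_vec_def by fastforce
    define l' where "l' = l(i := l i - 1)"
    have l: "l = l' + E {i}" using i by (auto simp: l'_def E_def fun_eq_iff)
    have "size_vec l = size_vec l' + 1"
      unfolding l by (simp add: size_vec_def sum.distrib E_def)
    with Suc obtain m where "has_codim R (filt R l') m" by auto
    from has_codim_filt_add_E[OF R this, of i] show ?case unfolding l by blast
  qed
  then show ?thesis using quot_dim_eq[OF subspace_filt[OF R]] unfolding hilb_def by auto
qed

lemma hilb_add_E:
  fixes R :: "('r :: finite \<Rightarrow> complex fps) set"
  assumes R: "branch.subspace R"
  shows "hilb R (l + E {i}) = hilb R l + (if jump R l i then 1 else 0)"
  using quot_dim_eq[OF subspace_filt[OF R] has_codim_filt_add_E[OF R has_codim_filt_hilb[OF R]]]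
  by (simp add: hilb_def)

lemma hilb_0:
  fixes R :: "('r :: finite \<Rightarrow> complex fps) set"
  assumes R: "branch.subspace R"
  shows "hilb R 0 = 0"
proof -
  have "filt R 0 = R" by (auto simp: mem_filt_iff)
  moreover have "has_codim R R 0"
    unfolding has_codim_def using branch.subspace_0[OF R]
    by (intro exI[of _ "{}"]) (auto simp: basis_mod_def spans_mod_def branch.independent_empty)
  ultimately show ?thesis using quot_dim_eq[OF R] by (simp add: hilb_def)
qed

lemma jump_antimono: "i \<noteq> j \<Longrightarrow> jump R (l + E {j}) i \<Longrightarrow> jump R l i"
proof -
  assume "i \<noteq> j" "jump R (l + E {j}) i"
  moreover from this have "(l + E {j}) i = l i" by (simp add: E_def)
  ultimately show ?thesis by (auto simp: jump_def mem_filt_add_E)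
qed

lemma E_insert: "i \<notin> I \<Longrightarrow> E (insert i I) = E I + E {i}"
  by (auto simp: E_def fun_eq_iff)

text \<open>Submodularity holds because a jump in direction \<open>i\<close> after a step in another
  direction \<open>j\<close> is already a jump before that step
  (\<open>jump_antimono\<close>).\<close>

lemma matroid_rank_hilb:
  fixes R :: "('r :: finite \<Rightarrow> complex fps) set"
  assumes R: "branch.subspace R"
  shows "matroid_rank UNIV (\<lambda>J. int (hilb R (l + E J)))"
proof -
  have ins: "hilb R (l + E (insert i I)) = hilb R (l + E I) + (if i \<notin> I \<and> jump R (l + E I) i then 1 else 0)" for I i
    using hilb_add_E[OF R, of "l + E I" i] by (cases "i \<in> I") (auto simp: E_insert[of i I] insert_absorb add.assoc)
  show ?thesis
    unfolding matroid_rank_def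
  proof (intro conjI allI impI)
    fix I i j
    show "int (hilb R (l + E I)) \<le> int (hilb R (l + E (insert i I)))"
      "int (hilb R (l + E (insert i I))) \<le> int (hilb R (l + E I)) + 1"
      by (auto simp: ins)
    have "jump R (l + E I) i" if "i \<notin> insert j I" "jump R (l + E (insert j I)) i"
      using that jump_antimono[of i j R "l + E I"]
      by (cases "j \<in> I") (auto simp: E_insert[of j I] insert_absorb add.assoc)
    then show "int (hilb R (l + E (insert j (insert i I)))) - int (hilb R (l + E (insert j I)))
        \<le> int (hilb R (l + E (insert i I))) - int (hilb R (l + E I))"
      unfolding insert_commute[of j i] ins[of i "insert j I"] ins[of i I] by auto
  qed
qed

lemma E_Un: "I \<inter> J = {} \<Longrightarrow> E (I \<union> J) = E I + E J"
  by (auto simp: E_def fun_eq_iff)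

lemma size_vec_add: "size_vec (l + m) = size_vec l + size_vec m"
  by (simp add: size_vec_def sum.distrib)

lemma size_vec_E: "size_vec (E (J :: 'r :: finite set)) = card J"
  by (simp add: size_vec_def E_def sum.If_cases)

text \<open>The maximum of \<open>2 \<rho>(J) - |J|\<close> over \<open>J \<subseteq> I\<close> is attained at a basis of \<open>I\<close>.\<close>
lemma cube_weight_eq:
  fixes R :: "('r :: finite \<Rightarrow> complex fps) set"
  assumes R: "branch.subspace R"
  shows "cube_weight R l I = weight R l + int (hilb R (l + E I)) - int (hilb R l)"
proof -
  define \<rho> where "\<rho> J = int (hilb R (l + E J))" for J
  have mr: "matroid_rank UNIV \<rho>" unfolding \<rho>_def by (rule matroid_rank_hilb[OF R])
  have E0: "E {} = 0" by (auto simp: E_def fun_eq_iff)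
  have \<rho>0: "\<rho> {} = int (hilb R l)" by (simp add: \<rho>_def E0)
  have w: "weight R (l + E J) = 2 * \<rho> J - int (size_vec l) - int (card J)" for J
    by (simp add: weight_def \<rho>_def size_vec_add size_vec_E)
  have upper: "\<rho> J \<le> \<rho> {} + int (card J)" for J
  proof -
    have "finite J" by simp
    then show ?thesis
    proof (induction J)
      case (insert j J)
      then show ?case using matroid_rank_insert(2)[OF mr, of J j] by simp
    qed simp
  qed
  have basis: "\<exists>J\<subseteq>I. \<rho> J = \<rho> I \<and> \<rho> J = \<rho> {} + int (card J)"
  proof -
    have "finite I" by simp
    then show ?thesis
    proof (induction I)
      case (insert i I)
      then obtain J where J: "J \<subseteq> I" "\<rho> J = \<rho> I" "\<rho> J = \<rho> {} + int (card J)" by auto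
      show ?case
      proof (cases "\<rho> (insert i I) = \<rho> I")
        case True
        then show ?thesis using J by (intro exI[of _ J]) auto
      next
        case False
        then have *: "\<rho> (insert i I) = \<rho> I + 1" using matroid_rank_insert[OF mr, of I i] by auto
        \<comment> \<open>Enlarging the base can only lower the gain from \<open>i\<close>; with
          \<open>D = I\<close> this carries the increase over \<open>I\<close> back to the partial
          basis \<open>J\<close>.\<close>
        have "\<rho> (insert i (J \<union> D)) - \<rho> (J \<union> D) \<le> \<rho> (insert i J) - \<rho> J" for D
        proof -
          have "finite D" by simp
          then show ?thesis
          proof (induction D)
            case (insert d D)
            then show ?case
              using matroid_rank_submodular[OF mr, of "J \<union> D" i d] by (simp add: insert_commute)
          qed simp
        qed
        from this[of I] have "\<rho> (insert i J) \<ge> \<rho> J + 1" using * J by (simp add: Un_absorb1)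
        then have "\<rho> (insert i J) = \<rho> J + 1" using matroid_rank_insert(2)[OF mr, of J i] by auto
        moreover have "i \<notin> J" using J insert by blast
        moreover have "card (insert i J) = Suc (card J)" using \<open>i \<notin> J\<close> by simp
        ultimately show ?thesis using J * by (intro exI[of _ "insert i J"]) auto
      qed
    qed (auto intro!: exI[of _ "{}"])
  qed
  have "cube_weight R l I = \<rho> I + \<rho> {} - int (size_vec l)"
    unfolding cube_weight_def
  proof (rule Max_eqI)
    fix y assume "y \<in> (\<lambda>I'. weight R (l + E I')) ` Pow I"
    then obtain J where J: "J \<subseteq> I" "y = weight R (l + E J)" by auto
    have "\<rho> J \<le> \<rho> I" by (rule matroid_rank_mono[OF mr]) (use J in auto)
    with upper[of J] show "y \<le> \<rho> I + \<rho> {} - int (size_vec l)" by (simp add: J w)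
  next
    obtain J where "J \<subseteq> I" "\<rho> J = \<rho> I" "\<rho> J = \<rho> {} + int (card J)" using basis by blast
    then show "\<rho> I + \<rho> {} - int (size_vec l) \<in> (\<lambda>I'. weight R (l + E I')) ` Pow I"
      by (intro image_eqI[of _ _ J]) (auto simp: w)
  qed auto
  also have "\<dots> = weight R l + int (hilb R (l + E I)) - int (hilb R l)"
    by (simp add: weight_def \<rho>0) (simp add: \<rho>_def)
  finally show ?thesis .
qed

text \<open>The link between both sides of the theorem: up to sign the rank of a homology group, and
  also the coefficient of \<open>q\<close> to the power \<open>k + hilb R l\<close> in the motivic
  series.\<close>

definition euler_coeff :: "('r :: finite \<Rightarrow> complex fps) set \<Rightarrow> ('r \<Rightarrow> nat) \<Rightarrow> nat \<Rightarrow> int" where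
  "euler_coeff R l k = (\<Sum>J\<in>{J. hilb R (l + E J) \<le> hilb R l + k}. (- 1) ^ card J)"

text \<open>Near \<open>l\<close> the set of level \<open>n\<close> looks like the fan over a rank
  complex with bound \<open>n - w(l) + h(l)\<close>. Its homology lives in the degree given by this
  bound minus \<open>\<rho> {} = h(l)\<close>, so degree \<open>k\<close> survives only for
  \<open>n = w(l) + k\<close>.\<close>

theorem PE1_eq:
  fixes R :: "('r :: finite \<Rightarrow> complex fps) set"
  assumes R: "branch.subspace R"
  shows "PE1 R (l, n, k) = (if n = weight R l + int k then (- 1) ^ k * euler_coeff R l k else 0)"
proof -
  define P where "P l I \<longleftrightarrow> cube_weight R l I \<le> n" for l I
  define \<rho> where "\<rho> J = int (hilb R (l + E J))" for J
  define m where "m = n - weight R l + int (hilb R l)"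
  have E0: "E {} = 0" by (auto simp: E_def fun_eq_iff)
  have face: "face_closed P"
    unfolding face_closed_def P_def
  proof (intro allI impI)
    fix l I J I' assume *: "cube_weight R l I \<le> n" "J \<subseteq> I" "I' \<subseteq> I - J"
    have "cube_weight R (l + E J) I' \<le> cube_weight R l I"
      unfolding cube_weight_def
    proof (rule Max_mono)
      show "(\<lambda>I'. weight R (l + E J + E I')) ` Pow I' \<subseteq> (\<lambda>I'. weight R (l + E I')) ` Pow I"
      proof
        fix y assume "y \<in> (\<lambda>I'. weight R (l + E J + E I')) ` Pow I'"
        then obtain D where "D \<subseteq> I'" "y = weight R (l + E J + E D)" by auto
        moreover have "E (J \<union> D) = E J + E D" using * \<open>D \<subseteq> I'\<close> by (intro E_Un) auto
        ultimately show "y \<in> (\<lambda>I'. weight R (l + E I')) ` Pow I"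
          using * by (intro image_eqI[of _ _ "J \<union> D"]) (auto simp: add.assoc)
      qed
    qed auto
    with * show "cube_weight R (l + E J) I' \<le> n" by linarith
  qed
  have K: "{I. P l I} = rank_complex UNIV \<rho> m"
    by (auto simp: P_def rank_complex_def cube_weight_eq[OF R] \<rho>_def m_def)
  have "S_level R n = cubical P" by (simp add: S_level_def cubical_def P_def)
  then have "E1 R l (int k + int (size_vec l)) n \<cong> local_homology (int k) (rank_complex UNIV \<rho> m)"
    using pair_homology_lowest_vertex[OF face, of "int k" l] by (simp add: E1_def K)
  then have iso: "local_homology (int k) (rank_complex UNIV \<rho> m) \<cong> E1 R l (int k + int (size_vec l)) n"
    by (rule group.iso_sym[rotated]) (simp add: E1_def)
  have mr: "matroid_rank UNIV \<rho>" unfolding \<rho>_def by (rule matroid_rank_hilb[OF R])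
  \<comment> \<open>The ground set is the whole index type, which is nonempty, so the side condition
    for an empty ground set is vacuous.\<close>
  obtain N where N: "free_of_rank (local_homology (int k) (rank_complex UNIV \<rho> m)) N"
    "int N = (if int k = m - \<rho> {} then (- 1) ^ nat (int k) * signed_count (rank_complex UNIV \<rho> m) else 0)"
    using local_homology_rank_complex[OF mr, of m "int k"] by auto
  have "free_of_rank (E1 R l (int k + int (size_vec l)) n) N"
    by (rule free_of_rank_iso[OF N(1) iso]) (simp add: E1_def)
  then have "PE1 R (l, n, k) = int N" by (simp add: PE1_def abelian_rank_free)
  moreover have "signed_count (rank_complex UNIV \<rho> m) = euler_coeff R l k" if "n = weight R l + int k"
    using that by (auto simp: signed_count_def rank_complex_def euler_coeff_def m_def \<rho>_def intro!: sum.cong)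
  moreover have "int k = m - \<rho> {} \<longleftrightarrow> n = weight R l + int k"
    by (auto simp: m_def \<rho>_def E0)
  ultimately show ?thesis using N(2) by auto
qed

section \<open>Convergent power series\<close>

lemma has_fps_expansionE_analytic:
  assumes "f has_fps_expansion F"
  obtains S where "open S" "0 \<in> S" "f holomorphic_on S"
  using has_fps_expansion_imp_holomorphic[OF assms] by metis

lemma fps_conv_radius_pos_if_expansion: "f has_fps_expansion F \<Longrightarrow> fps_conv_radius F > 0"
  by (simp add: has_fps_expansion_def)

text \<open>At a radius \<open>r\<close> inside the disc of convergence a subseries of the
  absolutely convergent series still converges; after division by \<open>r ^ k\<close> it is a
  series in \<open>r ^ m\<close>.\<close>

lemma fps_conv_radius_progression:
  fixes F :: "complex fps"
  assumes "fps_conv_radius F > 0" "m > 0"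
  shows "fps_conv_radius (Abs_fps (\<lambda>n. fps_nth F (n * m + k))) > 0"
proof -
  obtain r where r: "0 < r" "ereal r < fps_conv_radius F"
    using assms(1) ereal_dense2[of 0 "fps_conv_radius F"] by auto
  have "summable (\<lambda>n. norm (fps_nth F n * of_real r ^ n))"
    using r by (intro abs_summable_in_conv_radius) (simp add: fps_conv_radius_def)
  then have "summable ((\<lambda>n. norm (fps_nth F n * of_real r ^ n)) \<circ> (\<lambda>n. n * m + k))"
    using assms(2) by (intro summable_reindex) (auto simp: inj_on_def)
  then have "summable (\<lambda>n. norm (fps_nth F (n * m + k) * of_real r ^ (n * m + k)))"
    by (simp add: o_def)
  then have "summable (\<lambda>n. fps_nth F (n * m + k) * of_real r ^ (n * m + k))"
    by (rule summable_norm_cancel)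
  then have "summable (\<lambda>n. fps_nth F (n * m + k) * of_real r ^ (n * m + k) / of_real r ^ k)"
    by (rule summable_divide)
  moreover have "fps_nth F (n * m + k) * of_real r ^ (n * m + k) / of_real r ^ k
      = fps_nth F (n * m + k) * (of_real r ^ m) ^ n" for n
    using r by (simp add: power_add field_simps flip: power_mult)
  ultimately have "summable (\<lambda>n. fps_nth F (n * m + k) * (of_real r ^ m) ^ n)" by simp
  from conv_radius_geI[OF this] have "ereal (r ^ m) \<le> fps_conv_radius (Abs_fps (\<lambda>n. fps_nth F (n * m + k)))"
    using r by (simp add: fps_conv_radius_def norm_power)
  moreover have "0 < ereal (r ^ m)" using r by simp
  ultimately show ?thesis by order
qed

lemma fps_split_residues:
  fixes F :: "complex fps"
  assumes "m > 0"
  shows "F = (\<Sum>k<m. fps_X ^ k * (Abs_fps (\<lambda>n. fps_nth F (n * m + k)) oo fps_X ^ m))"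
proof (rule fps_ext)
  fix j
  have nth: "fps_nth (fps_X ^ k * (Abs_fps (\<lambda>n. fps_nth F (n * m + k)) oo fps_X ^ m)) j
      = (if j mod m = k then fps_nth F j else 0)" if "k < m" for k
  proof (cases "j < k")
    case True
    then show ?thesis using that by (auto simp: fps_X_power_mult_nth)
  next
    case False
    have "fps_nth (Abs_fps (\<lambda>n. fps_nth F (n * m + k)) oo fps_X ^ m) (j - k)
        = (\<Sum>i\<in>{0..j - k}. fps_nth F (i * m + k) * (if j - k = m * i then 1 else 0))"
      by (simp add: fps_compose_nth flip: power_mult)
    also have "\<dots> = (if j mod m = k then fps_nth F j else 0)"
    proof (cases "j mod m = k")
      case True
      define q where "q = j div m"
      have j: "j = q * m + k" unfolding q_def using True by (metis div_mult_mod_eq)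
      have "(\<Sum>i\<in>{0..j - k}. fps_nth F (i * m + k) * (if j - k = m * i then 1 else 0))
          = (\<Sum>i\<in>{q}. fps_nth F (i * m + k) * (if j - k = m * i then 1 else 0))"
        using assms by (intro sum.mono_neutral_right) (auto simp: j)
      then show ?thesis using True by (simp add: j)
    next
      case F: False
      have "j - k \<noteq> m * i" for i
      proof
        assume "j - k = m * i"
        then have "j = m * i + k" using False by simp
        then show False using F that by simp
      qed
      then show ?thesis using F by simp
    qed
    finally show ?thesis using False by (simp add: fps_X_power_mult_nth)
  qed
  have "fps_nth (\<Sum>k<m. fps_X ^ k * (Abs_fps (\<lambda>n. fps_nth F (n * m + k)) oo fps_X ^ m)) j
      = (\<Sum>k<m. if j mod m = k then fps_nth F j else 0)"
    by (simp add: fps_sum_nth nth)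
  also have "\<dots> = fps_nth F j" using assms by simp
  finally show "fps_nth F j = fps_nth (\<Sum>k<m. fps_X ^ k * (Abs_fps (\<lambda>n. fps_nth F (n * m + k)) oo fps_X ^ m)) j"
    by simp
qed

text \<open>The root is taken analytically as the exponential of a logarithm, which yields
  convergence. Dividing by the constant term first keeps the logarithm near 1, away from its branch
  cut.\<close>

lemma convergent_fps_root:
  fixes y :: "complex fps"
  assumes "fps_conv_radius y > 0" "fps_nth y 0 \<noteq> 0" "m > 0"
  obtains w where "fps_conv_radius w > 0" "w ^ m = y"
proof -
  let ?Y = "eval_fps y" and ?a = "fps_nth y 0"
  have Y: "?Y has_fps_expansion y" using assms(1) by (rule eval_fps_has_fps_expansion)
  obtain S where S: "open S" "0 \<in> S" "?Y holomorphic_on S" by (rule has_fps_expansionE_analytic[OF Y])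
  define c where "c = exp (Ln ?a / of_nat m)"
  have c: "c ^ m = ?a" unfolding c_def using assms by (simp flip: exp_of_nat_mult)
  have anY: "?Y analytic_on {0}" by (rule has_fps_expansion_imp_analytic_0[OF Y])
  have Y0: "?Y 0 / ?a = 1" using assms by (simp add: eval_fps_at_0)
  define L where "L z = Ln (?Y z / ?a)" for z
  have L: "L analytic_on {0}"
    unfolding L_def using Y0 assms anY by (intro analytic_intros) (auto simp: complex_nonpos_Reals_iff simp flip: zero_ereal_def)
  have "(\<lambda>z. c * exp (L z / of_nat m)) analytic_on {0}"
    using assms(3) by (intro analytic_intros L) simp
  then have W: "(\<lambda>z. c * exp (L z / of_nat m)) has_fps_expansion
      fps_expansion (\<lambda>z. c * exp (L z / of_nat m)) 0" (is "?w has_fps_expansion ?W")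
    by (rule analytic_at_imp_has_fps_expansion_0)
  have Wm: "(\<lambda>z. ?w z ^ m) has_fps_expansion ?W ^ m" by (rule has_fps_expansion_power[OF W])
  have "eventually (\<lambda>z. ?Y z \<noteq> 0) (nhds 0)"
  proof -
    have "isCont ?Y 0" by (rule analytic_at_imp_isCont[OF anY])
    then have "(?Y \<longlongrightarrow> ?Y 0) (nhds 0)" unfolding tendsto_at_iff_tendsto_nhds[symmetric] by (simp add: isCont_def tendsto_at_iff_tendsto_nhds)
    moreover have "?Y 0 \<noteq> 0" using assms by (simp add: eval_fps_at_0)
    ultimately show ?thesis by (rule tendsto_imp_eventually_ne)
  qed
  then have "eventually (\<lambda>z. ?w z ^ m = ?Y z) (nhds 0)"
  proof eventually_elim
    case (elim z)
    have "?w z ^ m = ?a * exp (L z)"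
      using assms by (simp add: power_mult_distrib c flip: exp_of_nat_mult)
    then show ?case using elim assms by (simp add: L_def)
  qed
  then have "?Y has_fps_expansion ?W ^ m"
    using Wm has_fps_expansion_cong by metis
  then have "?W ^ m = y" using Y fps_expansion_unique_complex by metis
  then show ?thesis using that fps_conv_radius_pos_if_expansion[OF W] by blast
qed

text \<open>Convergence comes from the analytic local inverse of the sum function, whose expansion
  at 0 is taken.\<close>

lemma convergent_fps_compositional_inverse:
  fixes s :: "complex fps"
  assumes "fps_conv_radius s > 0" "fps_nth s 0 = 0" "fps_nth s 1 \<noteq> 0"
  obtains T where "fps_conv_radius T > 0" "fps_nth T 0 = 0" "T oo s = fps_X"
proof -
  let ?s = "eval_fps s"
  have s: "?s has_fps_expansion s" using assms(1) by (rule eval_fps_has_fps_expansion)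
  obtain S where S: "open S" "0 \<in> S" "?s holomorphic_on S" by (rule has_fps_expansionE_analytic[OF s])
  have "deriv ?s has_fps_expansion fps_deriv s" by (rule has_fps_expansion_deriv[OF s])
  then have "deriv ?s 0 \<noteq> 0" using has_fps_expansion_imp_0_eq_fps_nth_0 assms(3) by fastforce
  then obtain r where r: "r > 0" "ball 0 r \<subseteq> S" "open (?s ` ball 0 r)" "inj_on ?s (ball 0 r)"
    using has_complex_derivative_locally_invertible[OF S(3,2,1)] by blast
  have hol: "?s holomorphic_on ball 0 r" using S r holomorphic_on_subset by blast
  obtain g where g: "g holomorphic_on ?s ` ball 0 r" "\<And>z. z \<in> ball 0 r \<Longrightarrow> g (?s z) = z"
    using holomorphic_has_inverse[OF hol _ r(4)] by (metis open_ball)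
  have s0: "?s 0 = 0" using assms(2) by (simp add: eval_fps_at_0)
  have "0 \<in> ?s ` ball 0 r" using r(1) s0 by (intro image_eqI[of _ _ 0]) auto
  then have "g analytic_on {0}" using g(1) r(3) analytic_at by blast
  then have G: "g has_fps_expansion fps_expansion g 0" by (rule analytic_at_imp_has_fps_expansion_0)
  have g0: "fps_nth (fps_expansion g 0) 0 = 0"
    using has_fps_expansion_imp_0_eq_fps_nth_0[OF G] g(2)[of 0] r(1) s0 by simp
  have "(g \<circ> ?s) has_fps_expansion (fps_expansion g 0 oo s)"
    by (rule has_fps_expansion_compose[OF G s assms(2)])
  moreover have "eventually (\<lambda>z. (g \<circ> ?s) z = z) (nhds 0)"
    using eventually_nhds_in_open[of "ball 0 r" 0] r(1) g(2) by (auto elim: eventually_mono)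
  ultimately have "(\<lambda>z. z) has_fps_expansion (fps_expansion g 0 oo s)"
    using has_fps_expansion_cong by metis
  then have "fps_expansion g 0 oo s = fps_X"
    using has_fps_expansion_fps_X fps_expansion_unique_complex by metis
  then show ?thesis using that fps_conv_radius_pos_if_expansion[OF G] g0 by blast
qed

lemma fps_conv_radius_compose_pos:
  fixes F G :: "complex fps"
  assumes "fps_conv_radius F > 0" "fps_conv_radius G > 0" "fps_nth G 0 = 0"
  shows "fps_conv_radius (F oo G) > 0"
  using has_fps_expansion_compose[OF eval_fps_has_fps_expansion[OF assms(1)] eval_fps_has_fps_expansion[OF assms(2)] assms(3)]
  by (rule fps_conv_radius_pos_if_expansion)

text \<open>The ring of convergent power series is generated over \<open>\<complex>{x}\<close> by the powers of an \<open>m\<close>-th root of \<open>x\<close>.\<close>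
lemma convergent_fps_finite_over_subring:
  fixes x :: "complex fps"
  assumes x: "fps_conv_radius x > 0" "x \<noteq> 0" "fps_nth x 0 = 0"
  obtains s where "fps_conv_radius s > 0"
    "\<And>g. fps_conv_radius g > 0 \<Longrightarrow>
       \<exists>U. (\<forall>k. fps_conv_radius (U k) > 0) \<and> g = (\<Sum>k<subdegree x. s ^ k * (U k oo x))"
proof -
  define m where "m = subdegree x"
  define y where "y = fps_shift m x"
  have m: "m > 0" using x by (auto simp: m_def subdegree_eq_0_iff intro!: gr0I)
  have "fps_nth y 0 \<noteq> 0" "fps_conv_radius y > 0" using x by (auto simp: y_def m_def)
  then obtain w where w: "fps_conv_radius w > 0" "w ^ m = y" using convergent_fps_root m by metis
  \<comment> \<open>An \<open>m\<close>-th root of \<open>x\<close> with a simple zero, hence a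
    local coordinate.\<close>
  define s where "s = fps_X * w"
  have x_eq: "x = fps_X ^ m * y"
    unfolding y_def m_def by (metis fps_shift_times_fps_X_power' mult.commute order_refl subdegree_decompose)
  have sm: "s ^ m = x" by (simp add: s_def power_mult_distrib w x_eq)
  have "fps_nth w 0 \<noteq> 0"
    using w(2) \<open>fps_nth y 0 \<noteq> 0\<close> m by (metis fps_nth_power_0 power_eq_0_iff)
  then have s0: "fps_nth s 0 = 0" "fps_nth s 1 \<noteq> 0" by (simp_all add: s_def)
  have sc: "fps_conv_radius s > 0"
    using fps_conv_radius_mult[of fps_X w] w(1) by (auto simp: s_def intro: less_le_trans)
  obtain T where T: "fps_conv_radius T > 0" "fps_nth T 0 = 0" "T oo s = fps_X"
    using convergent_fps_compositional_inverse[OF sc s0] .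
  show ?thesis
  proof (rule that[OF sc])
    fix g :: "complex fps" assume g: "fps_conv_radius g > 0"
    \<comment> \<open>\<open>G\<close> expresses \<open>g\<close> in the coordinate
      \<open>s\<close>; sorting its exponents by residue separates the powers \<open>s ^ k\<close>
      with \<open>k < m\<close> from series in \<open>s ^ m = x\<close>.\<close>
    define G where "G = g oo T"
    define U where "U k = Abs_fps (\<lambda>n. fps_nth G (n * m + k))" for k
    have Gc: "fps_conv_radius G > 0" unfolding G_def by (rule fps_conv_radius_compose_pos[OF g T(1,2)])
    have Xm: "fps_nth (fps_X ^ m :: complex fps) 0 = 0" using m by simp
    have "g = G oo s"
      unfolding G_def using fps_compose_assoc[OF s0(1) T(2), of g] T(3) by simp
    also have "G = (\<Sum>k<m. fps_X ^ k * (U k oo fps_X ^ m))"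
      unfolding U_def by (rule fps_split_residues[OF m])
    also have "\<dots> oo s = (\<Sum>k<m. s ^ k * (U k oo x))"
      by (simp add: fps_compose_sum_distrib fps_compose_mult_distrib[OF s0(1)] fps_X_power_compose[OF s0(1)]
          fps_compose_assoc[OF s0(1) Xm, symmetric] sm)
    finally have "g = (\<Sum>k<subdegree x. s ^ k * (U k oo x))" by (simp add: m_def)
    moreover have "\<forall>k. fps_conv_radius (U k) > 0"
      unfolding U_def using fps_conv_radius_progression[OF Gc m] by blast
    ultimately show "\<exists>U. (\<forall>k. fps_conv_radius (U k) > 0) \<and> g = (\<Sum>k<subdegree x. s ^ k * (U k oo x))"
      by blast
  qed
qed

section \<open>The conductor\<close>

lemma holomorphic_fun_onE:
  assumes "holomorphic_fun_on f U" "z \<in> U"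
  obtains D where "(f has_derivative D) (at z)" "\<forall>a v. D (a *s v) = a * D v"
  using assms unfolding holomorphic_fun_on_def by blast

lemma holomorphic_fun_on_subset: "holomorphic_fun_on f U \<Longrightarrow> V \<subseteq> U \<Longrightarrow> holomorphic_fun_on f V"
  unfolding holomorphic_fun_on_def by blast

lemma hol_germs_binop:
  assumes "f \<in> hol_germs p" "g \<in> hol_germs p"
    and "\<And>U. holomorphic_fun_on f U \<Longrightarrow> holomorphic_fun_on g U \<Longrightarrow> holomorphic_fun_on h U"
  shows "h \<in> hol_germs p"
proof -
  obtain U V where U: "open U" "p \<in> U" "holomorphic_fun_on f U" and V: "open V" "p \<in> V" "holomorphic_fun_on g V"
    using assms by (auto simp: hol_germs_def)
  have "holomorphic_fun_on h (U \<inter> V)"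
    using assms(3) holomorphic_fun_on_subset U V by (metis inf_le1 inf_le2)
  then show ?thesis using U V unfolding hol_germs_def by (auto intro!: exI[of _ "U \<inter> V"])
qed

lemma hol_germs_const: "(\<lambda>z. a) \<in> hol_germs p"
  unfolding hol_germs_def holomorphic_fun_on_def
  by (auto intro!: exI[of _ UNIV] exI[of _ "\<lambda>_. 0"])

lemma hol_germs_add:
  assumes "f \<in> hol_germs p" "g \<in> hol_germs p"
  shows "(\<lambda>z. f z + g z) \<in> hol_germs p"
proof (rule hol_germs_binop[OF assms])
  fix U assume *: "holomorphic_fun_on f U" "holomorphic_fun_on g U"
  show "holomorphic_fun_on (\<lambda>z. f z + g z) U"
    unfolding holomorphic_fun_on_def
  proof
    fix z assume "z \<in> U"
    obtain D where D: "(f has_derivative D) (at z)" "\<forall>a v. D (a *s v) = a * D v"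
      by (rule holomorphic_fun_onE[OF *(1) \<open>z \<in> U\<close>])
    obtain D' where D': "(g has_derivative D') (at z)" "\<forall>a v. D' (a *s v) = a * D' v"
      by (rule holomorphic_fun_onE[OF *(2) \<open>z \<in> U\<close>])
    show "\<exists>D. ((\<lambda>z. f z + g z) has_derivative D) (at z) \<and> (\<forall>a v. D (a *s v) = a * D v)"
      by (intro exI[of _ "\<lambda>v. D v + D' v"] conjI has_derivative_add D(1) D'(1))
        (simp add: D(2) D'(2) algebra_simps)
  qed
qed

lemma hol_germs_mult:
  assumes "f \<in> hol_germs p" "g \<in> hol_germs p"
  shows "(\<lambda>z. f z * g z) \<in> hol_germs p"
proof (rule hol_germs_binop[OF assms])
  fix U assume *: "holomorphic_fun_on f U" "holomorphic_fun_on g U"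
  show "holomorphic_fun_on (\<lambda>z. f z * g z) U"
    unfolding holomorphic_fun_on_def
  proof
    fix z assume "z \<in> U"
    obtain D where D: "(f has_derivative D) (at z)" "\<forall>a v. D (a *s v) = a * D v"
      by (rule holomorphic_fun_onE[OF *(1) \<open>z \<in> U\<close>])
    obtain D' where D': "(g has_derivative D') (at z)" "\<forall>a v. D' (a *s v) = a * D' v"
      by (rule holomorphic_fun_onE[OF *(2) \<open>z \<in> U\<close>])
    show "\<exists>D. ((\<lambda>z. f z * g z) has_derivative D) (at z) \<and> (\<forall>a v. D (a *s v) = a * D v)"
      by (intro exI[of _ "\<lambda>v. f z * D' v + D v * g z"] conjI has_derivative_mult D(1) D'(1))
        (simp add: D(2) D'(2) algebra_simps)
  qed
qed

lemma hol_germs_continuous: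
  assumes "f \<in> hol_germs p"
  obtains U where "open U" "p \<in> U" "holomorphic_fun_on f U" "continuous_on U f"
proof -
  obtain U where U: "open U" "p \<in> U" "holomorphic_fun_on f U" using assms by (auto simp: hol_germs_def)
  moreover have "continuous_on U f"
    using U holomorphic_fun_onE[OF U(3)] has_derivative_continuous
    by (metis continuous_at_imp_continuous_on)
  ultimately show ?thesis using that by blast
qed

lemma hol_germs_compose:
  assumes "f \<in> hol_germs p" "u holomorphic_on S" "open S" "f p \<in> S"
  shows "(\<lambda>z. u (f z)) \<in> hol_germs p"
proof -
  obtain U where U: "open U" "p \<in> U" "holomorphic_fun_on f U" "continuous_on U f"
    by (rule hol_germs_continuous[OF assms(1)])
  let ?V = "U \<inter> f -` S"
  have "open ?V" using U assms(3) by (intro continuous_open_preimage)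
  moreover have "holomorphic_fun_on (\<lambda>z. u (f z)) ?V"
    unfolding holomorphic_fun_on_def
  proof
    fix z assume z: "z \<in> ?V"
    obtain D where D: "(f has_derivative D) (at z)" "\<forall>a v. D (a *s v) = a * D v"
      using holomorphic_fun_onE[OF U(3)] z by blast
    have "(u has_field_derivative deriv u (f z)) (at (f z))"
      using z by (intro holomorphic_derivI[OF assms(2,3)]) auto
    then have "(u has_derivative (*) (deriv u (f z))) (at (f z))"
      by (simp add: has_field_derivative_def)
    from has_derivative_compose[OF D(1) this]
    show "\<exists>D. ((\<lambda>z. u (f z)) has_derivative D) (at z) \<and> (\<forall>a v. D (a *s v) = a * D v)"
      by (intro exI conjI) (auto simp: D(2) algebra_simps)
  qed
  ultimately show ?thesis
    using U assms(4) unfolding hol_germs_def by (auto intro!: exI[of _ ?V])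
qed

lemma hol_germs_eventually_ne:
  assumes "f \<in> hol_germs p" "f p \<noteq> a"
  shows "\<forall>\<^sub>F z in nhds p. f z \<noteq> a"
proof -
  obtain U where U: "open U" "p \<in> U" "holomorphic_fun_on f U" "continuous_on U f"
    by (rule hol_germs_continuous[OF assms(1)])
  have "open (U \<inter> f -` (- {a}))" using U by (intro continuous_open_preimage) auto
  then show ?thesis
    using U assms(2) eventually_nhds_in_open[of "U \<inter> f -` (- {a})" p] by (auto elim: eventually_mono)
qed

lemma fps_shift_mult_X_power:
  fixes y :: "complex fps"
  assumes "\<forall>k<n. fps_nth y k = 0"
  shows "y = fps_X ^ n * fps_shift n y"
  using assms by (intro fps_ext) (auto simp: fps_X_power_mult_nth)

text \<open>\<open>\<phi>\<close> is accessible only through its algebraic properties and the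
  vanishing condition, and it acts on functions rather than germs. That it respects germs, values at
  \<open>p\<close> and composition with convergent series is derived below.\<close>

locale normalization =
  fixes p :: "complex ^ 'n" and Cs :: "'r :: finite \<Rightarrow> (complex ^ 'n) set"
    and \<phi> :: "(complex ^ 'n \<Rightarrow> complex) \<Rightarrow> 'r \<Rightarrow> complex fps"
    and R :: "('r \<Rightarrow> complex fps) set"
  assumes icm: "integral_closure_map p Cs \<phi>" and R: "R = \<phi> ` hol_germs p"
begin

lemma
  shows R_subset: "R \<subseteq> branch_ring"
    and \<phi>_add: "f \<in> hol_germs p \<Longrightarrow> g \<in> hol_germs p \<Longrightarrow> \<phi> (\<lambda>z. f z + g z) = \<phi> f + \<phi> g"
    and \<phi>_mult: "f \<in> hol_germs p \<Longrightarrow> g \<in> hol_germs p \<Longrightarrow> \<phi> (\<lambda>z. f z * g z) = \<phi> f * \<phi> g"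
    and \<phi>_const: "\<phi> (\<lambda>z. a) = (\<lambda>i. fps_const a)"
    and \<phi>_eq_0: "f \<in> hol_germs p \<Longrightarrow> \<phi> f i = 0 \<longleftrightarrow> vanishes_on_germ p (Cs i) f"
    and fraction: "x \<in> branch_ring \<Longrightarrow> \<exists>a\<in>R. \<exists>b\<in>R. (\<forall>i. b i \<noteq> 0) \<and> b * x = a"
  using icm unfolding integral_closure_map_def R by blast+

lemma R_add: "x \<in> R \<Longrightarrow> y \<in> R \<Longrightarrow> x + y \<in> R"
  unfolding R by (auto simp flip: \<phi>_add intro!: imageI hol_germs_add)

lemma R_mult: "x \<in> R \<Longrightarrow> y \<in> R \<Longrightarrow> x * y \<in> R"
  unfolding R by (auto simp flip: \<phi>_mult intro!: imageI hol_germs_mult)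

lemma R_const: "(\<lambda>i. fps_const a) \<in> R"
  unfolding R \<phi>_const[symmetric] by (intro imageI hol_germs_const)

lemma subspace_R: "branch.subspace R"
  unfolding branch.subspace_def
proof (intro conjI ballI allI)
  show "0 \<in> R" using R_const[of 0] by (simp add: zero_fun_def)
  show "branch_scale c x \<in> R" if "x \<in> R" for c x
    using R_mult[OF R_const[of c] that] by (simp add: branch_scale_def times_fun_def)
qed (rule R_add)

text \<open>The difference vanishes near \<open>p\<close>, in particular on every component, so each
  component of its image is 0.\<close>

lemma \<phi>_cong:
  assumes "f \<in> hol_germs p" "g \<in> hol_germs p" "\<forall>\<^sub>F z in nhds p. f z = g z"
  shows "\<phi> f = \<phi> g"
proof
  fix i
  let ?h = "\<lambda>z. (-1) * g z"
  have h: "?h \<in> hol_germs p" by (intro hol_germs_mult hol_germs_const assms)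
  have "\<phi> ?h = (\<lambda>i. fps_const (-1)) * \<phi> g" using \<phi>_mult[OF hol_germs_const assms(2)] \<phi>_const by metis
  moreover have "\<phi> (\<lambda>z. f z + ?h z) = \<phi> f + \<phi> ?h" by (rule \<phi>_add[OF assms(1) h])
  ultimately have "\<phi> (\<lambda>z. f z + ?h z) i = \<phi> f i - \<phi> g i"
    by (simp add: plus_fun_def times_fun_def fps_const_neg[symmetric] del: fps_const_neg)
  moreover have "vanishes_on_germ p (Cs i) (\<lambda>z. f z + ?h z)"
    unfolding vanishes_on_germ_def using assms(3) by eventually_elim simp
  ultimately have "\<phi> f i - \<phi> g i = 0"
    using \<phi>_eq_0[OF hol_germs_add[OF assms(1) h], of i] by (simp only:)
  then show "\<phi> f i = \<phi> g i" by simp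
qed

lemma \<phi>_inverse:
  assumes "f \<in> hol_germs p" "f p \<noteq> 0"
  shows "(\<lambda>z. inverse (f z)) \<in> hol_germs p" "\<phi> f * \<phi> (\<lambda>z. inverse (f z)) = 1"
proof -
  have "inverse holomorphic_on (- {0 :: complex})" by (intro holomorphic_intros) auto
  then show g: "(\<lambda>z. inverse (f z)) \<in> hol_germs p"
    using assms by (intro hol_germs_compose[where f = f and u = inverse and S = "- {0}"]) auto
  have "\<phi> f * \<phi> (\<lambda>z. inverse (f z)) = \<phi> (\<lambda>z. f z * inverse (f z))" by (rule \<phi>_mult[OF assms(1) g, symmetric])
  also have "\<dots> = \<phi> (\<lambda>z. 1)"
  proof (rule \<phi>_cong[OF hol_germs_mult[OF assms(1) g] hol_germs_const])
    show "\<forall>\<^sub>F z in nhds p. f z * inverse (f z) = 1"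
      using hol_germs_eventually_ne[OF assms] by eventually_elim simp
  qed
  also have "\<dots> = 1" by (simp add: \<phi>_const one_fun_def)
  finally show "\<phi> f * \<phi> (\<lambda>z. inverse (f z)) = 1" .
qed

text \<open>If the constant term \<open>a\<close> differed from \<open>f p\<close>, then
  \<open>f - a\<close> would be invertible near \<open>p\<close> while the component
  \<open>i\<close> of its image has no constant term.\<close>

lemma \<phi>_nth_0:
  assumes "f \<in> hol_germs p"
  shows "fps_nth (\<phi> f i) 0 = f p"
proof (rule ccontr)
  let ?a = "fps_nth (\<phi> f i) 0" and ?c = "\<lambda>z :: complex ^ 'n. - fps_nth (\<phi> f i) 0"
  assume ne: "?a \<noteq> f p"
  have h: "(\<lambda>z. f z + ?c z) \<in> hol_germs p" by (intro hol_germs_add assms hol_germs_const)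
  have "\<phi> (\<lambda>z. f z + ?c z) * \<phi> (\<lambda>z. inverse (f z + ?c z)) = 1"
    using ne by (intro \<phi>_inverse h) simp
  from fun_cong[OF this, of i] have "\<phi> (\<lambda>z. f z + ?c z) i * \<phi> (\<lambda>z. inverse (f z + ?c z)) i = 1"
    by (simp add: times_fun_def one_fun_def)
  then have "fps_nth (\<phi> (\<lambda>z. f z + ?c z) i * \<phi> (\<lambda>z. inverse (f z + ?c z)) i) 0 = 1" by simp
  moreover have "\<phi> (\<lambda>z. f z + ?c z) i = \<phi> f i + fps_const (- ?a)"
    using \<phi>_add[OF assms hol_germs_const, of "- ?a"] \<phi>_const[of "- ?a"] by (simp add: plus_fun_def)
  ultimately show False by simp
qed

text \<open>Locality of \<open>R\<close>: all components share the constant term \<open>f p\<close>,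
  so a nonzero one on a single branch gives a germ that is invertible at \<open>p\<close>.\<close>

lemma R_unit: "x \<in> R \<Longrightarrow> fps_nth (x i) 0 \<noteq> 0 \<Longrightarrow> \<exists>y\<in>R. x * y = 1"
proof -
  assume "x \<in> R" "fps_nth (x i) 0 \<noteq> 0"
  then obtain f where f: "f \<in> hol_germs p" "x = \<phi> f" "f p \<noteq> 0" by (auto simp: R \<phi>_nth_0)
  show ?thesis unfolding R f(2) using \<phi>_inverse[OF f(1,3)] by blast
qed

text \<open>Induction on the coefficient index through \<open>u s = u 0 + s * v s\<close>: as
  \<open>\<phi> f i\<close> has no constant term, the coefficient \<open>k\<close> of its product
  with the image of \<open>v\<close> involves only smaller indices. All \<open>u\<close> are treated
  at once, since \<open>v\<close> takes the place of \<open>u\<close>.\<close>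

lemma \<phi>_compose:
  assumes f: "f \<in> hol_germs p" "f p = 0" and u: "u has_fps_expansion U"
  shows "(\<lambda>z. u (f z)) \<in> hol_germs p" "\<phi> (\<lambda>z. u (f z)) i = U oo \<phi> f i"
proof -
  have germ: "(\<lambda>z. u (f z)) \<in> hol_germs p" if exp: "u has_fps_expansion U" for u U
  proof -
    obtain S where "open S" "0 \<in> S" "u holomorphic_on S" by (rule has_fps_expansionE_analytic[OF exp])
    then show ?thesis using f by (intro hol_germs_compose[where f = f and u = u and S = S]) auto
  qed
  then show "(\<lambda>z. u (f z)) \<in> hol_germs p" using u .
  have x0: "fps_nth (\<phi> f i) 0 = 0" using \<phi>_nth_0[OF f(1)] f(2) by simp
  have "fps_nth (\<phi> (\<lambda>z. u (f z)) i) k = fps_nth (U oo \<phi> f i) k" if "u has_fps_expansion U" for k u U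
    using that
  proof (induction k arbitrary: u U rule: less_induct)
    case (less k)
    let ?x = "\<phi> f i" and ?a = "fps_nth U 0"
    define V where "V = fps_shift 1 (U - fps_const ?a)"
    define v where "v s = (if s = 0 then fps_nth U 1 else (u s - ?a) / s ^ 1)" for s
    have "(\<lambda>s. u s - ?a) has_fps_expansion (U - fps_const ?a)"
      by (intro has_fps_expansion_diff less.prems has_fps_expansion_const)
    \<comment> \<open>A constant \<open>U\<close> needs its own case, since the subdegree of the
      zero series is 0.\<close>
    moreover have "1 \<le> subdegree (U - fps_const ?a) \<or> U - fps_const ?a = 0"
      using subdegree_eq_0_iff[of "U - fps_const ?a"] by auto
    ultimately have v: "v has_fps_expansion V"
    proof (elim disjE)
      assume *: "(\<lambda>s. u s - ?a) has_fps_expansion (U - fps_const ?a)"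
        and "1 \<le> subdegree (U - fps_const ?a)"
      from has_fps_expansion_shift[OF this, of "fps_nth U 1"] show ?thesis
        unfolding v_def V_def by simp
    next
      assume *: "(\<lambda>s. u s - ?a) has_fps_expansion (U - fps_const ?a)" and z: "U - fps_const ?a = 0"
      have U1: "fps_nth U 1 = 0" using arg_cong[OF z, of "\<lambda>F. fps_nth F 1"] by simp
      have "eventually (\<lambda>s. u s - ?a = 0) (nhds 0)" using * z by (simp add: has_fps_expansion_0_iff)
      then have "eventually (\<lambda>s. v s = 0) (nhds 0)" by eventually_elim (simp add: v_def U1[unfolded One_nat_def])
      then show ?thesis by (simp add: V_def z has_fps_expansion_0_iff)
    qed
    have U_eq: "U = fps_const ?a + fps_X * V"
      by (rule fps_ext) (auto simp: V_def)
    have u_eq: "u s = ?a + s * v s" for s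
      using has_fps_expansion_imp_0_eq_fps_nth_0[OF less.prems] by (simp add: v_def)
    have "\<phi> (\<lambda>z. u (f z)) = \<phi> (\<lambda>z. ?a + f z * v (f z))" by (simp only: u_eq)
    also have "\<dots> = (\<lambda>i. fps_const ?a) + \<phi> f * \<phi> (\<lambda>z. v (f z))"
      using \<phi>_add[OF hol_germs_const hol_germs_mult[OF f(1) germ[OF v]]] \<phi>_mult[OF f(1) germ[OF v]] \<phi>_const
      by simp
    finally have 1: "\<phi> (\<lambda>z. u (f z)) i = fps_const ?a + ?x * \<phi> (\<lambda>z. v (f z)) i"
      by (simp add: plus_fun_def times_fun_def)
    have "U oo ?x = (fps_const ?a + fps_X * V) oo ?x" using U_eq by simp
    also have "\<dots> = fps_const ?a + (fps_X oo ?x) * (V oo ?x)"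
      by (simp add: fps_compose_add_distrib fps_compose_mult_distrib[OF x0])
    also have "fps_X oo ?x = ?x" using fps_X_power_compose[OF x0, of 1] by simp
    finally have 2: "U oo ?x = fps_const ?a + ?x * (V oo ?x)" .
    have "fps_nth (?x * \<phi> (\<lambda>z. v (f z)) i) k = fps_nth (?x * (V oo ?x)) k"
      unfolding fps_mult_nth
    proof (rule sum.cong)
      fix j assume "j \<in> {0..k}"
      then show "fps_nth ?x j * fps_nth (\<phi> (\<lambda>z. v (f z)) i) (k - j) = fps_nth ?x j * fps_nth (V oo ?x) (k - j)"
        using less.IH[OF _ v, of "k - j"] x0 by (cases "j = 0") auto
    qed simp
    then show ?case unfolding 1 2 by simp
  qed
  then show "\<phi> (\<lambda>z. u (f z)) i = U oo \<phi> f i" using u by (intro fps_ext) blast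
qed

lemma R_sum: "(\<And>q. q \<in> I \<Longrightarrow> x q \<in> R) \<Longrightarrow> sum x I \<in> R"
  by (rule branch.subspace_sum[OF subspace_R])

lemma R_1: "1 \<in> R"
  using R_const[of 1] by (simp add: one_fun_def)

lemma R_prod: "(\<And>q. q \<in> I \<Longrightarrow> x q \<in> R) \<Longrightarrow> prod x I \<in> R"
  by (induction I rule: infinite_finite_induct) (auto intro: R_mult R_1)

lemma prod_fun_nth: "prod x I j = (\<Prod>q\<in>I. x q j)" for x :: "'q \<Rightarrow> 'r \<Rightarrow> complex fps"
  by (induction I rule: infinite_finite_induct) (auto simp: one_fun_def times_fun_def)

lemma sum_fun_nth: "sum x I j = (\<Sum>q\<in>I. x q j)" for x :: "'q \<Rightarrow> 'r \<Rightarrow> complex fps"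
  by (induction I rule: infinite_finite_induct) (auto simp: zero_fun_def plus_fun_def)

text \<open>The parameter of branch \<open>i\<close>, extended by 0, is a fraction. Its numerator
  \<open>\<phi> f\<close> vanishes at \<open>p\<close> but not identically on branch
  \<open>i\<close>, so the convergent series on this branch are finite over those in
  \<open>\<phi> f i\<close>.\<close>

lemma finite_over_component:
  "\<exists>f s. f \<in> hol_germs p \<and> f p = 0 \<and> fps_conv_radius s > 0 \<and>
     (\<forall>g. fps_conv_radius g > 0 \<longrightarrow> (\<exists>U. (\<forall>k. fps_conv_radius (U k) > 0) \<and>
        g = (\<Sum>k<subdegree (\<phi> f i). s ^ k * (U k oo \<phi> f i))))"
proof -
  have "(\<lambda>j. if j = i then fps_X else 0) \<in> branch_ring" by (simp add: branch_ring_def)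
  then obtain a b where ab: "a \<in> R" "b \<in> R" "\<forall>i. b i \<noteq> 0" "b * (\<lambda>j. if j = i then fps_X else 0) = a"
    using fraction by blast
  have ai: "a i = b i * fps_X" using fun_cong[OF ab(4), of i] by (simp add: times_fun_def)
  obtain f where f: "f \<in> hol_germs p" "a = \<phi> f" using ab(1) by (auto simp: R)
  have x: "\<phi> f i \<noteq> 0" "fps_nth (\<phi> f i) 0 = 0" using ai ab(3) f(2) by auto
  have "fps_conv_radius (\<phi> f i) > 0" using ab(1) R_subset f(2) by (auto simp: branch_ring_def)
  from convergent_fps_finite_over_subring[OF this x(1,2)] obtain s where
    "fps_conv_radius s > 0" "\<forall>g. fps_conv_radius g > 0 \<longrightarrow> (\<exists>U. (\<forall>k. fps_conv_radius (U k) > 0) \<and>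
        g = (\<Sum>k<subdegree (\<phi> f i). s ^ k * (U k oo \<phi> f i)))" by metis
  moreover have "f p = 0" using x(2) \<phi>_nth_0[OF f(1)] by simp
  ultimately show ?thesis using f(1) by blast
qed

text \<open>Over \<open>R\<close> the branch ring is generated by finitely many elements, powers of
  the series \<open>s i\<close> placed on single branches; the product of their denominators clears
  all of them.\<close>

lemma common_denominator: "\<exists>d\<in>R. (\<forall>i. d i \<noteq> 0) \<and> (\<forall>y\<in>branch_ring. d * y \<in> R)"
proof -
  define P where "P i f s \<longleftrightarrow> f \<in> hol_germs p \<and> f p = 0 \<and> fps_conv_radius s > 0 \<and>
     (\<forall>g. fps_conv_radius g > 0 \<longrightarrow> (\<exists>U. (\<forall>k. fps_conv_radius (U k) > 0) \<and>
        g = (\<Sum>k<subdegree (\<phi> f i). s ^ k * (U k oo \<phi> f i))))" for i f s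
  have "\<forall>i. \<exists>f s. P i f s" unfolding P_def by (intro allI finite_over_component)
  from choice[OF this] obtain f where "\<forall>i. \<exists>s. P i (f i) s" ..
  from choice[OF this] obtain s where fs: "\<forall>i. P i (f i) (s i)" ..
  define m where "m i = subdegree (\<phi> (f i) i)" for i
  have f: "f i \<in> hol_germs p" "f i p = 0" and sc: "fps_conv_radius (s i) > 0" for i
    using fs unfolding P_def by blast+
  have gen: "\<exists>U. (\<forall>k. fps_conv_radius (U k) > 0) \<and> g = (\<Sum>k<m i. s i ^ k * (U k oo \<phi> (f i) i))"
    if "fps_conv_radius g > 0" for g i
    using fs that unfolding P_def m_def by blast
  define \<eta> where "\<eta> q = (\<lambda>j. if j = fst q then s (fst q) ^ snd q else 0)" for q :: "'r \<times> nat"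
  have "\<eta> q \<in> branch_ring" for q
    using less_le_trans[OF sc fps_conv_radius_power] by (auto simp: branch_ring_def \<eta>_def)
  then have "\<forall>q. \<exists>b. b \<in> R \<and> (\<forall>i. b i \<noteq> 0) \<and> b * \<eta> q \<in> R" using fraction by metis
  from choice[OF this] obtain b where b: "\<And>q. b q \<in> R" "\<And>q i. b q i \<noteq> 0" "\<And>q. b q * \<eta> q \<in> R" by blast
  define I where "I = (SIGMA i : UNIV. {..<m i})"
  have finI: "finite I" by (simp add: I_def)
  define d where "d = prod b I"
  have d\<eta>: "d * \<eta> q \<in> R" if "q \<in> I" for q
  proof -
    have "d = b q * prod b (I - {q})" unfolding d_def by (rule prod.remove[OF finI that])
    then have "d * \<eta> q = (b q * \<eta> q) * prod b (I - {q})" by (simp add: mult_ac)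
    then show ?thesis using R_mult[OF b(3) R_prod[of "I - {q}" b]] b(1) by simp
  qed
  have "d * y \<in> R" if y: "y \<in> branch_ring" for y
  proof -
    have "\<forall>i. \<exists>U. (\<forall>k. fps_conv_radius (U k) > 0) \<and> y i = (\<Sum>k<m i. s i ^ k * (U k oo \<phi> (f i) i))"
      using gen y by (simp add: branch_ring_def)
    from choice[OF this] obtain U where U: "\<And>i k. fps_conv_radius (U i k) > 0"
      "\<And>i. y i = (\<Sum>k<m i. s i ^ k * (U i k oo \<phi> (f i) i))" by blast
    \<comment> \<open>Composition with the germs \<open>f i\<close> turns the coefficient series
      into elements of \<open>R\<close>. Their values on the other branches are killed by
      \<open>\<eta> q\<close>.\<close>
    define r where "r q = \<phi> (\<lambda>z. eval_fps (U (fst q) (snd q)) (f (fst q) z))" for q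
    have r: "r q \<in> R" "r q i = U (fst q) (snd q) oo \<phi> (f (fst q)) i" for q i
      using \<phi>_compose[OF f eval_fps_has_fps_expansion[OF U(1)]] unfolding r_def R by blast+
    have "y = (\<Sum>q\<in>I. \<eta> q * r q)"
    proof
      fix j
      have "(\<Sum>q\<in>I. \<eta> q * r q) j = (\<Sum>q\<in>I. \<eta> q j * r q j)" by (simp add: sum_fun_nth times_fun_def)
      also have "\<dots> = (\<Sum>i\<in>UNIV. \<Sum>k<m i. \<eta> (i, k) j * r (i, k) j)"
        unfolding I_def by (subst sum.Sigma) (auto intro!: sum.cong)
      also have "\<dots> = (\<Sum>i\<in>UNIV. if i = j then y j else 0)"
        by (intro sum.cong) (auto simp: \<eta>_def r U(2))
      also have "\<dots> = y j" by simp
      finally show "y j = (\<Sum>q\<in>I. \<eta> q * r q) j" by simp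
    qed
    then have "d * y = (\<Sum>q\<in>I. (d * \<eta> q) * r q)" by (simp add: sum_distrib_left mult.assoc)
    then show ?thesis using R_sum[of I] R_mult d\<eta> r(1) by simp
  qed
  moreover have "d \<in> R" unfolding d_def by (intro R_prod b(1))
  moreover have "d i \<noteq> 0" for i using b(2) finI by (simp add: d_def prod_fun_nth)
  ultimately show ?thesis by blast
qed

text \<open>A family whose order on each branch is at least that of the common denominator
  \<open>d\<close> is \<open>d\<close> times an element of the branch ring.\<close>

lemma conductor_exponent_exists:
  "\<exists>c. \<forall>y\<in>branch_ring. (\<forall>i. \<forall>k<c i. fps_nth (y i) k = 0) \<longrightarrow> y \<in> R"
proof -
  obtain d where d: "d \<in> R" "\<And>i. d i \<noteq> 0" "\<And>y. y \<in> branch_ring \<Longrightarrow> d * y \<in> R"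
    using common_denominator by blast
  show ?thesis
  proof (intro exI[of _ "\<lambda>i. subdegree (d i)"] ballI impI)
    fix y assume y: "y \<in> branch_ring" "\<forall>i. \<forall>k<subdegree (d i). fps_nth (y i) k = 0"
    define e where "e i = fps_shift (subdegree (d i)) (d i)" for i
    define q where "q i = fps_shift (subdegree (d i)) (y i) * inverse (e i)" for i
    have e0: "fps_nth (e i) 0 \<noteq> 0" for i using d(2) by (simp add: e_def)
    have "fps_conv_radius (e i) > 0" for i using d(1) R_subset by (auto simp: e_def branch_ring_def)
    then have "fps_conv_radius (inverse (e i)) > 0" for i using e0 by (intro fps_conv_radius_inverse_pos)
    moreover have "fps_conv_radius (fps_shift (subdegree (d i)) (y i)) > 0" for i
      using y by (simp add: branch_ring_def)
    ultimately have "fps_conv_radius (q i) > 0" for i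
      unfolding q_def by (intro less_le_trans[OF _ fps_conv_radius_mult]) simp
    then have "q \<in> branch_ring" by (simp add: branch_ring_def)
    then have "d * q \<in> R" by (rule d(3))
    moreover have "d i * q i = y i" for i
    proof -
      define n Y where "n = subdegree (d i)" and "Y = fps_shift n (y i)"
      have di: "d i = fps_X ^ n * e i"
        unfolding e_def n_def[symmetric]
        by (rule fps_shift_mult_X_power) (use nth_less_subdegree_zero[of _ "d i"] n_def in blast)
      have yi: "y i = fps_X ^ n * Y"
        unfolding Y_def by (rule fps_shift_mult_X_power) (use y n_def in blast)
      have qi: "q i = Y * inverse (e i)" by (simp add: q_def Y_def n_def)
      have "d i * q i = (fps_X ^ n * Y) * (inverse (e i) * e i)" unfolding di qi by (simp only: mult_ac)
      also have "inverse (e i) * e i = 1" by (rule inverse_mult_eq_1[OF e0])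
      finally show ?thesis unfolding yi by simp
    qed
    ultimately show "y \<in> R" by (simp add: times_fun_def)
  qed
qed

end

section \<open>The Gorenstein symmetry\<close>

text \<open>Reflection at \<open>c\<close> leaves the nonnegative orthant, so the weight is extended
  to all integer vectors. Negative entries impose no condition on the order, hence
  \<open>nat\<close> in the Hilbert function; they still count in the size.\<close>

definition weight_int :: "('r :: finite \<Rightarrow> complex fps) set \<Rightarrow> ('r \<Rightarrow> int) \<Rightarrow> int" where
  "weight_int R l = 2 * int (hilb R (\<lambda>i. nat (l i))) - (\<Sum>i\<in>UNIV. l i)"

lemma vec_induct [case_names zero add]:
  fixes l :: "'r :: finite \<Rightarrow> nat"
  assumes "P 0" and step: "\<And>l i. P l \<Longrightarrow> P (l + E {i})"
  shows "P l"
proof (induction "size_vec l" arbitrary: l)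
  case 0
  then have "l = 0" by (simp add: size_vec_def fun_eq_iff)
  show ?case unfolding \<open>l = 0\<close> by (rule assms(1))
next
  case (Suc n)
  then obtain i where i: "l i \<noteq> 0" unfolding size_vec_def by fastforce
  define l' where "l' = l(i := l i - 1)"
  have l: "l = l' + E {i}" using i by (auto simp: l'_def E_def fun_eq_iff)
  have "size_vec l = size_vec l' + 1" unfolding l size_vec_add size_vec_E by simp
  then show ?case using Suc step[of l' i] by (simp add: l[symmetric])
qed

lemma fps_mult_nth_lowest:
  fixes f g :: "complex fps"
  assumes "\<forall>k<a. fps_nth f k = 0" "\<forall>k<b. fps_nth g k = 0"
  shows "\<forall>k<a + b. fps_nth (f * g) k = 0" "fps_nth (f * g) (a + b) = fps_nth f a * fps_nth g b"
proof -
  have "f * g = fps_X ^ (a + b) * (fps_shift a f * fps_shift b g)"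
    by (subst fps_shift_mult_X_power[OF assms(1)], subst fps_shift_mult_X_power[OF assms(2)])
      (simp add: power_add mult_ac)
  then show "\<forall>k<a + b. fps_nth (f * g) k = 0" "fps_nth (f * g) (a + b) = fps_nth f a * fps_nth g b"
    by (simp_all add: fps_X_power_mult_nth)
qed

lemma codim_le_if_has_codim:
  assumes "has_codim V W n"
  shows "codim_le V W n"
proof -
  obtain B where "basis_mod B V W" "finite B" "card B = n" using assms by (auto simp: has_codim_def)
  then show ?thesis unfolding codim_le_def by (intro exI[of _ B]) (simp add: basis_mod_def)
qed

lemma codim_le_1_line:
  assumes "branch.subspace W" "codim_le S W 1" "s \<in> S" "t \<in> S" "t \<notin> W"
  shows "\<exists>k. s - branch_scale k t \<in> W"
proof -
  obtain B where B: "finite B" "card B \<le> 1" "spans_mod B S W" using assms(2) by (auto simp: codim_le_def)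
  obtain u v where u: "u \<in> branch.span B" "s - u \<in> W" and v: "v \<in> branch.span B" "t - v \<in> W"
    using B(3) assms(3,4) unfolding spans_mod_def by blast
  have "v \<noteq> 0" using v assms(5) by auto
  then have "B \<noteq> {}" using v(1) by auto
  with B(1,2) have "card B = 1" by (metis card_0_eq le_antisym less_one not_le)
  then obtain b where b: "B = {b}" by (auto simp: card_1_singleton_iff)
  obtain \<alpha> \<beta> where \<alpha>: "u = branch_scale \<alpha> b" and \<beta>: "v = branch_scale \<beta> b"
    using u(1) v(1) by (auto simp: b branch.span_singleton)
  have "\<beta> \<noteq> 0" using \<open>v \<noteq> 0\<close> \<beta> by auto
  have "(s - u) - branch_scale (\<alpha> / \<beta>) (t - v) \<in> W"
    by (rule branch.subspace_diff[OF assms(1) u(2) branch.subspace_scale[OF assms(1) v(2)]])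
  also have "(s - u) - branch_scale (\<alpha> / \<beta>) (t - v) = s - branch_scale (\<alpha> / \<beta>) t"
    using \<open>\<beta> \<noteq> 0\<close> by (simp add: \<alpha> \<beta> branch.scale_right_diff_distrib)
  finally show ?thesis by blast
qed

lemma branch_ring_mult: "x \<in> branch_ring \<Longrightarrow> y \<in> branch_ring \<Longrightarrow> x * y \<in> branch_ring"
  by (auto simp: branch_ring_def times_fun_def intro!: less_le_trans[OF _ fps_conv_radius_mult])

lemma subspace_branch_ring: "branch.subspace branch_ring"
  unfolding branch.subspace_def
proof (intro conjI ballI allI)
  show "0 \<in> branch_ring" by (simp add: branch_ring_def zero_fun_def)
  show "x + y \<in> branch_ring" if "x \<in> branch_ring" "y \<in> branch_ring" for x y
    using that by (auto simp: branch_ring_def plus_fun_def intro!: less_le_trans[OF _ fps_conv_radius_add])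
  show "branch_scale a x \<in> branch_ring" if "x \<in> branch_ring" for a x
    using that by (auto simp: branch_ring_def branch_scale_def intro!: less_le_trans[OF _ fps_conv_radius_mult])
qed

definition unit_monomial :: "'r \<Rightarrow> nat \<Rightarrow> 'r \<Rightarrow> complex fps" where
  "unit_monomial i k = (\<lambda>j. if j = i then fps_X ^ k else 0)"

lemma size_vec_add_E: "size_vec (l + E {i}) = size_vec l + 1"
  unfolding size_vec_add size_vec_E by simp

lemma unit_monomial_nth: "fps_nth (unit_monomial i k j) n = (if j = i \<and> n = k then 1 else 0)"
  by (simp add: unit_monomial_def)

lemma unit_monomial_in_branch_ring: "unit_monomial i k \<in> branch_ring"
  by (simp add: unit_monomial_def branch_ring_def)

lemma hilb_branch_ring: "hilb branch_ring (l :: 'r :: finite \<Rightarrow> nat) = size_vec l"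
proof (induction l rule: vec_induct)
  case zero
  have "size_vec (0 :: 'r \<Rightarrow> nat) = 0" by (simp add: size_vec_def)
  then show ?case by (simp only: hilb_0[OF subspace_branch_ring])
next
  case (add l i)
  have "jump branch_ring l i"
    unfolding jump_def mem_filt_iff
    by (intro bexI[of _ "unit_monomial i (l i)"])
      (auto simp: mem_filt_iff unit_monomial_in_branch_ring unit_monomial_nth)
  then show ?case using add by (simp only: hilb_add_E[OF subspace_branch_ring] size_vec_add_E if_True)
qed

context normalization
begin

lemma max_ideal_iff: "f \<in> max_ideal R \<longleftrightarrow> f \<in> R \<and> (\<forall>i. fps_nth (f i) 0 = 0)"
proof
  assume "f \<in> max_ideal R"
  then show "f \<in> R \<and> (\<forall>i. fps_nth (f i) 0 = 0)" using R_unit[of f] by (auto simp: max_ideal_def)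
next
  assume f: "f \<in> R \<and> (\<forall>i. fps_nth (f i) 0 = 0)"
  have "f * g \<noteq> 1" for g
  proof
    assume "f * g = 1"
    \<comment> \<open>\<open>undefined\<close> stands for an arbitrary branch.\<close>
    from fun_cong[OF this, of undefined] have "f undefined * g undefined = 1" by (simp add: times_fun_def one_fun_def)
    then have "fps_nth (f undefined * g undefined) 0 = 1" by simp
    then show False using f by simp
  qed
  then show "f \<in> max_ideal R" using f by (auto simp: max_ideal_def)
qed

text \<open>The colon module \<open>(R : filt R l)\<close> inside the normalization. It grows from
  \<open>R\<close> at \<open>l = 0\<close> to the whole branch ring at the conductor.\<close>

definition quotient_by_filt :: "('r \<Rightarrow> nat) \<Rightarrow> ('r \<Rightarrow> complex fps) set" where
  "quotient_by_filt l = {y \<in> branch_ring. \<forall>f\<in>filt R l. y * f \<in> R}"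

lemma branch_scale_mult_left: "branch_scale a x * y = branch_scale a (x * y)"
  by (simp add: branch_scale_def times_fun_def mult.assoc)

lemma branch_scale_mult_right: "x * branch_scale a y = branch_scale a (x * y)"
  by (simp add: branch_scale_def times_fun_def mult.left_commute)

lemma subspace_quotient_by_filt: "branch.subspace (quotient_by_filt l)"
  unfolding branch.subspace_def quotient_by_filt_def
proof (intro conjI ballI allI CollectI)
  fix x y f a
  show "0 \<in> branch_ring" using branch.subspace_0[OF subspace_branch_ring] .
  show "0 * f \<in> R" using branch.subspace_0[OF subspace_R] by simp
  assume x: "x \<in> {y \<in> branch_ring. \<forall>f\<in>filt R l. y * f \<in> R}"
  show "branch_scale a x \<in> branch_ring" using x branch.subspace_scale[OF subspace_branch_ring] by blast
  show "branch_scale a x * f \<in> R" if "f \<in> filt R l"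
    using x that branch.subspace_scale[OF subspace_R] by (simp add: branch_scale_mult_left)
  assume y: "y \<in> {y \<in> branch_ring. \<forall>f\<in>filt R l. y * f \<in> R}"
  show "x + y \<in> branch_ring" using x y branch.subspace_add[OF subspace_branch_ring] by blast
  show "(x + y) * f \<in> R" if "f \<in> filt R l"
    using x y that R_add by (simp add: distrib_right)
qed

text \<open>Multiplication by \<open>x e\<close>, for \<open>e\<close> generating \<open>\<F>(l)\<close> modulo \<open>\<F>(l + E\<^sub>i)\<close>, embeds the quotient into the
  socle of \<open>\<O>/(x)\<close>.\<close>
lemma codim_quotient_by_filt:
  assumes x: "x \<in> max_ideal R" and x0: "\<And>i. x i \<noteq> 0"
    and socle: "codim_le {f \<in> R. \<forall>m\<in>max_ideal R. f * m \<in> (*) x ` R} ((*) x ` R) 1"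
  shows "codim_le (quotient_by_filt (l + E {i})) (quotient_by_filt l) (if jump R l i then 1 else 0)"
proof (cases "jump R l i")
  case False
  then show ?thesis
    by (auto simp: codim_le_def spans_mod_def quotient_by_filt_def filt_add_E_no_jump intro!: exI[of _ "{}"])
next
  case True
  then obtain e where e: "e \<in> filt R l" "fps_nth (e i) (l i) \<noteq> 0" by (auto simp: jump_def)
  let ?A = "quotient_by_filt (l + E {i})" and ?S = "{f \<in> R. \<forall>m\<in>max_ideal R. f * m \<in> (*) x ` R}"
  have xR: "branch.subspace ((*) x ` R)"
    unfolding branch.subspace_def
  proof (intro conjI ballI allI)
    show "0 \<in> (*) x ` R" using branch.subspace_0[OF subspace_R] by (intro image_eqI[of _ _ 0]) auto
    show "u + v \<in> (*) x ` R" if "u \<in> (*) x ` R" "v \<in> (*) x ` R" for u v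
      using that R_add by (auto simp flip: distrib_left)
    show "branch_scale a u \<in> (*) x ` R" if "u \<in> (*) x ` R" for a u
      using that branch.subspace_scale[OF subspace_R] by (auto simp flip: branch_scale_mult_right)
  qed
  \<comment> \<open>Elements of the maximal ideal have positive order on every branch, so
    multiplication by them pushes \<open>e\<close> into the next filtration step.\<close>
  have me: "m * e \<in> filt R (l + E {i})" if "m \<in> max_ideal R" for m
    unfolding mem_filt_iff
  proof (intro conjI allI impI)
    show "m * e \<in> R" using that e R_mult by (simp add: max_ideal_iff mem_filt_iff)
    fix j k assume k: "k < (l + E {i}) j"
    then have "k < 1 + l j" by (auto simp: E_def split: if_splits)
    moreover have "\<forall>k<1. fps_nth (m j) k = 0" using that by (simp add: max_ideal_iff)
    moreover have "\<forall>k<l j. fps_nth (e j) k = 0" using e by (simp add: mem_filt_iff)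
    ultimately show "fps_nth ((m * e) j) k = 0" using fps_mult_nth_lowest(1)[of 1 "m j" "l j" "e j"] by (simp add: times_fun_def)
  qed
  have inS: "x * (y * e) \<in> ?S" if y: "y \<in> ?A" for y
  proof (intro CollectI conjI ballI)
    have "y * (x * e) \<in> R" using y me[OF x] by (simp add: quotient_by_filt_def)
    then show "x * (y * e) \<in> R" by (simp add: mult_ac)
    fix m assume "m \<in> max_ideal R"
    then have "y * (m * e) \<in> R" using y me by (simp add: quotient_by_filt_def)
    then show "x * (y * e) * m \<in> (*) x ` R" by (intro image_eqI[of _ _ "y * (m * e)"]) (simp_all add: mult_ac)
  qed
  \<comment> \<open>The kernel of the embedding: if \<open>x y e\<close> lies in \<open>x R\<close>,
    then \<open>y e\<close> lies in \<open>R\<close>, and \<open>e\<close> spans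
    \<open>filt R l\<close> modulo the next step.\<close>
  have inA: "y \<in> quotient_by_filt l" if y: "y \<in> ?A" and xye: "x * (y * e) \<in> (*) x ` R" for y
  proof -
    obtain r where r: "r \<in> R" "x * (y * e) = x * r" using xye by auto
    have "(y * e) j = r j" for j
      using fun_cong[OF r(2), of j] x0[of j] by (simp add: times_fun_def)
    then have ye: "y * e \<in> R" using r(1) by (metis ext)
    have "y * f \<in> R" if f: "f \<in> filt R l" for f
    proof -
      let ?k = "fps_nth (f i) (l i) / fps_nth (e i) (l i)"
      have "f - branch_scale ?k e \<in> filt R l"
        using f e(1) subspace_filt[OF subspace_R] by (meson branch.subspace_diff branch.subspace_scale)
      then have "f - branch_scale ?k e \<in> filt R (l + E {i})" using e(2) by (simp add: mem_filt_add_E)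
      then have "y * (f - branch_scale ?k e) \<in> R" using y by (simp add: quotient_by_filt_def)
      moreover have "branch_scale ?k (y * e) \<in> R" using ye branch.subspace_scale[OF subspace_R] by blast
      ultimately have "y * (f - branch_scale ?k e) + branch_scale ?k (y * e) \<in> R" by (rule R_add)
      then show ?thesis by (simp add: right_diff_distrib branch_scale_mult_right)
    qed
    then show ?thesis using y by (simp add: quotient_by_filt_def)
  qed
  have "\<exists>y0. \<forall>y\<in>?A. \<exists>k. y - branch_scale k y0 \<in> quotient_by_filt l"
  proof (cases "\<forall>y\<in>?A. x * (y * e) \<in> (*) x ` R")
    case True
    have "y - branch_scale 0 0 \<in> quotient_by_filt l" if "y \<in> ?A" for y
      using inA[OF that] True that by simp
    then show ?thesis by blast
  next
    case False
    then obtain y0 where y0: "y0 \<in> ?A" "x * (y0 * e) \<notin> (*) x ` R" by blast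
    have "\<exists>k. y - branch_scale k y0 \<in> quotient_by_filt l" if y: "y \<in> ?A" for y
    proof -
      obtain k where k: "x * (y * e) - branch_scale k (x * (y0 * e)) \<in> (*) x ` R"
        using codim_le_1_line[OF xR socle inS[OF y] inS[OF y0(1)] y0(2)] by blast
      have "x * ((y - branch_scale k y0) * e) = x * (y * e) - branch_scale k (x * (y0 * e))"
        by (simp add: left_diff_distrib right_diff_distrib branch_scale_mult_left branch_scale_mult_right)
      moreover have "y - branch_scale k y0 \<in> ?A"
        using y y0(1) subspace_quotient_by_filt by (meson branch.subspace_diff branch.subspace_scale)
      ultimately show ?thesis using inA k by metis
    qed
    then show ?thesis by blast
  qed
  then obtain y0 where y0: "\<And>y. y \<in> ?A \<Longrightarrow> \<exists>k. y - branch_scale k y0 \<in> quotient_by_filt l" by blast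
  have "spans_mod {y0} ?A (quotient_by_filt l)"
    unfolding spans_mod_def branch.span_singleton using y0 by blast
  then show ?thesis using True unfolding codim_le_def by (intro exI[of _ "{y0}"]) simp
qed

text \<open>In a negative coordinate the truncation keeps the Hilbert function fixed, so only the
  size changes and the weight drops by 1.\<close>

lemma weight_int_add_unit:
  "weight_int R (\<lambda>j. l j + int (E {i} j)) =
     weight_int R l + (if 0 \<le> l i \<and> jump R (\<lambda>j. nat (l j)) i then 1 else - 1)"
proof -
  have "(\<Sum>j\<in>UNIV. int (E {i} j)) = 1"
    using size_vec_E[of "{i}"] by (simp add: size_vec_def flip: of_nat_sum)
  then have s: "(\<Sum>j\<in>UNIV. l j + int (E {i} j)) = (\<Sum>j\<in>UNIV. l j) + 1"
    by (simp only: sum.distrib)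
  show ?thesis
  proof (cases "0 \<le> l i")
    case True
    have "(\<lambda>j. nat (l j + int (E {i} j))) = (\<lambda>j. nat (l j)) + E {i}"
      using True by (auto simp: E_def fun_eq_iff)
    then show ?thesis using True unfolding weight_int_def s by (simp add: hilb_add_E[OF subspace_R])
  next
    case False
    have "(\<lambda>j. nat (l j + int (E {i} j))) = (\<lambda>j. nat (l j))" using False by (auto simp: E_def fun_eq_iff)
    then show ?thesis using False unfolding weight_int_def s by simp
  qed
qed

section \<open>The conductor and duality of jumps\<close>

context
  fixes c :: "'r \<Rightarrow> nat"
  assumes c: "is_conductor R c"
begin

lemma conductor_subset:
  assumes "y \<in> branch_ring" "\<And>i k. k < c i \<Longrightarrow> fps_nth (y i) k = 0"
  shows "y \<in> R"
proof -
  define g where "g = (\<lambda>i. fps_shift (c i) (y i))"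
  have "g \<in> branch_ring" using assms(1) by (simp add: g_def branch_ring_def)
  moreover have "y = (\<lambda>i. fps_X ^ c i) * g"
    using fps_shift_mult_X_power assms(2) by (simp add: g_def times_fun_def fun_eq_iff)
  ultimately have "y \<in> conductor_ideal R" using c unfolding is_conductor_def by blast
  then have "\<forall>g\<in>branch_ring. y * g \<in> R" by (simp add: conductor_ideal_def)
  from bspec[OF this subsetD[OF R_subset R_1]] show ?thesis by simp
qed

text \<open>Otherwise the exponent on branch \<open>i\<close> could be lowered by one: any multiple
  of the resulting monomial differs from a scalar multiple of
  \<open>unit_monomial i (c i - 1)\<close> by something of order at least \<open>c\<close>.\<close>

lemma conductor_minimal:
  assumes "c i > 0"
  shows "unit_monomial i (c i - 1) \<notin> R"
proof
  assume e: "unit_monomial i (c i - 1) \<in> R"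
  define e' where "e' = (\<lambda>j. if j = i then fps_X ^ (c i - 1) else fps_X ^ c j :: complex fps)"
  have e'b: "e' \<in> branch_ring" by (simp add: e'_def branch_ring_def)
  have "e' * g \<in> R" if g: "g \<in> branch_ring" for g
  proof -
    let ?a = "fps_nth (g i) 0"
    let ?y = "e' * g - branch_scale ?a (unit_monomial i (c i - 1))"
    have "?y \<in> R"
    proof (rule conductor_subset)
      show "?y \<in> branch_ring"
        by (rule branch.subspace_diff[OF subspace_branch_ring branch_ring_mult[OF e'b g]
              branch.subspace_scale[OF subspace_branch_ring unit_monomial_in_branch_ring]])
      have y: "?y j = e' j * g j - fps_const ?a * unit_monomial i (c i - 1) j" for j
        by (simp add: times_fun_def branch_scale_def)
      show "fps_nth (?y j) k = 0" if k: "k < c j" for j k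
      proof (cases "j = i")
        case True
        have "k < c i - 1 \<or> k = c i - 1" using k[unfolded True] by linarith
        then show ?thesis unfolding y using True by (auto simp: e'_def unit_monomial_def fps_X_power_mult_nth)
      next
        case False
        then show ?thesis unfolding y using k by (simp add: e'_def unit_monomial_def fps_X_power_mult_nth)
      qed
    qed
    from R_add[OF this branch.subspace_scale[OF subspace_R e, of ?a]]
    have "?y + branch_scale ?a (unit_monomial i (c i - 1)) \<in> R" .
    then show ?thesis by simp
  qed
  then have "e' \<in> conductor_ideal R" using e'b by (simp add: conductor_ideal_def)
  then obtain g where "e' = (\<lambda>i. fps_X ^ c i) * g" using c unfolding is_conductor_def by blast
  from fun_cong[OF this, of i] have "fps_X ^ (c i - 1) = fps_X ^ c i * g i" by (simp add: e'_def times_fun_def)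
  then have "fps_nth (fps_X ^ (c i - 1) :: complex fps) (c i - 1) = fps_nth (fps_X ^ c i * g i) (c i - 1)" by simp
  then show False using assms by (simp add: fps_X_power_mult_nth)
qed

lemma jump_above_conductor:
  assumes "c i \<le> l i"
  shows "jump R l i"
proof -
  have "unit_monomial i (l i) \<in> R"
    by (rule conductor_subset[OF unit_monomial_in_branch_ring]) (use assms in \<open>auto simp: unit_monomial_nth\<close>)
  then show ?thesis
    unfolding jump_def
    by (intro bexI[of _ "unit_monomial i (l i)"]) (auto simp: mem_filt_iff unit_monomial_nth)
qed

lemma hilb_above_conductor: "hilb R (c + v) = hilb R c + size_vec v"
proof (induction v rule: vec_induct)
  case zero
  have "size_vec (0 :: 'r \<Rightarrow> nat) = 0" by (simp add: size_vec_def)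
  then show ?case by (simp only: add_0_right)
next
  case (add v i)
  have "jump R (c + v) i" by (rule jump_above_conductor) simp
  then have "hilb R (c + v + E {i}) = hilb R (c + v) + 1" by (simp only: hilb_add_E[OF subspace_R] if_True)
  also have "\<dots> = hilb R c + size_vec (v + E {i})" using add by (simp only: size_vec_add_E add.assoc)
  finally show ?case by (simp only: add.assoc)
qed

text \<open>The product of witnesses for the two jumps has order at least \<open>c j\<close> on
  every other branch and exactly \<open>c i - 1\<close> on branch \<open>i\<close>. Modulo the
  conductor it is a multiple of the monomial of degree \<open>c i - 1\<close>, which is not in
  \<open>R\<close>.\<close>

lemma jumps_exclusive:
  fixes l :: "'r \<Rightarrow> int"
  assumes "0 \<le> l i" "jump R (\<lambda>j. nat (l j)) i"
    and "l i < int (c i)" "jump R (\<lambda>j. nat (int (c j) - (l j + int (E {i} j)))) i"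
  shows False
proof -
  define m where "m = (\<lambda>j. nat (l j))"
  define n where "n = (\<lambda>j. nat (int (c j) - (l j + int (E {i} j))))"
  obtain f where f: "f \<in> filt R m" "fps_nth (f i) (m i) \<noteq> 0" using assms(2) by (auto simp: jump_def m_def)
  obtain g where g: "g \<in> filt R n" "fps_nth (g i) (n i) \<noteq> 0" using assms(4) by (auto simp: jump_def n_def)
  \<comment> \<open>The shift by \<open>E {i}\<close> in the reflected vector makes the two orders
    add up to \<open>c i - 1\<close> rather than \<open>c i\<close>.\<close>
  have mni: "m i + n i = c i - 1" "c i > 0" using assms(1,3) by (auto simp: m_def n_def E_def)
  have mnj: "c j \<le> m j + n j" if "j \<noteq> i" for j using that by (auto simp: m_def n_def E_def)
  have fm: "\<forall>k<m j. fps_nth (f j) k = 0" and gn: "\<forall>k<n j. fps_nth (g j) k = 0" for j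
    using f g by (auto simp: mem_filt_iff)
  have low: "\<forall>k<m j + n j. fps_nth (f j * g j) k = 0"
    "fps_nth (f j * g j) (m j + n j) = fps_nth (f j) (m j) * fps_nth (g j) (n j)" for j
    by (rule fps_mult_nth_lowest[OF fm gn])+
  define a where "a = fps_nth ((f * g) i) (c i - 1)"
  have a: "a \<noteq> 0" unfolding a_def mni(1)[symmetric] using low(2)[of i] f(2) g(2) by (simp add: times_fun_def)
  have fg: "f * g \<in> R" using f g R_mult by (simp add: mem_filt_iff)
  let ?y = "unit_monomial i (c i - 1) - branch_scale (1 / a) (f * g)"
  have sfg: "branch_scale (1 / a) (f * g) \<in> R" using fg branch.subspace_scale[OF subspace_R] by blast
  have "?y \<in> R"
  proof (rule conductor_subset)
    show "?y \<in> branch_ring"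
      by (rule branch.subspace_diff[OF subspace_branch_ring unit_monomial_in_branch_ring subsetD[OF R_subset sfg]])
    fix j k assume k: "k < c j"
    show "fps_nth (?y j) k = 0"
    proof (cases "j = i")
      case False
      then have "fps_nth (f j * g j) k = 0" using low(1)[of j] mnj[of j] k by simp
      then show ?thesis using False by (simp add: unit_monomial_def branch_scale_def times_fun_def)
    next
      case True
      show ?thesis
      proof (cases "k = c i - 1")
        case True
        then show ?thesis
          using a \<open>j = i\<close> unfolding a_def by (simp add: unit_monomial_def branch_scale_def)
      next
        case False
        then have "k < m i + n i" using mni k[unfolded \<open>j = i\<close>] by linarith
        then have "fps_nth (f i * g i) k = 0" using low(1)[of i] by simp
        then show ?thesis using \<open>j = i\<close> False by (simp add: unit_monomial_def branch_scale_def times_fun_def)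
      qed
    qed
  qed
  then have "?y + branch_scale (1 / a) (f * g) \<in> R" using sfg by (rule R_add)
  then have "unit_monomial i (c i - 1) \<in> R" by simp
  then show False using conductor_minimal mni(2) by blast
qed

text \<open>The colon modules climb from \<open>R\<close> to the branch ring in steps that cost at
  most the jumps along the way, \<open>hilb R c\<close> in total. Adding the codimension of
  \<open>filt R c\<close> in \<open>R\<close> bounds \<open>size_vec c\<close>, its codimension in
  the branch ring.\<close>

lemma conductor_size_le_if_Gorenstein:
  assumes "Gorenstein R"
  shows "size_vec c \<le> 2 * hilb R c"
proof -
  let ?S = "\<lambda>x. {f \<in> R. \<forall>m\<in>max_ideal R. f * m \<in> (*) x ` R}"
  obtain x where x: "x \<in> max_ideal R" "\<And>y. y \<in> R \<Longrightarrow> x * y = 0 \<Longrightarrow> y = 0"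
    "quot_dim (?S x) ((*) x ` R) = 1"
    using assms unfolding Gorenstein_def by blast
  have xR: "x \<in> R" using x(1) by (simp add: max_ideal_iff)
  \<comment> \<open>A zero component would let \<open>x\<close> annihilate the monomial of degree
    \<open>c i\<close> on that branch, which lies in \<open>R\<close>.\<close>
  have x0: "x i \<noteq> 0" for i
  proof
    assume "x i = 0"
    then have "x * unit_monomial i (c i) = 0" by (simp add: unit_monomial_def times_fun_def zero_fun_def fun_eq_iff)
    moreover have "unit_monomial i (c i) \<in> R"
      by (rule conductor_subset[OF unit_monomial_in_branch_ring]) (auto simp: unit_monomial_nth)
    ultimately have "unit_monomial i (c i) = 0" using x(2) by blast
    from fun_cong[OF this, of i] show False by (simp add: unit_monomial_def zero_fun_def)
  qed
  have sub1: "branch.subspace ((*) x ` R)"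
    unfolding branch.subspace_def
  proof (intro conjI ballI allI)
    show "0 \<in> (*) x ` R" using branch.subspace_0[OF subspace_R] by (intro image_eqI[of _ _ 0]) auto
    show "u + v \<in> (*) x ` R" if "u \<in> (*) x ` R" "v \<in> (*) x ` R" for u v
      using that R_add by (auto simp flip: distrib_left)
    show "branch_scale a u \<in> (*) x ` R" if "u \<in> (*) x ` R" for a u
      using that branch.subspace_scale[OF subspace_R] by (auto simp flip: branch_scale_mult_right)
  qed
  have sub2: "branch.subspace (?S x)"
    unfolding branch.subspace_def
  proof (intro conjI ballI allI CollectI)
    fix u v m a
    show "0 \<in> R" "0 * m \<in> (*) x ` R" using branch.subspace_0[OF subspace_R] branch.subspace_0[OF sub1] by simp_all
    assume u: "u \<in> ?S x"
    show "branch_scale a u \<in> R" using u branch.subspace_scale[OF subspace_R] by blast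
    show "branch_scale a u * m \<in> (*) x ` R" if "m \<in> max_ideal R"
      using u that branch.subspace_scale[OF sub1] by (simp add: branch_scale_mult_left)
    assume v: "v \<in> ?S x"
    show "u + v \<in> R" using u v R_add by blast
    show "(u + v) * m \<in> (*) x ` R" if "m \<in> max_ideal R"
      using u v that branch.subspace_add[OF sub1] by (simp add: distrib_right)
  qed
  have sub3: "(*) x ` R \<subseteq> ?S x"
  proof (intro subsetI CollectI conjI ballI)
    fix z assume "z \<in> (*) x ` R"
    then obtain r where r: "r \<in> R" "z = x * r" by blast
    show "z \<in> R" using r xR R_mult by simp
    show "z * m \<in> (*) x ` R" if "m \<in> max_ideal R" for m
      using r that R_mult[of r m] by (intro image_eqI[of _ _ "r * m"]) (simp_all add: max_ideal_iff mult.assoc)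
  qed
  have socle: "codim_le (?S x) ((*) x ` R) 1" by (rule codim_le_quot_dim_1[OF sub2 sub1 sub3 x(3)])
  have chain: "codim_le (quotient_by_filt l) (quotient_by_filt 0) (hilb R l)" for l
  proof (induction l rule: vec_induct)
    case zero
    have "codim_le (quotient_by_filt 0) (quotient_by_filt 0) 0"
      using branch.subspace_0[OF subspace_quotient_by_filt]
      by (auto simp: codim_le_def spans_mod_def intro!: exI[of _ "{}"])
    then show ?case by (simp only: hilb_0[OF subspace_R])
  next
    case (add l i)
    show ?case
      using codim_le_trans[OF subspace_quotient_by_filt codim_quotient_by_filt[OF x(1) x0 socle, of l i] add]
      by (simp only: hilb_add_E[OF subspace_R] add.commute[of "hilb R l"])
  qed
  have q0: "quotient_by_filt 0 = R"
  proof
    have "1 \<in> filt R 0" using R_1 by (simp add: mem_filt_iff)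
    then show "quotient_by_filt 0 \<subseteq> R" by (auto simp: quotient_by_filt_def)
    show "R \<subseteq> quotient_by_filt 0"
      using R_subset R_mult by (auto simp: quotient_by_filt_def mem_filt_iff)
  qed
  have qc: "quotient_by_filt c = (branch_ring :: ('r \<Rightarrow> complex fps) set)"
  proof
    show "branch_ring \<subseteq> quotient_by_filt c"
    proof
      fix y :: "'r \<Rightarrow> complex fps" assume y: "y \<in> branch_ring"
      have "y * f \<in> R" if f: "f \<in> filt R c" for f
      proof (rule conductor_subset)
        show "y * f \<in> branch_ring" using y f R_subset by (intro branch_ring_mult) (auto simp: mem_filt_iff)
        show "fps_nth ((y * f) j) k = 0" if "k < c j" for j k
          using fps_mult_nth_lowest(1)[of 0 "y j" "c j" "f j"] f that by (simp add: mem_filt_iff times_fun_def)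
      qed
      then show "y \<in> quotient_by_filt c" using y by (simp add: quotient_by_filt_def)
    qed
  qed (auto simp: quotient_by_filt_def)
  have "codim_le branch_ring (filt R c) (hilb R c + hilb R c)"
    by (rule codim_le_trans[OF subspace_filt[OF subspace_R] chain[of c, unfolded q0 qc]
        codim_le_if_has_codim[OF has_codim_filt_hilb[OF subspace_R]]])
  moreover have "filt R c = filt branch_ring c"
    using R_subset conductor_subset by (auto simp: mem_filt_iff)
  ultimately have "codim_le branch_ring (filt branch_ring c) (2 * hilb R c)" by (simp add: mult_2)
  then show ?thesis
    using has_codim_le[OF subspace_filt[OF subspace_branch_ring] has_codim_filt_hilb[OF subspace_branch_ring]]
    by (simp add: hilb_branch_ring)
qed

text \<open>A unit step changes the defect \<open>D\<close> by a sum of two signs, and exclusive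
  jumps prevent both from being positive. Far below 0 the defect is \<open>|c| - 2 h(c)\<close>,
  which is nonpositive, so \<open>D\<close> is nonpositive everywhere; being odd under the
  reflection it vanishes.\<close>

theorem weight_symmetric_if_Gorenstein:
  assumes "Gorenstein R"
  shows "weight_int R (\<lambda>i. int (c i) - l i) = weight_int R l"
proof -
  define D where "D l = weight_int R l - weight_int R (\<lambda>i. int (c i) - l i)" for l
  have step: "D (\<lambda>j. l j + int (E {i} j)) \<le> D l" for l i
  proof -
    let ?l' = "\<lambda>j. int (c j) - (l j + int (E {i} j))"
    have "(\<lambda>j. ?l' j + int (E {i} j)) = (\<lambda>j. int (c j) - l j)" by (simp add: fun_eq_iff)
    then have "weight_int R (\<lambda>j. int (c j) - l j) =
      weight_int R ?l' + (if 0 \<le> ?l' i \<and> jump R (\<lambda>j. nat (?l' j)) i then 1 else - 1)"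
      using weight_int_add_unit[of ?l' i] by simp
    moreover have "\<not> (0 \<le> l i \<and> jump R (\<lambda>j. nat (l j)) i \<and> 0 \<le> ?l' i \<and> jump R (\<lambda>j. nat (?l' j)) i)"
      using jumps_exclusive[of l i] by (auto simp: E_def)
    ultimately show ?thesis unfolding D_def weight_int_add_unit[of l i] by (auto split: if_splits)
  qed
  have neg: "D l \<le> 0" for l
  proof -
    \<comment> \<open>The constant vector \<open>- int M\<close> lies below \<open>l\<close> and
      below 0; from there \<open>l\<close> is reached by unit steps.\<close>
    define B where "B = Max (range (\<lambda>i. \<bar>l i\<bar>))"
    define M where "M = nat B"
    have M: "- int M \<le> l i" for i
    proof -
      have "\<bar>l i\<bar> \<le> B" unfolding B_def by (intro Max_ge) auto
      moreover have "B \<le> int M" by (simp add: M_def)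
      ultimately show ?thesis by linarith
    qed
    have "D (\<lambda>i. - int M + int (v i)) \<le> D (\<lambda>i. - int M)" for v
    proof (induction v rule: vec_induct)
      case (add v i)
      have "(\<lambda>j. - int M + int ((v + E {i}) j)) = (\<lambda>j. - int M + int (v j) + int (E {i} j))"
        by (simp add: fun_eq_iff)
      then show ?case using step[of "\<lambda>i. - int M + int (v i)" i] add by (simp only: order_trans)
    qed simp
    moreover have "(\<lambda>i. - int M + int (nat (l i + int M))) = l"
    proof
      fix i
      show "- int M + int (nat (l i + int M)) = l i" using M[of i] by linarith
    qed
    ultimately have "D l \<le> D (\<lambda>i. - int M)" by metis
    also have "D (\<lambda>i. - int M) = int (size_vec c) - 2 * int (hilb R c)"
    proof -
      have "(\<lambda>i. nat (int (c i) - - int M)) = c + (\<lambda>_. M)" by (simp add: fun_eq_iff nat_add_distrib)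
      moreover have "(\<lambda>i. nat (- int M)) = (0 :: 'r \<Rightarrow> nat)" by (simp add: fun_eq_iff)
      ultimately show ?thesis
        unfolding D_def weight_int_def using hilb_above_conductor[of "\<lambda>_. M"]
        by (simp add: hilb_0[OF subspace_R] size_vec_def sum.distrib sum_negf)
    qed
    also have "\<dots> \<le> 0" using conductor_size_le_if_Gorenstein[OF assms] by linarith
    finally show ?thesis .
  qed
  have "D (\<lambda>i. int (c i) - l i) = - D l" by (simp add: D_def)
  with neg[of l] neg[of "\<lambda>i. int (c i) - l i"] have "D l = 0" by linarith
  then show ?thesis by (simp add: D_def)
qed

end

end

section \<open>Generating series\<close>

text \<open>Toggling \<open>i\<close> is an involution on \<open>K\<close> without fixed points that
  reverses the sign of every term.\<close>

lemma sum_toggle: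
  fixes f :: "'r :: finite set \<Rightarrow> int"
  assumes K: "\<And>J. i \<notin> J \<Longrightarrow> insert i J \<in> K \<longleftrightarrow> J \<in> K"
    and f: "\<And>J. i \<notin> J \<Longrightarrow> J \<in> K \<Longrightarrow> f (insert i J) = - f J"
  shows "sum f K = 0"
proof -
  define t where "t J = (if i \<in> J then J - {i} else insert i J)" for J :: "'r set"
  have tt: "t (t J) = J" for J by (auto simp: t_def)
  have tK: "t J \<in> K" if "J \<in> K" for J
    using K[of J] K[of "J - {i}"] that by (auto simp: t_def insert_absorb)
  have ft: "- f (t J) = f J" if "J \<in> K" for J
  proof (cases "i \<in> J")
    case True
    then have J: "insert i (J - {i}) = J" by auto
    then have "J - {i} \<in> K" using K[of "J - {i}"] that by simp
    from f[OF _ this] show ?thesis using True J by (simp add: t_def)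
  next
    case False
    then show ?thesis using f[OF False that] by (simp add: t_def)
  qed
  have "sum f K = (\<Sum>J\<in>K. - f J)"
    by (rule sum.reindex_bij_witness[where i = t and j = t]) (use tt tK ft in auto)
  then show ?thesis by (simp add: sum_negf)
qed

lemma E_le_iff: "E J \<le> l \<longleftrightarrow> (\<forall>i\<in>J. 1 \<le> l i)"
  by (auto simp: le_fun_def E_def)

lemma inj_E: "E I = E J \<longleftrightarrow> I = J"
proof
  assume eq: "E I = E J"
  have "i \<in> I \<longleftrightarrow> i \<in> J" for i using fun_cong[OF eq, of i] by (simp add: E_def split: if_splits)
  then show "I = J" by blast
qed simp

lemma sum_signs_UNIV: "(\<Sum>J\<in>(UNIV :: 'r :: finite set set). (- 1 :: int) ^ card J) = 0"
  by (rule sum_toggle[of undefined]) auto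

lemma hilb_add_E_le:
  fixes R :: "('r :: finite \<Rightarrow> complex fps) set"
  assumes R: "branch.subspace R"
  shows "hilb R l \<le> hilb R (l + E J)" "hilb R (l + E J) \<le> hilb R l + CARD('r)"
proof -
  note mr = matroid_rank_hilb[OF R, of l]
  have E0: "l + E {} = l" by (auto simp: E_def fun_eq_iff)
  show "hilb R l \<le> hilb R (l + E J)"
    using matroid_rank_mono[OF mr _ empty_subsetI, of J] unfolding E0 by simp
  have "finite J" by simp
  then have "hilb R (l + E J) \<le> hilb R l + card J"
  proof (induction J)
    case empty
    then show ?case unfolding E0 by simp
  next
    case (insert j J)
    have "card (insert j J) = card J + 1" using insert.hyps by simp
    then show ?case using insert.IH matroid_rank_insert(2)[where I = J and i = j, OF mr subset_UNIV UNIV_I] by linarith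
  qed
  also have "card J \<le> CARD('r)" by (simp add: card_mono)
  finally show "hilb R (l + E J) \<le> hilb R l + CARD('r)" by simp
qed

text \<open>The Hilbert function grows by at most one per direction, so for such \<open>k\<close>
  all faces are counted and the signs cancel.\<close>

lemma euler_coeff_eq_0:
  fixes R :: "('r :: finite \<Rightarrow> complex fps) set"
  assumes R: "branch.subspace R" and "CARD('r) \<le> k"
  shows "euler_coeff R l k = 0"
proof -
  have "hilb R (l + E J) \<le> hilb R l + k" for J
    using hilb_add_E_le(2)[OF R, of l J] assms(2) by linarith
  then have "{J. hilb R (l + E J) \<le> hilb R l + k} = UNIV" by blast
  then show ?thesis by (simp add: euler_coeff_def sum_signs_UNIV)
qed

lemma euler_coeff_support:
  fixes R :: "('r :: finite \<Rightarrow> complex fps) set"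
  assumes R: "branch.subspace R" and "euler_coeff R l k \<noteq> 0"
  shows "k < CARD('r)"
  using euler_coeff_eq_0[OF R, of k l] assms(2) by (meson not_le)

lemma finite_euler_coeff_support:
  fixes R :: "('r :: finite \<Rightarrow> complex fps) set"
  assumes R: "branch.subspace R"
  shows "finite {k. euler_coeff R l k \<noteq> 0}"
proof (rule finite_subset)
  show "{k. euler_coeff R l k \<noteq> 0} \<subseteq> {..<CARD('r)}"
  proof
    fix k assume "k \<in> {k. euler_coeff R l k \<noteq> 0}"
    then have "euler_coeff R l k \<noteq> 0" by simp
    from euler_coeff_support[OF R this] show "k \<in> {..<CARD('r)}" by simp
  qed
qed simp

lemma PE1_nonzeroD:
  fixes R :: "('r :: finite \<Rightarrow> complex fps) set"
  assumes R: "branch.subspace R" and "PE1 R (l, n, k) \<noteq> 0"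
  shows "n = weight R l + int k" "k < CARD('r)"
proof -
  show n: "n = weight R l + int k" using assms(2) unfolding PE1_eq[OF R] by presburger
  have "euler_coeff R l k \<noteq> 0" using assms(2) n unfolding PE1_eq[OF R] by auto
  then show "k < CARD('r)" by (rule euler_coeff_support[OF R])
qed

section \<open>Coefficients of the motivic series\<close>

lemma poly_div_one_minus_q:
  "(Polynomial.monom 1 (h + d) - Polynomial.monom 1 h) div [:1, -1:] = - (\<Sum>j<d. Polynomial.monom (1 :: int) (h + j))"
proof -
  have "[:1, -1:] * (\<Sum>j<d. Polynomial.monom (1 :: int) (h + j)) = Polynomial.monom 1 h - Polynomial.monom 1 (h + d)"
  proof (induction d)
    case (Suc d)
    have "[:1, -1:] * Polynomial.monom (1 :: int) (h + d) = Polynomial.monom 1 (h + d) - Polynomial.monom 1 (h + Suc d)"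
      by (simp add: monom_Suc)
    then show ?case using Suc by (simp add: distrib_left)
  qed simp
  then have "Polynomial.monom 1 (h + d) - Polynomial.monom 1 h = [:1, -1:] * - (\<Sum>j<d. Polynomial.monom (1 :: int) (h + j))"
    by simp
  then show ?thesis by (metis nonzero_mult_div_cancel_left pCons_eq_0_iff zero_neq_one)
qed

text \<open>Each exact quotient is minus a block of \<open>d J\<close> consecutive powers starting
  at \<open>q ^ hilb R l\<close>, so the coefficient at offset \<open>k\<close> is minus the signed
  count of the \<open>J\<close> with \<open>d J > k\<close>. As all signs sum to 0, this is the
  signed count of those with \<open>d J \<le> k\<close>.\<close>

lemma coeff_motivic_coeff:
  fixes R :: "('r :: finite \<Rightarrow> complex fps) set"
  assumes R: "branch.subspace R"
  shows "Polynomial.coeff (motivic_coeff R l) n = (if hilb R l \<le> n then euler_coeff R l (n - hilb R l) else 0)"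
proof -
  let ?h = "hilb R l"
  define d where "d J = hilb R (l + E J) - ?h" for J
  have d: "hilb R (l + E J) = ?h + d J" for J using hilb_add_E_le(1)[OF R, of l J] by (simp add: d_def)
  have "motivic_coeff R l = (\<Sum>J\<in>UNIV. (-1) ^ card J * - (\<Sum>j<d J. Polynomial.monom (1 :: int) (?h + j)))"
    unfolding motivic_coeff_def d poly_div_one_minus_q ..
  also have "\<dots> = (\<Sum>J\<in>UNIV. Polynomial.smult ((-1) ^ card J) (- (\<Sum>j<d J. Polynomial.monom (1 :: int) (?h + j))))"
  proof (rule sum.cong)
    fix J :: "'r set"
    show "(-1) ^ card J * - (\<Sum>j<d J. Polynomial.monom (1 :: int) (?h + j)) = Polynomial.smult ((-1) ^ card J) (- (\<Sum>j<d J. Polynomial.monom 1 (?h + j)))"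
      by (cases "even (card J)") auto
  qed simp
  finally have c: "Polynomial.coeff (motivic_coeff R l) n
      = (\<Sum>J\<in>UNIV. (-1) ^ card J * - (\<Sum>j<d J. if ?h + j = n then 1 else 0))"
    by (simp add: coeff_sum)
  show ?thesis
  proof (cases "?h \<le> n")
    case False
    then have "(\<Sum>j<m. if ?h + j = n then 1 else (0::int)) = 0" for m by (intro sum.neutral) auto
    then show ?thesis using False unfolding c by simp
  next
    case True
    define k where "k = n - ?h"
    have n: "n = ?h + k" using True by (simp add: k_def)
    have "(\<Sum>j<d J. if ?h + j = n then 1 else (0::int)) = (if k < d J then 1 else 0)" for J
      by (simp add: n)
    then have "Polynomial.coeff (motivic_coeff R l) n = (\<Sum>J\<in>UNIV. (-1) ^ card J * (if d J \<le> k then 1 else 0) - (-1) ^ card J)"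
      unfolding c by (intro sum.cong) auto
    also have "\<dots> = (\<Sum>J\<in>UNIV. if d J \<le> k then (-1) ^ card J else 0) - (\<Sum>J\<in>(UNIV :: 'r set set). (-1) ^ card J)"
      unfolding sum_subtractf by (intro arg_cong2[of _ _ _ _ "(-)"] sum.cong) auto
    also have "\<dots> = euler_coeff R l k"
      unfolding euler_coeff_def sum_signs_UNIV d by (simp add: sum.If_cases)
    finally show ?thesis using True by (simp add: k_def)
  qed
qed

lemma coeff_sum_monom_shift:
  assumes "finite A" "\<And>k. k \<notin> A \<Longrightarrow> a k = 0"
  shows "Polynomial.coeff (\<Sum>k\<in>A. Polynomial.monom (a k :: int) (k + h)) n = (if h \<le> n then a (n - h) else 0)"
proof (cases "h \<le> n")
  case True
  have "Polynomial.coeff (\<Sum>k\<in>A. Polynomial.monom (a k) (k + h)) n = (\<Sum>k\<in>A. if k = n - h then a k else 0)"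
    unfolding coeff_sum using True by (intro sum.cong) auto
  also have "\<dots> = a (n - h)" using assms by (auto simp: sum.delta)
  finally show ?thesis using True by simp
next
  case False
  then show ?thesis unfolding coeff_sum by (auto intro!: sum.neutral)
qed

lemma is_motivic_expansion_iff:
  fixes R :: "('r :: finite \<Rightarrow> complex fps) set"
  assumes R: "branch.subspace R"
  shows "is_motivic_expansion R l a \<longleftrightarrow> a = euler_coeff R l"
proof
  assume a: "is_motivic_expansion R l a"
  show "a = euler_coeff R l"
  proof
    fix k
    have fin: "finite {k. a k \<noteq> 0}"
      and mc: "motivic_coeff R l = (\<Sum>k | a k \<noteq> 0. Polynomial.monom (a k) (k + hilb R l))"
      using a unfolding is_motivic_expansion_def by blast+
    have "Polynomial.coeff (motivic_coeff R l) (k + hilb R l) = a k"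
      unfolding mc by (subst coeff_sum_monom_shift[OF fin]) simp_all
    then show "a k = euler_coeff R l k" by (simp add: coeff_motivic_coeff[OF R])
  qed
next
  assume a: "a = euler_coeff R l"
  show "is_motivic_expansion R l a"
    unfolding is_motivic_expansion_def a
  proof (intro conjI poly_eqI)
    note fin = finite_euler_coeff_support[OF R, of l]
    show "finite {k. euler_coeff R l k \<noteq> 0}" by (rule fin)
    show "Polynomial.coeff (motivic_coeff R l) n =
      Polynomial.coeff (\<Sum>k | euler_coeff R l k \<noteq> 0. Polynomial.monom (euler_coeff R l k) (k + hilb R l)) n" for n
      unfolding coeff_motivic_coeff[OF R] by (rule coeff_sum_monom_shift[OF fin, symmetric]) simp
  qed
qed

lemma poly_of_int_sum_monom:
  fixes x :: "rat fls"
  shows "poly (map_poly of_int (\<Sum>k\<in>A. Polynomial.monom (a k) (k + h))) x = (\<Sum>k\<in>A. of_int (a k) * x ^ (k + h))"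
proof -
  have "map_poly of_int (\<Sum>k\<in>A. Polynomial.monom (a k) (k + h)) = (\<Sum>k\<in>A. Polynomial.monom (of_int (a k) :: rat fls) (k + h))"
    by (rule poly_eqI) (simp add: coeff_map_poly coeff_sum of_int_sum if_distrib cong: if_cong)
  then show ?thesis by (simp add: poly_sum poly_monom)
qed

text \<open>The exponents of the root of \<open>q\<close> add up to
  \<open>|l| + w(l) + 2 k = 2 (h(l) + k)\<close>, and the sign of the substituted \<open>h\<close>
  cancels the one in the rank formula.\<close>

lemma part_a:
  fixes R :: "('r :: finite \<Rightarrow> complex fps) set"
  assumes R: "branch.subspace R"
  shows "finite {(n, k). PE1 R (l, n, k) \<noteq> 0} \<and>
       (\<Sum>(n, k) \<in> {(n, k). PE1 R (l, n, k) \<noteq> 0}.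
          of_int (PE1 R (l, n, k)) * (\<Prod>i\<in>UNIV. fls_X ^ l i) * fls_X powi n * (- fls_X) ^ k)
       = (poly (map_poly of_int (motivic_coeff R l)) (fls_X ^ 2) :: rat fls)"
proof -
  let ?r = "CARD('r)" and ?S = "{(n, k). PE1 R (l, n, k) \<noteq> 0}"
  define T where "T = (\<lambda>k. (weight R l + int k, k)) ` {..<?r}"
  have S: "?S \<subseteq> T"
  proof clarify
    fix n k assume nk: "PE1 R (l, n, k) \<noteq> 0"
    show "(n, k) \<in> T"
      unfolding T_def using PE1_nonzeroD[OF R nk] by (intro image_eqI[of _ _ k]) auto
  qed
  have finT: "finite T" by (simp add: T_def)
  define g :: "int \<times> nat \<Rightarrow> rat fls" where
    "g z = of_int (PE1 R (l, fst z, snd z)) * (\<Prod>i\<in>UNIV. fls_X ^ l i) * fls_X powi fst z * (- fls_X) ^ snd z" for z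
  have X0: "fls_X \<noteq> (0 :: rat fls)" by simp
  have "(\<Sum>(n, k) \<in> ?S. of_int (PE1 R (l, n, k)) * (\<Prod>i\<in>UNIV. fls_X ^ l i) * fls_X powi n * (- fls_X) ^ k) = (sum g ?S :: rat fls)"
    by (intro sum.cong) (auto simp: g_def)
  also have "\<dots> = sum g T"
    by (rule sum.mono_neutral_left[OF finT S]) (auto simp: g_def)
  also have "\<dots> = (\<Sum>k<?r. g (weight R l + int k, k))"
    unfolding T_def by (subst sum.reindex) (auto simp: inj_on_def)
  also have "\<dots> = (\<Sum>k<?r. of_int (euler_coeff R l k) * (fls_X ^ 2) ^ (k + hilb R l))"
  proof (rule sum.cong)
    fix k
    have "(\<Prod>i\<in>UNIV. fls_X ^ l i) * fls_X powi (weight R l + int k) = (fls_X :: rat fls) powi (int (size_vec l) + (weight R l + int k))"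
    proof -
      have "(\<Prod>i\<in>UNIV. (fls_X :: rat fls) ^ l i) = fls_X powi int (size_vec l)"
        by (simp only: size_vec_def power_sum power_int_of_nat)
      then show ?thesis by (simp only: power_int_add[OF disjI1[OF X0]])
    qed
    also have "int (size_vec l) + (weight R l + int k) = int (2 * hilb R l + k)" by (simp add: weight_def)
    also have "(fls_X :: rat fls) powi int (2 * hilb R l + k) = fls_X ^ (2 * hilb R l + k)" by (rule power_int_of_nat)
    finally have 1: "(\<Prod>i\<in>UNIV. fls_X ^ l i) * fls_X powi (weight R l + int k) = (fls_X :: rat fls) ^ (2 * hilb R l + k)" .
    have 2: "(- 1) ^ k * (- fls_X) ^ k = (fls_X :: rat fls) ^ k" by (simp flip: power_mult_distrib)
    have "g (weight R l + int k, k) = of_int (euler_coeff R l k)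
        * ((\<Prod>i\<in>UNIV. fls_X ^ l i) * fls_X powi (weight R l + int k)) * ((- 1) ^ k * (- fls_X) ^ k)"
      by (simp add: g_def PE1_eq[OF R] mult_ac)
    also have "\<dots> = of_int (euler_coeff R l k) * fls_X ^ (2 * hilb R l + k) * fls_X ^ k" unfolding 1 2 ..
    also have "\<dots> = of_int (euler_coeff R l k) * (fls_X ^ 2) ^ (k + hilb R l)"
      by (simp add: mult.assoc algebra_simps flip: power_add power_mult)
    finally show "g (weight R l + int k, k) = of_int (euler_coeff R l k) * (fls_X ^ 2) ^ (k + hilb R l)" .
  qed simp
  also have "\<dots> = poly (map_poly of_int (\<Sum>k<?r. Polynomial.monom (euler_coeff R l k) (k + hilb R l))) (fls_X ^ 2)"
    by (rule poly_of_int_sum_monom[symmetric])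
  also have "(\<Sum>k<?r. Polynomial.monom (euler_coeff R l k) (k + hilb R l)) = motivic_coeff R l"
    by (rule poly_eqI, subst coeff_sum_monom_shift)
      (simp_all add: coeff_motivic_coeff[OF R] euler_coeff_eq_0[OF R])
  finally show ?thesis using finite_subset[OF S finT] by blast
qed

section \<open>Coefficients of products and substitutions in \<open>T\<close>, \<open>Q\<close>,
  \<open>h\<close>\<close>

lemma power_minus_Qh: "(- (var_Q * var_h)) ^ j = (Poly_Mapping.single (0, int j, j) ((- 1) ^ j) :: 'r TQh_poly)"
proof (induction j)
  case 0
  have "(0, int 0, 0) = (0 :: 'r TQh)" by (simp add: zero_prod_def)
  then show ?case by (simp only: power_0 single_one)
next
  case (Suc j)
  have "- (var_Q * var_h) = (Poly_Mapping.single (0, 1, 1) (- 1) :: 'r TQh_poly)"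
    by (simp add: var_Q_def var_h_def mult_single single_uminus)
  then show ?case using Suc by (simp add: mult_single add.commute)
qed

lemma part_c:
  fixes R :: "('r :: finite \<Rightarrow> complex fps) set"
  assumes R: "branch.subspace R" and a: "a = euler_coeff R l"
  shows "PE1 R (l, n, k) = Poly_Mapping.lookup
         (\<Sum>j | a j \<noteq> 0. Poly_Mapping.single (l, weight R l, 0) (a j) * (- (var_Q * var_h)) ^ j) (l, n, k)"
proof -
  have fin: "finite {j. a j \<noteq> 0}" unfolding a by (rule finite_euler_coeff_support[OF R])
  have "Poly_Mapping.lookup (\<Sum>j | a j \<noteq> 0. Poly_Mapping.single (l, weight R l, 0) (a j) * (- (var_Q * var_h)) ^ j) (l, n, k)
      = (\<Sum>j | a j \<noteq> 0. if j = k then (if n = weight R l + int k then (- 1) ^ k * a k else 0) else 0)"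
    unfolding lookup_sum power_minus_Qh mult_single
    by (intro sum.cong) (auto simp: lookup_single when_def)
  also have "\<dots> = (if n = weight R l + int k then (- 1) ^ k * a k else 0)"
    using fin by (auto simp: sum.delta)
  finally show ?thesis by (simp add: PE1_eq[OF R] a)
qed

lemma prod_one_minus_TQ:
  "(\<Prod>i\<in>UNIV. 1 - var_T i * var_Q) =
     (\<Sum>J\<in>(UNIV :: 'r :: finite set set). Poly_Mapping.single (E J, int (card J), 0) ((- 1) ^ card J))"
proof -
  have E0: "E {} = (0 :: 'r \<Rightarrow> nat)" by (simp add: E_def fun_eq_iff)
  have z: "(0, int 0, 0) = (0 :: 'r TQh)" by (simp add: zero_prod_def)
  have TQ: "- (var_T i * var_Q) = (Poly_Mapping.single (E {i}, 1, 0) (- 1) :: 'r TQh_poly)" for i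
    by (simp add: var_T_def var_Q_def mult_single single_uminus)
  have "(\<Prod>i\<in>J. - (var_T i * var_Q)) = (Poly_Mapping.single (E J, int (card J), 0) ((- 1) ^ card J) :: 'r TQh_poly)" for J
  proof -
    have "finite J" by simp
    then show ?thesis
    proof (induction J)
      case empty
      show ?case unfolding prod.empty card.empty E0 z power_0 single_one ..
    next
      case (insert i J)
      then have "(\<Prod>i\<in>insert i J. - (var_T i * var_Q))
          = Poly_Mapping.single (E {i}, 1, 0) (- 1) * Poly_Mapping.single (E J, int (card J), 0) ((- 1) ^ card J)"
        by (simp only: prod.insert TQ not_False_eq_True)
      also have "\<dots> = Poly_Mapping.single (E {i} + E J, 1 + int (card J), 0) (- 1 * (- 1) ^ card J)"
        by (simp only: mult_single add_Pair add_0_right)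
      also have "E {i} + E J = E (insert i J)" using insert by (simp only: E_insert add.commute not_False_eq_True)
      finally show ?case using insert by simp
    qed
  qed
  moreover have "(\<Prod>i\<in>UNIV. 1 - var_T i * var_Q) = (\<Prod>i\<in>UNIV. - (var_T i * var_Q) + (1 :: 'r TQh_poly))"
    by (simp add: algebra_simps)
  ultimately show ?thesis
    by (simp only: prod_add[OF finite] Pow_UNIV prod.neutral_const mult_1_right)
qed

text \<open>Distinct \<open>J\<close> give distinct exponents, so no terms of the expanded product
  merge. The condition \<open>E J \<le> l\<close> guards the truncated subtraction.\<close>

lemma series_mult_one_minus_TQ:
  fixes F :: "'r :: finite TQh_series"
  shows "series_mult (\<Prod>i\<in>UNIV. 1 - var_T i * var_Q) F (l, n, k) =
     (\<Sum>J\<in>{J. E J \<le> l}. (- 1) ^ card J * F (l - E J, n - int (card J), k))"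
proof -
  let ?P = "(\<Prod>i\<in>UNIV. 1 - var_T i * var_Q) :: 'r TQh_poly"
  define key where "key J = (E J, int (card J), 0 :: nat)" for J :: "'r set"
  have inj: "key I = key J \<longleftrightarrow> I = J" for I J by (auto simp: key_def inj_E)
  have lk: "Poly_Mapping.lookup ?P x = (\<Sum>J\<in>UNIV. if key J = x then (- 1) ^ card J else 0)" for x
    unfolding prod_one_minus_TQ lookup_sum lookup_single when_def key_def ..
  have lkey: "Poly_Mapping.lookup ?P (key J) = (- 1) ^ card J" for J
    unfolding lk inj by (simp add: sum.delta)
  have keys: "Poly_Mapping.keys ?P = range key"
  proof
    show "range key \<subseteq> Poly_Mapping.keys ?P" by (auto simp: in_keys_iff lkey)
    show "Poly_Mapping.keys ?P \<subseteq> range key"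
    proof
      fix x assume "x \<in> Poly_Mapping.keys ?P"
      then have nz: "(\<Sum>J\<in>UNIV. if key J = x then (- 1 :: int) ^ card J else 0) \<noteq> 0" by (simp add: in_keys_iff lk)
      show "x \<in> range key"
      proof (rule ccontr)
        assume "x \<notin> range key"
        then have "key J \<noteq> x" for J by blast
        then show False using nz by simp
      qed
    qed
  qed
  have "{(m, a, j) \<in> Poly_Mapping.keys ?P. m \<le> l \<and> j \<le> k} = key ` {J. E J \<le> l}"
    unfolding keys by (auto simp: key_def)
  then have "series_mult ?P F (l, n, k) = (\<Sum>(m, a, j)\<in>key ` {J. E J \<le> l}. Poly_Mapping.lookup ?P (m, a, j) * F (l - m, n - a, k - j))"
    by (simp add: series_mult_def)
  also have "\<dots> = (\<Sum>J\<in>{J. E J \<le> l}. Poly_Mapping.lookup ?P (key J) * F (l - E J, n - int (card J), k))"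
  proof -
    have "inj_on key {J. E J \<le> l}" using inj by (simp add: inj_on_def)
    then show ?thesis by (subst sum.reindex) (simp_all add: key_def)
  qed
  finally show ?thesis by (simp add: lkey)
qed

lemma lookup_single_1_mult:
  fixes P :: "'k :: cancel_comm_monoid_add \<Rightarrow>\<^sub>0 int"
  shows "Poly_Mapping.lookup (Poly_Mapping.single a 1 * P) (a + x) = Poly_Mapping.lookup P x"
proof -
  have P: "P = (\<Sum>k\<in>Poly_Mapping.keys P. Poly_Mapping.single k (Poly_Mapping.lookup P k))"
    by (rule poly_mapping_eqI)
      (simp add: lookup_sum lookup_single when_def sum.delta in_keys_iff)
  have "Poly_Mapping.single a 1 * P = (\<Sum>k\<in>Poly_Mapping.keys P. Poly_Mapping.single (a + k) (Poly_Mapping.lookup P k))"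
    by (subst P) (simp only: sum_distrib_left mult_single mult_1)
  then have "Poly_Mapping.lookup (Poly_Mapping.single a 1 * P) (a + x)
      = (\<Sum>k\<in>Poly_Mapping.keys P. if k = x then Poly_Mapping.lookup P k else 0)"
    by (simp only: lookup_sum lookup_single when_def add_left_cancel)
  also have "\<dots> = Poly_Mapping.lookup P x"
    by (simp add: sum.delta in_keys_iff)
  finally show ?thesis .
qed

lemma lookup_invert_T: "Poly_Mapping.lookup (invert_T P) (l, n) = Poly_Mapping.lookup P (- l, n)"
proof -
  have "Poly_Mapping.lookup (invert_T P) (l, n)
      = (\<Sum>z\<in>Poly_Mapping.keys P. if z = (- l, n) then Poly_Mapping.lookup P z else 0)"
  proof -
    have *: "- a = l \<longleftrightarrow> a = - l" for a :: "'a \<Rightarrow> int" by (metis minus_minus)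
    show ?thesis
      unfolding invert_T_def lookup_sum
      by (intro sum.cong refl) (simp add: lookup_single when_def * split: prod.splits)
  qed
  also have "\<dots> = Poly_Mapping.lookup P (- l, n)"
    by (simp add: sum.delta in_keys_iff)
  finally show ?thesis .
qed

lemma power_minus_Q: "(- Poly_Mapping.single (0, 1) 1) ^ k = (Poly_Mapping.single (0, int k) ((- 1) ^ k) :: 'r TQ_laurent)"
proof (induction k)
  case 0
  have "(0, int 0) = (0 :: ('r \<Rightarrow> int) \<times> int)" by (simp add: zero_prod_def)
  then show ?case by (simp only: power_0 single_one)
next
  case (Suc k)
  have "- Poly_Mapping.single (0, 1) 1 = (Poly_Mapping.single (0, 1) (- 1) :: 'r TQ_laurent)"
    by (simp add: single_uminus)
  then show ?case unfolding power_Suc Suc by (simp only: mult_single add_Pair add_0_right of_nat_Suc)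
qed

text \<open>The bound \<open>r\<close> on the powers of \<open>h\<close> replaces the sum over the
  support of \<open>P\<close> by one over a fixed range.\<close>

lemma lookup_subst_h:
  fixes P :: "'r TQh_poly"
  assumes P: "\<And>l n k. r \<le> k \<Longrightarrow> Poly_Mapping.lookup P (l, n, k) = 0"
  shows "Poly_Mapping.lookup (subst_h P) (l, v) =
    (if \<forall>i. 0 \<le> l i then \<Sum>k<r. (- 1) ^ k * Poly_Mapping.lookup P (\<lambda>i. nat (l i), v - int k, k) else 0)"
proof -
  define g where "g z = (if (\<lambda>i. int (fst z i)) = l \<and> fst (snd z) + int (snd (snd z)) = v
    then (- 1) ^ snd (snd z) * Poly_Mapping.lookup P z else 0)" for z
  have "Poly_Mapping.lookup (subst_h P) (l, v) = sum g (Poly_Mapping.keys P)"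
    unfolding subst_h_def lookup_sum power_minus_Q
    by (intro sum.cong) (auto simp: lookup_single when_def mult_single g_def)
  also have "\<dots> = (if \<forall>i. 0 \<le> l i then \<Sum>k<r. (- 1) ^ k * Poly_Mapping.lookup P (\<lambda>i. nat (l i), v - int k, k) else 0)"
  proof (cases "\<forall>i. 0 \<le> l i")
    case False
    have "g z = 0" for z
    proof -
      have "(\<lambda>i. int (fst z i)) \<noteq> l" using False by auto
      then show ?thesis by (simp add: g_def)
    qed
    then show ?thesis unfolding if_not_P[OF False] by simp
  next
    case True
    define T where "T = (\<lambda>k. (\<lambda>i. nat (l i), v - int k, k)) ` {..<r}"
    have finT: "finite T" by (simp add: T_def)
    have "sum g (Poly_Mapping.keys P) = sum g (Poly_Mapping.keys P \<union> T)"
      by (rule sum.mono_neutral_left) (auto simp: finT g_def in_keys_iff)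
    also have "\<dots> = sum g T"
    proof (rule sum.mono_neutral_right)
      show "\<forall>z\<in>Poly_Mapping.keys P \<union> T - T. g z = 0"
      proof
        fix z assume z: "z \<in> Poly_Mapping.keys P \<union> T - T"
        obtain m n k where zz: "z = (m, n, k)" by (cases z) auto
        have "k < r" using z P[of k m n] unfolding zz by (auto simp: in_keys_iff not_le[symmetric] simp del: not_le)
        moreover have "m = (\<lambda>i. nat (l i)) \<and> n = v - int k" if "g z \<noteq> 0"
          using that unfolding g_def zz by (auto split: if_splits)
        ultimately show "g z = 0" using z unfolding zz T_def by auto
      qed
    qed (auto simp: finT)
    also have "\<dots> = (\<Sum>k<r. g (\<lambda>i. nat (l i), v - int k, k))"
      unfolding T_def by (subst sum.reindex) (auto simp: inj_on_def)
    also have "\<dots> = (\<Sum>k<r. (- 1) ^ k * Poly_Mapping.lookup P (\<lambda>i. nat (l i), v - int k, k))"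
      using True by (intro sum.cong) (auto simp: g_def)
    finally show ?thesis using True by simp
  qed
  finally show ?thesis .
qed

lemma weight_int_of_nat: "weight_int R (\<lambda>i. int (l i)) = weight R l"
  by (simp add: weight_int_def weight_def size_vec_def)

section \<open>The numerator of the rational function and its symmetry\<close>

context normalization
begin

text \<open>Once direction \<open>i\<close> always jumps, a further step in it adds one to the
  Hilbert function at every vertex \<open>l + E J\<close>, so all differences between these vertices
  are unchanged.\<close>

lemma hilb_shift_if_jumps:
  assumes "\<And>l. m \<le> l i \<Longrightarrow> jump R l i" "m \<le> l i"
  shows "weight R (l + E {i}) = weight R l + 1" "euler_coeff R (l + E {i}) k = euler_coeff R l k"
proof -
  have "hilb R (l + E J + E {i}) = hilb R (l + E J) + 1" for J
    using assms(1)[of "l + E J"] assms(2) by (simp only: hilb_add_E[OF subspace_R] plus_fun_apply trans_le_add1 if_True)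
  then have h: "hilb R (l + E {i} + E J) = hilb R (l + E J) + 1" for J by (simp only: add.assoc add.commute[of "E {i}"])
  have h0: "hilb R (l + E {i}) = hilb R l + 1"
    using assms by (simp only: hilb_add_E[OF subspace_R] if_True)
  show "weight R (l + E {i}) = weight R l + 1" unfolding weight_def h0 size_vec_add_E by simp
  show "euler_coeff R (l + E {i}) k = euler_coeff R l k" unfolding euler_coeff_def h h0 by simp
qed

definition numerator_coeff :: "'r TQh_series" where
  "numerator_coeff = series_mult (\<Prod>i\<in>UNIV. 1 - var_T i * var_Q) (PE1 R)"

lemma numerator_coeff_eq:
  "numerator_coeff (l, n, k) = (\<Sum>J\<in>{J. E J \<le> l}. (- 1) ^ card J * PE1 R (l - E J, n - int (card J), k))"
  unfolding numerator_coeff_def by (rule series_mult_one_minus_TQ)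

text \<open>The terms for \<open>J\<close> and \<open>insert i J\<close> cancel, since a step in
  direction \<open>i\<close> multiplies the coefficient of \<open>PE1\<close> by \<open>Q\<close>.
  The strict bound \<open>m < l i\<close> keeps the entry at least \<open>m\<close> even after it is
  lowered by one.\<close>

lemma numerator_coeff_0_if_large:
  assumes "\<And>l. m \<le> l i \<Longrightarrow> jump R l i" "m < l i"
  shows "numerator_coeff (l, n, k) = 0"
  unfolding numerator_coeff_eq
proof (rule sum_toggle[of i])
  show "insert i J \<in> {J. E J \<le> l} \<longleftrightarrow> J \<in> {J. E J \<le> l}" for J
    using assms(2) by (auto simp: E_le_iff)
  fix J assume J: "i \<notin> J" "J \<in> {J. E J \<le> l}"
  define l' where "l' = l - E (insert i J)"
  have l': "l - E J = l' + E {i}"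
  proof
    fix j
    show "(l - E J) j = (l' + E {i}) j"
      using J assms(2) by (cases "j = i") (auto simp: l'_def E_def)
  qed
  have ml: "m \<le> l' i" using assms(2) by (simp add: l'_def E_def)
  have w: "weight R (l' + E {i}) = weight R l' + 1"
    using assms(1) ml by (rule hilb_shift_if_jumps(1))
  have e: "euler_coeff R (l' + E {i}) k = euler_coeff R l' k"
    using assms(1) ml by (rule hilb_shift_if_jumps(2))
  have "PE1 R (l' + E {i}, n - int (card J), k) = PE1 R (l', n - int (card (insert i J)), k)"
    unfolding PE1_eq[OF subspace_R] w e using J(1) by (intro if_cong) auto
  then show "(- 1) ^ card (insert i J) * PE1 R (l - E (insert i J), n - int (card (insert i J)), k) =
      - ((- 1) ^ card J * PE1 R (l - E J, n - int (card J), k))"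
    unfolding l' using J(1) by (simp add: l'_def[symmetric])
qed

lemma numerator_coeff_0_if_degree:
  assumes "CARD('r) \<le> k"
  shows "numerator_coeff (l, n, k) = 0"
  unfolding numerator_coeff_eq
proof (rule sum.neutral, rule ballI)
  fix J
  have "PE1 R (l - E J, n - int (card J), k) = 0"
    using PE1_nonzeroD(2)[OF subspace_R, of "l - E J" "n - int (card J)" k] assms by (meson not_le)
  then show "(- 1) ^ card J * PE1 R (l - E J, n - int (card J), k) = 0" by simp
qed

text \<open>Large \<open>l\<close> cancel by means of exponents beyond which every direction jumps.
  For each remaining \<open>l\<close> the power of \<open>Q\<close> is determined by
  \<open>J\<close> and \<open>k\<close>, of which there are finitely many.\<close>

lemma finite_numerator_support: "finite {x. numerator_coeff x \<noteq> 0}"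
proof -
  obtain m where "\<forall>y\<in>branch_ring. (\<forall>i. \<forall>k<m i. fps_nth (y i) k = 0) \<longrightarrow> y \<in> R"
    using conductor_exponent_exists ..
  then have m: "y \<in> R" if "y \<in> branch_ring" "\<And>i k. k < m i \<Longrightarrow> fps_nth (y i) k = 0" for y
    using that by simp
  have jump: "jump R l i" if "m i \<le> l i" for l i
  proof -
    have "unit_monomial i (l i) \<in> R"
      by (rule m[OF unit_monomial_in_branch_ring]) (use that in \<open>auto simp: unit_monomial_nth\<close>)
    then show ?thesis
      unfolding jump_def by (intro bexI[of _ "unit_monomial i (l i)"]) (auto simp: mem_filt_iff unit_monomial_nth)
  qed
  define L where "L = {l :: 'r \<Rightarrow> nat. \<forall>i. l i \<le> m i}"
  have "L = PiE UNIV (\<lambda>i. {..m i})" by (auto simp: L_def PiE_UNIV_domain)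
  then have finL: "finite L" by (simp add: finite_PiE)
  define g where "g q = (fst q, weight R (fst q - E (fst (snd q))) + int (snd (snd q)) + int (card (fst (snd q))), snd (snd q))"
    for q :: "('r \<Rightarrow> nat) \<times> 'r set \<times> nat"
  have "{x. numerator_coeff x \<noteq> 0} \<subseteq> g ` (L \<times> UNIV \<times> {..<CARD('r)})"
  proof
    fix x assume x: "x \<in> {x. numerator_coeff x \<noteq> 0}"
    obtain l n k where lnk: "x = (l, n, k)" by (cases x) auto
    have nz: "numerator_coeff (l, n, k) \<noteq> 0" using x lnk by simp
    have "l \<in> L"
      unfolding L_def
    proof (rule CollectI, rule allI, rule ccontr)
      fix i assume "\<not> l i \<le> m i"
      then have "m i < l i" by simp
      from numerator_coeff_0_if_large[where m = "m i" and i = i and l = l and n = n and k = k, OF jump this]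
      show False using nz by simp
    qed
    have "\<exists>J. PE1 R (l - E J, n - int (card J), k) \<noteq> 0"
    proof (rule ccontr)
      assume "\<not> ?thesis"
      then have z: "PE1 R (l - E J, n - int (card J), k) = 0" for J by blast
      show False using nz unfolding numerator_coeff_eq z by simp
    qed
    then obtain J where "PE1 R (l - E J, n - int (card J), k) \<noteq> 0" ..
    note PE1_nonzeroD[OF subspace_R this]
    then have "x = g (l, J, k)" "k < CARD('r)" by (auto simp: g_def lnk)
    then show "x \<in> g ` (L \<times> UNIV \<times> {..<CARD('r)})" using \<open>l \<in> L\<close> by (intro image_eqI[of _ _ "(l, J, k)"]) auto
  qed
  moreover have "finite (g ` (L \<times> (UNIV :: 'r set set) \<times> {..<CARD('r)}))" using finL by simp
  ultimately show ?thesis by (rule finite_subset)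
qed

text \<open>The coefficients of \<open>PE\<^sub>1(T, Q, -Q)\<close>.\<close>
definition PE1_subst :: "('r \<Rightarrow> int) \<Rightarrow> int \<Rightarrow> int" where
  "PE1_subst l v = (if \<forall>i. 0 \<le> l i
     then \<Sum>k<CARD('r). (- 1) ^ k * PE1 R (\<lambda>i. nat (l i), v - int k, k) else 0)"

text \<open>Multiplication by \<open>1 - Q\<^sup>2\<close> telescopes the sum over \<open>k\<close>.\<close>
lemma PE1_subst_diff:
  "PE1_subst l v - PE1_subst l (v - 2) =
     (\<Sum>J\<in>UNIV. (- 1) ^ card J * (if v = weight_int R (\<lambda>i. l i + int (E J i)) + int (card J) then 1 else 0))"
proof (cases "\<forall>i. 0 \<le> l i")
  case False
  then obtain i where i: "l i < 0" by (auto simp: not_le)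
  \<comment> \<open>With a negative entry the left side is 0. On the right a step in direction
    \<open>i\<close> lowers the extended weight by 1 and raises the cardinality by 1, so toggling
    \<open>i\<close> cancels all terms.\<close>
  have "(\<Sum>J\<in>UNIV. (- 1) ^ card J * (if v = weight_int R (\<lambda>i. l i + int (E J i)) + int (card J) then 1 else (0 :: int))) = 0"
  proof (rule sum_toggle[of i])
    fix J :: "'r set" assume J: "i \<notin> J"
    have "(\<lambda>j. l j + int (E (insert i J) j)) = (\<lambda>j. l j + int (E J j) + int (E {i} j))"
      using J by (auto simp: E_def fun_eq_iff)
    moreover have "\<not> 0 \<le> l i + int (E J i)" using i J by (simp add: E_def)
    ultimately have "weight_int R (\<lambda>j. l j + int (E (insert i J) j)) = weight_int R (\<lambda>j. l j + int (E J j)) - 1"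
      using weight_int_add_unit[of "\<lambda>j. l j + int (E J j)" i] by simp
    then show "(- 1) ^ card (insert i J) * (if v = weight_int R (\<lambda>j. l j + int (E (insert i J) j)) + int (card (insert i J)) then 1 else 0)
        = - ((- 1) ^ card J * (if v = weight_int R (\<lambda>j. l j + int (E J j)) + int (card J) then 1 else (0 :: int)))"
      using J by simp
  qed simp
  moreover have "PE1_subst l u = 0" for u unfolding PE1_subst_def by (rule if_not_P[OF False])
  ultimately show ?thesis by simp
next
  case True
  define m where "m = (\<lambda>i. nat (l i))"
  have lm: "l = (\<lambda>i. int (m i))" using True by (simp add: m_def fun_eq_iff)
  define w where "w = weight R m"
  define d where "d J = hilb R (m + E J) - hilb R m" for J
  have d: "hilb R (m + E J) = hilb R m + d J" "d J \<le> CARD('r)" for J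
    using hilb_add_E_le[OF subspace_R, of m J] by (simp_all add: d_def)
  \<comment> \<open>Under \<open>h = -Q\<close> the term of degree \<open>k\<close> carries
    \<open>Q\<close> to the power \<open>w + 2 k\<close>, and the sign of the rank formula
    disappears.\<close>
  define f where "f u k = (if u = w + 2 * int k then 1 else 0 :: int)" for u k
  have eul: "euler_coeff R m k = (\<Sum>J\<in>UNIV. if d J \<le> k then (- 1) ^ card J else 0)" for k
    unfolding euler_coeff_def d by (simp add: sum.If_cases)
  have ps: "PE1_subst l u = (\<Sum>k<CARD('r). f u k * euler_coeff R m k)" for u
  proof -
    have "PE1_subst l u = (\<Sum>k<CARD('r). (- 1) ^ k * PE1 R (m, u - int k, k))"
      using True by (simp add: PE1_subst_def m_def)
    also have "\<dots> = (\<Sum>k<CARD('r). f u k * euler_coeff R m k)"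
    proof (rule sum.cong)
      fix k
      have "(- 1) ^ k * ((- 1) ^ k * x) = (x :: int)" for x by (simp flip: mult.assoc power_mult_distrib)
      moreover have "u - int k = w + int k \<longleftrightarrow> u = w + 2 * int k" by linarith
      ultimately show "(- 1) ^ k * PE1 R (m, u - int k, k) = f u k * euler_coeff R m k"
        unfolding PE1_eq[OF subspace_R] f_def w_def[symmetric] by simp
    qed simp
    finally show ?thesis .
  qed
  have f2: "f (v - 2) k = f v (Suc k)" for k by (simp add: f_def)
  have "PE1_subst l v - PE1_subst l (v - 2) = (\<Sum>k<CARD('r). (f v k - f v (Suc k)) * euler_coeff R m k)"
    unfolding ps f2 by (simp add: sum_subtractf left_diff_distrib)
  also have "\<dots> = (\<Sum>k<CARD('r). \<Sum>J\<in>UNIV. (f v k - f v (Suc k)) * (if d J \<le> k then (- 1) ^ card J else 0))"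
    unfolding eul by (simp only: sum_distrib_left)
  also have "\<dots> = (\<Sum>J\<in>UNIV. \<Sum>k<CARD('r). (f v k - f v (Suc k)) * (if d J \<le> k then (- 1) ^ card J else 0))"
    by (rule sum.swap)
  \<comment> \<open>For fixed \<open>J\<close> the sum over \<open>k \<ge> d J\<close> telescopes.
    Apart from the sign, its upper boundary term does not depend on \<open>J\<close>, so it drops
    out of the alternating sum.\<close>
  also have "\<dots> = (\<Sum>J\<in>UNIV. (- 1) ^ card J * f v (d J) - f v CARD('r) * (- 1) ^ card J)"
  proof (rule sum.cong)
    fix J
    have "(\<Sum>k<CARD('r). (f v k - f v (Suc k)) * (if d J \<le> k then (- 1) ^ card J else 0))
        = (\<Sum>k\<in>{d J..<CARD('r)}. (f v k - f v (Suc k)) * (- 1) ^ card J)"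
      by (rule sum.mono_neutral_cong_right) auto
    also have "\<dots> = (- 1) ^ card J * - (\<Sum>k\<in>{d J..<CARD('r)}. f v (Suc k) - f v k)"
      by (simp add: sum_distrib_left sum_negf[symmetric] mult.commute)
    also have "(\<Sum>k\<in>{d J..<CARD('r)}. f v (Suc k) - f v k) = f v CARD('r) - f v (d J)"
      by (rule sum_Suc_diff'[OF d(2)])
    finally show "(\<Sum>k<CARD('r). (f v k - f v (Suc k)) * (if d J \<le> k then (- 1) ^ card J else 0))
        = (- 1) ^ card J * f v (d J) - f v CARD('r) * (- 1) ^ card J"
      by (simp add: algebra_simps)
  qed simp
  also have "\<dots> = (\<Sum>J\<in>UNIV. (- 1) ^ card J * f v (d J))"
    unfolding sum_subtractf sum_distrib_left[symmetric] sum_signs_UNIV by simp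
  \<comment> \<open>The exponent \<open>w + 2 d J\<close> is rewritten through the weight of the
    vertex \<open>l + E J\<close>, an expression that makes sense for negative entries as
    well.\<close>
  also have "\<dots> = (\<Sum>J\<in>UNIV. (- 1) ^ card J * (if v = weight_int R (\<lambda>i. l i + int (E J i)) + int (card J) then 1 else 0))"
  proof (rule sum.cong)
    fix J
    have "(\<lambda>i. l i + int (E J i)) = (\<lambda>i. int ((m + E J) i))" by (simp add: lm fun_eq_iff)
    then have "weight_int R (\<lambda>i. l i + int (E J i)) = weight R (m + E J)" by (simp only: weight_int_of_nat)
    also have "\<dots> = w + 2 * int (d J) - int (card J)"
      unfolding w_def weight_def d size_vec_add size_vec_E by simp
    finally show "(- 1) ^ card J * f v (d J) = (- 1) ^ card J * (if v = weight_int R (\<lambda>i. l i + int (E J i)) + int (card J) then 1 else 0)"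
      by (simp add: f_def)
  qed simp
  finally show ?thesis .
qed

lemma lookup_subst_numerator:
  assumes N: "Poly_Mapping.lookup N = numerator_coeff"
  shows "Poly_Mapping.lookup (subst_h N) (l, v) = (\<Sum>I\<in>UNIV. (- 1) ^ card I * PE1_subst (\<lambda>i. l i - int (E I i)) (v - int (card I)))"
proof -
  have "Poly_Mapping.lookup (subst_h N) (l, v) =
    (if \<forall>i. 0 \<le> l i then \<Sum>k<CARD('r). (- 1) ^ k * numerator_coeff (\<lambda>i. nat (l i), v - int k, k) else 0)"
    using lookup_subst_h[of "CARD('r)" N l v] numerator_coeff_0_if_degree unfolding N by blast
  also have "\<dots> = (\<Sum>I\<in>UNIV. (- 1) ^ card I * PE1_subst (\<lambda>i. l i - int (E I i)) (v - int (card I)))"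
  proof (cases "\<forall>i. 0 \<le> l i")
    case False
    then obtain i where i: "l i < 0" by (auto simp: not_le)
    have "PE1_subst (\<lambda>i. l i - int (E I i)) u = 0" for I u
    proof -
      have "\<not> 0 \<le> l i - int (E I i)" using i by simp
      then show ?thesis unfolding PE1_subst_def by meson
    qed
    then show ?thesis unfolding if_not_P[OF False] by simp
  next
    case True
    define m where "m = (\<lambda>i. nat (l i))"
    have lm: "l i = int (m i)" for i using True by (simp add: m_def)
    have ps: "PE1_subst (\<lambda>i. l i - int (E I i)) (v - int (card I)) =
       (if E I \<le> m then \<Sum>k<CARD('r). (- 1) ^ k * PE1 R (m - E I, v - int (card I) - int k, k) else 0)" for I
    proof -
      have "(\<forall>i. 0 \<le> l i - int (E I i)) \<longleftrightarrow> E I \<le> m" by (auto simp: lm le_fun_def)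
      moreover have "(\<lambda>i. nat (l i - int (E I i))) = m - E I"
      proof
        fix i
        show "nat (l i - int (E I i)) = (m - E I) i" by (simp add: lm nat_diff_distrib')
      qed
      ultimately show ?thesis unfolding PE1_subst_def by presburger
    qed
    have "(\<Sum>k<CARD('r). (- 1) ^ k * numerator_coeff (m, v - int k, k))
        = (\<Sum>k<CARD('r). \<Sum>I\<in>{I. E I \<le> m}. (- 1) ^ card I * ((- 1) ^ k * PE1 R (m - E I, v - int (card I) - int k, k)))"
    proof -
      have "v - int k - int (card I) = v - int (card I) - int k" for k and I :: "'r set" by simp
      then show ?thesis
        unfolding numerator_coeff_eq sum_distrib_left by (simp only: mult.left_commute)
    qed
    also have "\<dots> = (\<Sum>I\<in>{I. E I \<le> m}. \<Sum>k<CARD('r). (- 1) ^ card I * ((- 1) ^ k * PE1 R (m - E I, v - int (card I) - int k, k)))"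
      by (rule sum.swap)
    also have "\<dots> = (\<Sum>I\<in>{I. E I \<le> m}. (- 1) ^ card I * PE1_subst (\<lambda>i. l i - int (E I i)) (v - int (card I)))"
      by (intro sum.cong) (simp_all add: ps sum_distrib_left)
    also have "\<dots> = (\<Sum>I\<in>UNIV. (- 1) ^ card I * PE1_subst (\<lambda>i. l i - int (E I i)) (v - int (card I)))"
      by (rule sum.mono_neutral_left) (auto simp: ps)
    finally show ?thesis using True by (simp add: m_def)
  qed
  finally show ?thesis .
qed

text \<open>This cancels the factor \<open>1 - Q^2\<close>: a Laurent polynomial in \<open>Q\<close>
  annihilated by it is 0.\<close>

lemma periodic_finite_support:
  fixes D :: "int \<Rightarrow> int"
  assumes "finite {v. D v \<noteq> 0}" "\<And>v. D v = D (v - 2)"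
  shows "D v = 0"
proof (rule ccontr)
  assume nz: "D v \<noteq> 0"
  have "D (v - 2 * int k) = D v" for k
  proof (induction k)
    case (Suc k)
    then show ?case using assms(2)[of "v - 2 * int k"] by (simp add: algebra_simps)
  qed simp
  then have "range (\<lambda>k. v - 2 * int k) \<subseteq> {v. D v \<noteq> 0}" using nz by auto
  then have "finite (range (\<lambda>k :: nat. v - 2 * int k))" using assms(1) finite_subset by blast
  moreover have "inj (\<lambda>k :: nat. v - 2 * int k)" by (auto simp: inj_def)
  ultimately show False using finite_imageD infinite_UNIV_nat by blast
qed

text \<open>The factor \<open>1 - Q^2\<close> turns the numerator into the double sum
  \<open>G\<close> over \<open>I\<close> (from the denominator) and \<open>J\<close> (from
  \<open>PE1_subst_diff\<close>). Reflection at \<open>c\<close> sends \<open>l - E I + E J\<close>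
  to the same expression with \<open>I\<close> and \<open>J\<close> exchanged, and the signs are
  symmetric in both.\<close>

lemma numerator_symmetric:
  assumes N: "Poly_Mapping.lookup N = numerator_coeff" and c: "is_conductor R c" and G: "Gorenstein R"
  shows "Poly_Mapping.lookup (subst_h N) (\<lambda>i. int (c i) - l i, v) = Poly_Mapping.lookup (subst_h N) (l, v)"
proof -
  let ?S = "\<lambda>l v. Poly_Mapping.lookup (subst_h N) (l, v)"
  define G where "G l v = (\<Sum>I\<in>UNIV. \<Sum>J\<in>UNIV. (- 1) ^ card I * ((- 1) ^ card J *
    (if v = weight_int R (\<lambda>i. l i - int (E I i) + int (E J i)) + int (card J) + int (card I) then 1 else 0 :: int)))" for l v
  have diff: "?S l v - ?S l (v - 2) = G l v" for l v
  proof -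
    have *: "v - 2 - int (card I) = v - int (card I) - 2" for I :: "'r set" by simp
    have "?S l v - ?S l (v - 2) = (\<Sum>I\<in>UNIV. (- 1) ^ card I *
        (PE1_subst (\<lambda>i. l i - int (E I i)) (v - int (card I)) - PE1_subst (\<lambda>i. l i - int (E I i)) (v - int (card I) - 2)))"
      unfolding lookup_subst_numerator[OF N] sum_subtractf[symmetric] right_diff_distrib by (simp only: *)
    also have "\<dots> = G l v"
      unfolding PE1_subst_diff G_def sum_distrib_left
      by (intro sum.cong arg_cong2[of _ _ _ _ "(*)"] if_cong) auto
    finally show ?thesis .
  qed
  have sym: "G (\<lambda>i. int (c i) - l i) v = G l v" for v
  proof -
    have "weight_int R (\<lambda>i. int (c i) - l i - int (E I i) + int (E J i)) = weight_int R (\<lambda>i. l i - int (E J i) + int (E I i))" for I J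
    proof -
      have "(\<lambda>i. int (c i) - l i - int (E I i) + int (E J i)) = (\<lambda>i. int (c i) - (l i - int (E J i) + int (E I i)))"
        by (simp add: fun_eq_iff)
      then show ?thesis using weight_symmetric_if_Gorenstein[OF c G, of "\<lambda>i. l i - int (E J i) + int (E I i)"] by simp
    qed
    then have "G (\<lambda>i. int (c i) - l i) v = (\<Sum>I\<in>UNIV. \<Sum>J\<in>UNIV. (- 1) ^ card I * ((- 1) ^ card J *
      (if v = weight_int R (\<lambda>i. l i - int (E J i) + int (E I i)) + int (card J) + int (card I) then 1 else 0)))"
      unfolding G_def by simp
    also have "\<dots> = G l v"
      unfolding G_def by (subst sum.swap) (intro sum.cong refl, simp add: mult.left_commute add.commute add.left_commute)
    finally show ?thesis .
  qed
  have fin: "finite {v. ?S l v \<noteq> 0}" for l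
  proof (rule finite_subset)
    show "{v. ?S l v \<noteq> 0} \<subseteq> snd ` Poly_Mapping.keys (subst_h N)" by (force simp: in_keys_iff)
  qed simp
  define D where "D v = ?S (\<lambda>i. int (c i) - l i) v - ?S l v" for v
  have "D v = 0"
  proof (rule periodic_finite_support[of D])
    show "finite {v. D v \<noteq> 0}"
      by (rule finite_subset[OF _ finite_UnI[OF fin[of "\<lambda>i. int (c i) - l i"] fin[of l]]]) (auto simp: D_def)
    show "D v = D (v - 2)" for v
      using diff[of "\<lambda>i. int (c i) - l i" v] diff[of l v] sym[of v] unfolding D_def by linarith
  qed
  then show ?thesis by (simp add: D_def)
qed

end

theorem theorem1p3p1:
  fixes p :: "complex ^ 'n"
    and C :: "(complex ^ 'n) set"
    and Cs :: "'r :: finite \<Rightarrow> (complex ^ 'n) set"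
    and \<phi> :: "(complex ^ 'n \<Rightarrow> complex) \<Rightarrow> 'r \<Rightarrow> complex fps"
    and R :: "('r \<Rightarrow> complex fps) set"
  assumes "isolated_curve_singularity p C"
    and "irreducible_components p C Cs"
    and "integral_closure_map p Cs \<phi>"
    and "R = \<phi> ` hol_germs p"
  shows
    \<comment> \<open>(a): coefficient of \<open>t\<^sup>l\<close>, where \<^term>\<open>fls_X\<close> is the square root of \<open>q\<close>\<close>
    "(\<forall>l. finite {(n, k). PE1 R (l, n, k) \<noteq> 0} \<and>
       (\<Sum>(n, k) \<in> {(n, k). PE1 R (l, n, k) \<noteq> 0}.
          of_int (PE1 R (l, n, k)) * (\<Prod>i\<in>UNIV. fls_X ^ l i) * fls_X powi n * (- fls_X) ^ k)
       = (poly (map_poly of_int (motivic_coeff R l)) (fls_X ^ 2) :: rat fls)) \<and>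
     \<comment> \<open>(b)\<close>
     (\<forall>l. \<exists>!a. is_motivic_expansion R l a) \<and>
     \<comment> \<open>(c): coefficient of \<open>T\<^sup>l Q\<^sup>n h\<^sup>k\<close>\<close>
     (\<forall>a. (\<forall>l. is_motivic_expansion R l (a l)) \<longrightarrow>
       (\<forall>l n k. PE1 R (l, n, k) = Poly_Mapping.lookup
         (\<Sum>j | a l j \<noteq> 0.
            Poly_Mapping.single (l, weight R l, 0) (a l j) * (- (var_Q * var_h)) ^ j)
         (l, n, k))) \<and>
     \<comment> \<open>(d) and (e)\<close>
     (\<exists>N :: 'r TQh_poly.
       series_mult (\<Prod>i\<in>UNIV. 1 - var_T i * var_Q) (PE1 R) = Poly_Mapping.lookup N \<and>
       (\<forall>c. Gorenstein R \<and> is_conductor R c \<longrightarrow>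
          invert_T (subst_h N) = Poly_Mapping.single (\<lambda>i. - int (c i), 0) 1 * subst_h N))"
proof -
  interpret normalization p Cs \<phi> R
    using assms(3,4) by unfold_locales
  note R = subspace_R
  define N where "N = Abs_poly_mapping numerator_coeff"
  have N: "Poly_Mapping.lookup N = numerator_coeff"
    unfolding N_def by (rule lookup_Abs_poly_mapping[OF finite_numerator_support])
  have e: "invert_T (subst_h N) = Poly_Mapping.single (\<lambda>i. - int (c i), 0) 1 * subst_h N"
    if c: "Gorenstein R \<and> is_conductor R c" for c
  proof (rule poly_mapping_eqI)
    fix x :: "('r \<Rightarrow> int) \<times> int"
    obtain l v where x: "x = (l, v)" by (cases x)
    let ?l = "\<lambda>i. int (c i) + l i"
    \<comment> \<open>Writing the exponent as a shift by \<open>- c\<close> removes the monomial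
      factor and leaves the symmetry of single coefficients.\<close>
    have x': "x = (\<lambda>i. - int (c i), 0) + (?l, v)" by (simp add: x fun_eq_iff)
    have neg: "(\<lambda>i. int (c i) - ?l i) = - l" by (simp add: fun_eq_iff)
    have "Poly_Mapping.lookup (Poly_Mapping.single (\<lambda>i. - int (c i), 0) 1 * subst_h N) x = Poly_Mapping.lookup (subst_h N) (?l, v)"
      unfolding x' by (rule lookup_single_1_mult)
    also have "\<dots> = Poly_Mapping.lookup (subst_h N) (- l, v)"
      using numerator_symmetric[OF N, of c ?l v] c unfolding neg by simp
    also have "\<dots> = Poly_Mapping.lookup (invert_T (subst_h N)) x" unfolding x by (rule lookup_invert_T[symmetric])
    finally show "Poly_Mapping.lookup (invert_T (subst_h N)) x = Poly_Mapping.lookup (Poly_Mapping.single (\<lambda>i. - int (c i), 0) 1 * subst_h N) x" ..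
  qed
  show ?thesis
  proof (intro conjI)
    show "\<forall>l. finite {(n, k). PE1 R (l, n, k) \<noteq> 0} \<and>
       (\<Sum>(n, k) \<in> {(n, k). PE1 R (l, n, k) \<noteq> 0}.
          of_int (PE1 R (l, n, k)) * (\<Prod>i\<in>UNIV. fls_X ^ l i) * fls_X powi n * (- fls_X) ^ k)
       = (poly (map_poly of_int (motivic_coeff R l)) (fls_X ^ 2) :: rat fls)"
      by (intro allI part_a[OF R])
    show "\<forall>l. \<exists>!a. is_motivic_expansion R l a"
      by (simp add: is_motivic_expansion_iff[OF R])
    show "\<forall>a. (\<forall>l. is_motivic_expansion R l (a l)) \<longrightarrow>
       (\<forall>l n k. PE1 R (l, n, k) = Poly_Mapping.lookup
         (\<Sum>j | a l j \<noteq> 0.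
            Poly_Mapping.single (l, weight R l, 0) (a l j) * (- (var_Q * var_h)) ^ j)
         (l, n, k))"
    proof (intro allI impI)
      fix a l n k
      assume "\<forall>l. is_motivic_expansion R l (a l)"
      then have "a l = euler_coeff R l" by (simp add: is_motivic_expansion_iff[OF R])
      then show "PE1 R (l, n, k) = Poly_Mapping.lookup
         (\<Sum>j | a l j \<noteq> 0.
            Poly_Mapping.single (l, weight R l, 0) (a l j) * (- (var_Q * var_h)) ^ j)
         (l, n, k)" by (rule part_c[OF R])
    qed
    show "\<exists>N :: 'r TQh_poly.
       series_mult (\<Prod>i\<in>UNIV. 1 - var_T i * var_Q) (PE1 R) = Poly_Mapping.lookup N \<and>
       (\<forall>c. Gorenstein R \<and> is_conductor R c \<longrightarrow>
          invert_T (subst_h N) = Poly_Mapping.single (\<lambda>i. - int (c i), 0) 1 * subst_h N)"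
      using N e unfolding numerator_coeff_def by (intro exI[of _ N]) simp
  qed
qed

end
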